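(* (Subset Collection.) In the v-set interpretation: let $x,y$ be sets and $\psi(a,b,c)$ an arbitrary ternary relation (any formula of the ambient system). Then there is a set $z$ such that for every set $c$, if every element $a$ of $x$ has some element $b$ of $y$ with $\psi(a,b,c)$, then $z$ contains a set $w\subseteq y$ such that every element $a$ of $x$ has some $b\in w$ with $\psi(a,b,c)$, and every element $b$ of $w$ has some $a\in x$ with $\psi(a,b,c)$.
   Context: Work in Heyting arithmetic extended by unary predicates $\mathcal V$ ("v-set"), $\mathcal M$ ("Meaningful condition"), $\mathcal T$ ("True condition"). $\langle\cdot,\cdot\rangle$ is Cantor pairing with projections $(\cdot)_L,(\cdot)_R$; $en$ is Kleene application, $en\!\downarrow$ means it is defined. Write $\mathrm{cd}_x(n)=(xn)_R$, $\mathrm{el}_x(n)=(xn)_L$. $\Xi(f,g)$ is a fixed primitive recursive injective coding of pairs. Axioms: (V1) $\forall x\,[\forall n\,(xn\!\downarrow\wedge\mathcal M(\mathrm{cd}_x(n))\wedge(\mathcal T(\mathrm{cd}_x(n))\to\mathcal V(\mathrm{el}_x(n))))]\to\mathcal V(x)$; (V2) for every formula $\phi$: if the antecedent of (V1) with $\mathcal V$ replaced by $\phi$ implies $\phi(x)$ for all $x$, then $\forall x(\mathcal V(x)\to\phi(x))$; (X1) $\mathcal M(\Xi(f,g))\to(\mathcal T(\Xi(f,g))\leftrightarrow\forall n(fn\!\downarrow\wedge\mathcal T(fn)\to gn\!\downarrow\wedge\mathcal T(gn)))$; (X2) if $\forall n(fn\!\downarrow\to\mathcal M(fn))$ and $\forall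 n(fn\!\downarrow\wedge gn\!\downarrow\wedge\mathcal T(fn)\to\mathcal M(gn))$ then $\mathcal M(\Xi(f,g))$; ($\mathsf{ECT}_V$) $(\forall n(\phi(n)\to\exists m\,\psi(n,m)))\to\exists e\,\forall n(\phi(n)\to en\!\downarrow\wedge\psi(n,en))$ for arbitrary $\psi$ and almost-negative $\phi$ (built from $\Sigma_1$ formulas and atoms $\mathcal V(t),\mathcal M(t),\mathcal T(t)$ by $\wedge,\to,\forall_{\mathbb N}$). Sets are interpreted as v-sets (numbers $x$ with $\mathcal V(x)$); $EL(x)=\{\mathrm{el}_x(n):\mathcal T(\mathrm{cd}_x(n))\}$. Set equality is extensional equality $\simeq$ of v-sets, characterized by $x\simeq y\iff(\forall a\in EL(x)\exists b\in EL(y)\,a\simeq b)\wedge(\forall b\in EL(y)\exists a\in EL(x)\,b\simeq a)$. Unbounded set quantifiers range over v-sets, bounded quantifiers range over $EL(x)$, and $x\in y$ means $\exists y'\in EL(y)\,x\simeq y'$. A set-theoretic statement holds in the v-set interpretation if its interpretation is provable in this system. *)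

theory Defs
  imports Main
begin

section \<open>Primitive recursive function symbols\<close>

text \<open>A symbol may be applied to any number of arguments: missing arguments are read as 0,
  surplus ones are ignored. Hence no arity discipline is needed and every term denotes.
  In \<open>PRec g h\<close> the first argument is the recursion argument, and \<open>h\<close> receives the predecessor,
  the previous value and the parameters, in this order.\<close>

datatype prsym =
    PZero
  | PSucc
  | PProj nat
  | PComp prsym "prsym list"
  | PRec prsym prsym

definition arg :: "'a \<Rightarrow> 'a list \<Rightarrow> nat \<Rightarrow> 'a" where
  "arg d xs i = (if i < length xs then xs ! i else d)"

fun pr_eval :: "prsym \<Rightarrow> nat list \<Rightarrow> nat" where
  "pr_eval PZero xs = 0"
| "pr_eval PSucc xs = Suc (arg 0 xs 0)"
| "pr_eval (PProj i) xs = arg 0 xs i"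
| "pr_eval (PComp f gs) xs = pr_eval f (map (\<lambda>g. pr_eval g xs) gs)"
| "pr_eval (PRec g h) xs =
     rec_nat (pr_eval g (tl xs)) (\<lambda>k r. pr_eval h (k # r # tl xs)) (arg 0 xs 0)"


section \<open>Terms and formulas\<close>

text \<open>Variables are de Bruijn indices; quantifiers bind index 0.\<close>

datatype tm = Var nat | Fn prsym "tm list"

datatype fm =
    Falsum
  | Equ tm tm  (infix \<open>\<doteq>\<close> 60)
  | Vset tm
  | Meaningful tm
  | Truth tm
  | Conj fm fm  (infixr \<open>\<^bold>\<and>\<close> 45)
  | Disj fm fm  (infixr \<open>\<^bold>\<or>\<close> 40)
  | Impl fm fm  (infixr \<open>\<^bold>\<longrightarrow>\<close> 35)
  | Forall fm
  | Exists fm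

abbreviation Iff :: "fm \<Rightarrow> fm \<Rightarrow> fm"  (infix \<open>\<^bold>\<longleftrightarrow>\<close> 30) where
  "\<phi> \<^bold>\<longleftrightarrow> \<psi> \<equiv> (\<phi> \<^bold>\<longrightarrow> \<psi>) \<^bold>\<and> (\<psi> \<^bold>\<longrightarrow> \<phi>)"

primrec subst_tm :: "(nat \<Rightarrow> tm) \<Rightarrow> tm \<Rightarrow> tm" where
  "subst_tm \<sigma> (Var i) = \<sigma> i"
| "subst_tm \<sigma> (Fn f ts) = Fn f (map (subst_tm \<sigma>) ts)"

abbreviation lift_tm :: "tm \<Rightarrow> tm"  (\<open>\<up>\<close>) where
  "\<up> \<equiv> subst_tm (\<lambda>i. Var (Suc i))"

definition up :: "(nat \<Rightarrow> tm) \<Rightarrow> nat \<Rightarrow> tm" where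
  "up \<sigma> = case_nat (Var 0) (\<lambda>i. \<up> (\<sigma> i))"

primrec subst :: "(nat \<Rightarrow> tm) \<Rightarrow> fm \<Rightarrow> fm" where
  "subst \<sigma> Falsum = Falsum"
| "subst \<sigma> (s \<doteq> t) = (subst_tm \<sigma> s \<doteq> subst_tm \<sigma> t)"
| "subst \<sigma> (Vset t) = Vset (subst_tm \<sigma> t)"
| "subst \<sigma> (Meaningful t) = Meaningful (subst_tm \<sigma> t)"
| "subst \<sigma> (Truth t) = Truth (subst_tm \<sigma> t)"
| "subst \<sigma> (\<phi> \<^bold>\<and> \<psi>) = (subst \<sigma> \<phi> \<^bold>\<and> subst \<sigma> \<psi>)"
| "subst \<sigma> (\<phi> \<^bold>\<or> \<psi>) = (subst \<sigma> \<phi> \<^bold>\<or> subst \<sigma> \<psi>)"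
| "subst \<sigma> (\<phi> \<^bold>\<longrightarrow> \<psi>) = (subst \<sigma> \<phi> \<^bold>\<longrightarrow> subst \<sigma> \<psi>)"
| "subst \<sigma> (Forall \<phi>) = Forall (subst (up \<sigma>) \<phi>)"
| "subst \<sigma> (Exists \<phi>) = Exists (subst (up \<sigma>) \<phi>)"

abbreviation lift :: "fm \<Rightarrow> fm" where
  "lift \<equiv> subst (\<lambda>i. Var (Suc i))"

definition inst :: "fm \<Rightarrow> tm \<Rightarrow> fm" where
  "inst \<phi> t = subst (case_nat t Var) \<phi>"

text \<open>\<open>at \<phi> ts k\<close>: the indices \<open>0, 1, \<dots>\<close> of \<open>\<phi>\<close> are replaced by the terms \<open>ts\<close>; the remaining
  free variables, which are the parameters of \<open>\<phi>\<close>, are moved below \<open>k\<close> new binders.\<close>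

definition at :: "fm \<Rightarrow> tm list \<Rightarrow> nat \<Rightarrow> fm" where
  "at \<phi> ts k = subst (\<lambda>i. if i < length ts then ts ! i else Var (i - length ts + k)) \<phi>"


section \<open>Cantor pairing\<close>

abbreviation zero :: tm where "zero \<equiv> Fn PZero []"
abbreviation suc :: "tm \<Rightarrow> tm" where "suc t \<equiv> Fn PSucc [t]"
abbreviation one :: tm where "one \<equiv> suc zero"

text \<open>Explicit definition of a symbol by a term: \<open>Var i\<close> stands for argument number \<open>i\<close>.\<close>

primrec fun_of :: "tm \<Rightarrow> prsym" where
  "fun_of (Var i) = PProj i"
| "fun_of (Fn f ts) = PComp f (map fun_of ts)"

definition pred_pr :: prsym where "pred_pr = PRec PZero (PProj 0)"
definition add_pr :: prsym where "add_pr = PRec (PProj 0) (fun_of (suc (Var 1)))"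
definition mult_pr :: prsym where
  "mult_pr = PRec PZero (fun_of (Fn add_pr [Var 1, Var 2]))"
definition monus_pr :: prsym where
  "monus_pr = fun_of (Fn (PRec (PProj 0) (fun_of (Fn pred_pr [Var 1]))) [Var 1, Var 0])"

abbreviation prd :: "tm \<Rightarrow> tm" where "prd t \<equiv> Fn pred_pr [t]"
abbreviation add :: "tm \<Rightarrow> tm \<Rightarrow> tm"  (infixl \<open>\<oplus>\<close> 65) where "s \<oplus> t \<equiv> Fn add_pr [s, t]"
abbreviation mult :: "tm \<Rightarrow> tm \<Rightarrow> tm"  (infixl \<open>\<otimes>\<close> 70) where "s \<otimes> t \<equiv> Fn mult_pr [s, t]"
abbreviation monus :: "tm \<Rightarrow> tm \<Rightarrow> tm"  (infixl \<open>\<ominus>\<close> 65) where "s \<ominus> t \<equiv> Fn monus_pr [s, t]"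

definition tri_pr :: prsym where "tri_pr = PRec PZero (fun_of (suc (Var 0) \<oplus> Var 1))"

definition pair_pr :: prsym where
  "pair_pr = fun_of (Fn tri_pr [Var 0 \<oplus> Var 1] \<oplus> Var 1)"

text \<open>\<open>diag_pr\<close> maps \<open>z\<close> to the largest \<open>s\<close> whose triangular number is at most \<open>z\<close>.\<close>

definition diag_pr :: prsym where
  "diag_pr = PRec PZero
     (fun_of (Var 1 \<oplus> (one \<ominus> (Fn tri_pr [suc (Var 1)] \<ominus> suc (Var 0)))))"
definition right_pr :: prsym where
  "right_pr = fun_of (Var 0 \<ominus> Fn tri_pr [Fn diag_pr [Var 0]])"
definition left_pr :: prsym where
  "left_pr = fun_of (Fn diag_pr [Var 0] \<ominus> Fn right_pr [Var 0])"

abbreviation pr :: "tm \<Rightarrow> tm \<Rightarrow> tm" where "pr s t \<equiv> Fn pair_pr [s, t]"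
abbreviation lft :: "tm \<Rightarrow> tm" where "lft t \<equiv> Fn left_pr [t]"
abbreviation rgt :: "tm \<Rightarrow> tm" where "rgt t \<equiv> Fn right_pr [t]"


section \<open>Kleene application\<close>

text \<open>Indices of unary partial recursive functions, with \<open>\<langle>_,_\<rangle>\<close> Cantor pairing:
  \<^item> \<open>\<langle>0,_\<rangle>\<close>, \<open>\<langle>1,_\<rangle>\<close>, \<open>\<langle>2,_\<rangle>\<close>, \<open>\<langle>3,_\<rangle>\<close>: zero, successor, left and right projection;
  \<^item> \<open>\<langle>4,\<langle>a,b\<rangle>\<rangle> n = \<langle>a n, b n\<rangle>\<close> and \<open>\<langle>5,\<langle>a,b\<rangle>\<rangle> n = a (b n)\<close>;
  \<^item> \<open>e = \<langle>6,\<langle>a,b\<rangle>\<rangle>\<close>: \<open>e \<langle>p,0\<rangle> = a p\<close> and \<open>e \<langle>p,k+1\<rangle> = b \<langle>\<langle>p,k\<rangle>, e \<langle>p,k\<rangle>\<rangle>\<close>;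
  \<^item> \<open>e = \<langle>7,a\<rangle>\<close>: \<open>e \<langle>p,k\<rangle>\<close> is the least \<open>j \<ge> k\<close> with \<open>a \<langle>p,j\<rangle> = 0\<close> (and \<open>a \<langle>p,i\<rangle>\<close> defined
    for \<open>k \<le> i < j\<close>).
  The identity is \<open>\<langle>4,\<langle>\<langle>2,0\<rangle>,\<langle>3,0\<rangle>\<rangle>\<rangle>\<close>, so these are closed under ordinary minimisation.

  A computation tree \<open>\<langle>\<langle>e,n\<rangle>,\<langle>m,\<langle>z1,z2\<rangle>\<rangle>\<rangle>\<close> has conclusion \<open>e n = m\<close> and immediate subtrees
  \<open>z1\<close>, \<open>z2\<close> (irrelevant if the rule has fewer premises). \<open>check_pr\<close> takes a tree \<open>z\<close> and the list
  of the values of \<open>comp_pr\<close> at \<open>z-1, \<dots>, 0\<close>. Only rules with \<open>e > 0\<close> have premises, and then the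
  subtrees are smaller than \<open>z\<close>.\<close>

definition eq_pr :: prsym where
  "eq_pr = fun_of (one \<ominus> ((Var 0 \<ominus> Var 1) \<oplus> (Var 1 \<ominus> Var 0)))"
abbreviation eqt :: "tm \<Rightarrow> tm \<Rightarrow> tm" where "eqt s t \<equiv> Fn eq_pr [s, t]"

primrec num :: "nat \<Rightarrow> tm" where
  "num 0 = zero"
| "num (Suc k) = suc (num k)"

definition drop_pr :: prsym where
  "drop_pr = PRec (PProj 0) (fun_of (rgt (Var 1)))"

definition check_pr :: prsym where
  "check_pr =
    (let z = Var 0; h = Var 1;
         e = lft (lft z); n = rgt (lft z); m = lft (rgt z);
         z1 = lft (rgt (rgt z)); z2 = rgt (rgt (rgt z));
         d = rgt e; a = lft d; b = rgt d; p = lft n; k = rgt n;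
         val = (\<lambda>u. lft (rgt u));
         ok = (\<lambda>u f j. lft (Fn drop_pr [z \<ominus> suc u, h]) \<otimes> eqt (lft u) (pr f j));
         rule = (\<lambda>i c. eqt (lft e) (num i) \<otimes> c)
     in fun_of
       (rule 0 (eqt m zero)
      \<oplus> rule 1 (eqt m (suc n))
      \<oplus> rule 2 (eqt m (lft n))
      \<oplus> rule 3 (eqt m (rgt n))
      \<oplus> rule 4 (ok z1 a n \<otimes> ok z2 b n \<otimes> eqt m (pr (val z1) (val z2)))
      \<oplus> rule 5 (ok z1 b n \<otimes> ok z2 a (val z1) \<otimes> eqt m (val z2))
      \<oplus> rule 6 (eqt k zero \<otimes> ok z1 a p \<otimes> eqt m (val z1)
                \<oplus> (one \<ominus> eqt k zero) \<otimes> ok z1 e (pr p (prd k))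
                   \<otimes> ok z2 b (pr (pr p (prd k)) (val z1)) \<otimes> eqt m (val z2))
      \<oplus> rule 7 (ok z1 d n \<otimes>
                (eqt (val z1) zero \<otimes> eqt m k
                \<oplus> (one \<ominus> eqt (val z1) zero) \<otimes> ok z2 e (pr p (suc k)) \<otimes> eqt m (val z2)))))"

definition hist_pr :: prsym where
  "hist_pr = PRec PZero (fun_of (pr (Fn check_pr [Var 0, Var 1]) (Var 1)))"

definition comp_pr :: prsym where
  "comp_pr = fun_of (Fn check_pr [Var 0, Fn hist_pr [Var 0]])"

text \<open>\<open>App e n m\<close> is \<open>\<exists>z (T(e,n,z) \<and> U(z) = m)\<close> with Kleene's \<open>T\<close> and \<open>U\<close>, i.e. \<open>e n = m\<close>.
  A formula \<open>\<phi>(e n)\<close> with a partial term is always read as \<open>\<exists>m (e n = m \<and> \<phi>(m))\<close>, written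
  \<open>with_app e n \<phi>\<close>, where \<open>m\<close> is index 0 of \<open>\<phi>\<close>.\<close>

definition App :: "tm \<Rightarrow> tm \<Rightarrow> tm \<Rightarrow> fm" where
  "App e n m = Exists (Fn comp_pr [Var 0] \<doteq> one
                \<^bold>\<and> lft (Var 0) \<doteq> pr (\<up> e) (\<up> n) \<^bold>\<and> lft (rgt (Var 0)) \<doteq> \<up> m)"

definition with_app :: "tm \<Rightarrow> tm \<Rightarrow> fm \<Rightarrow> fm" where
  "with_app e n \<phi> = Exists (App (\<up> e) (\<up> n) (Var 0) \<^bold>\<and> \<phi>)"

definition defined :: "tm \<Rightarrow> tm \<Rightarrow> fm" where
  "defined e n = Exists (App (\<up> e) (\<up> n) (Var 0))"


section \<open>The formal system\<close>

inductive quantifier_free :: "fm \<Rightarrow> bool" where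
  "quantifier_free Falsum"
| "quantifier_free (s \<doteq> t)"
| "quantifier_free \<phi> \<Longrightarrow> quantifier_free \<psi> \<Longrightarrow> quantifier_free (\<phi> \<^bold>\<and> \<psi>)"
| "quantifier_free \<phi> \<Longrightarrow> quantifier_free \<psi> \<Longrightarrow> quantifier_free (\<phi> \<^bold>\<or> \<psi>)"
| "quantifier_free \<phi> \<Longrightarrow> quantifier_free \<psi> \<Longrightarrow> quantifier_free (\<phi> \<^bold>\<longrightarrow> \<psi>)"

text \<open>Bounded quantifiers are not needed here, as all primitive recursive functions have symbols.\<close>

inductive sigma1 :: "fm \<Rightarrow> bool" where
  "quantifier_free \<phi> \<Longrightarrow> sigma1 \<phi>"
| "sigma1 \<phi> \<Longrightarrow> sigma1 (Exists \<phi>)"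

inductive almost_negative :: "fm \<Rightarrow> bool" where
  "sigma1 \<phi> \<Longrightarrow> almost_negative \<phi>"
| "almost_negative (Vset t)"
| "almost_negative (Meaningful t)"
| "almost_negative (Truth t)"
| "almost_negative \<phi> \<Longrightarrow> almost_negative \<psi> \<Longrightarrow> almost_negative (\<phi> \<^bold>\<and> \<psi>)"
| "almost_negative \<phi> \<Longrightarrow> almost_negative \<psi> \<Longrightarrow> almost_negative (\<phi> \<^bold>\<longrightarrow> \<psi>)"
| "almost_negative \<phi> \<Longrightarrow> almost_negative (Forall \<phi>)"

text \<open>\<open>closed_under \<phi>\<close>, with \<open>x\<close> at index 0: the antecedent of (V1) for \<open>x\<close>, with the predicate
  \<open>\<V>\<close> replaced by \<open>\<phi>\<close> (whose own argument is its index 0). Inside, index 0 is the value \<open>x n\<close>,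
  index 1 is \<open>n\<close>, index 2 is \<open>x\<close>.\<close>

definition closed_under :: "fm \<Rightarrow> fm" where
  "closed_under \<phi> = Forall (with_app (Var 1) (Var 0)
     (Meaningful (rgt (Var 0)) \<^bold>\<and> (Truth (rgt (Var 0)) \<^bold>\<longrightarrow> at \<phi> [lft (Var 0)] 3)))"

text \<open>The parameter \<open>\<Xi>\<close> is the symbol for the fixed coding of pairs.\<close>

inductive axiom_of :: "prsym \<Rightarrow> fm \<Rightarrow> bool" for \<Xi> :: prsym where
  zero_eq: "axiom_of \<Xi> (Fn PZero ts \<doteq> zero)"
| succ_eq: "axiom_of \<Xi> (Fn PSucc ts \<doteq> suc (arg zero ts 0))"
| proj_eq: "axiom_of \<Xi> (Fn (PProj i) ts \<doteq> arg zero ts i)"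
| comp_eq: "axiom_of \<Xi> (Fn (PComp f gs) ts \<doteq> Fn f (map (\<lambda>g. Fn g ts) gs))"
| rec_nil: "axiom_of \<Xi> (Fn (PRec g h) [] \<doteq> Fn (PRec g h) [zero])"
| rec_zero: "axiom_of \<Xi> (Fn (PRec g h) (zero # ts) \<doteq> Fn g ts)"
| rec_suc: "axiom_of \<Xi> (Fn (PRec g h) (suc t # ts) \<doteq> Fn h (t # Fn (PRec g h) (t # ts) # ts))"
| suc_not_zero: "axiom_of \<Xi> (suc t \<doteq> zero \<^bold>\<longrightarrow> Falsum)"
| suc_inj: "axiom_of \<Xi> (suc s \<doteq> suc t \<^bold>\<longrightarrow> s \<doteq> t)"
| induction: "axiom_of \<Xi>
    (inst \<phi> zero \<^bold>\<and> Forall (\<phi> \<^bold>\<longrightarrow> at \<phi> [suc (Var 0)] 1) \<^bold>\<longrightarrow> Forall \<phi>)"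
| V1: "axiom_of \<Xi> (Forall (closed_under (Vset (Var 0)) \<^bold>\<longrightarrow> Vset (Var 0)))"
| V2: "axiom_of \<Xi> (Forall (closed_under \<phi> \<^bold>\<longrightarrow> \<phi>) \<^bold>\<longrightarrow> Forall (Vset (Var 0) \<^bold>\<longrightarrow> \<phi>))"
| X1: "axiom_of \<Xi>
    (Meaningful (Fn \<Xi> [f, g]) \<^bold>\<longrightarrow>
      (Truth (Fn \<Xi> [f, g]) \<^bold>\<longleftrightarrow>
        Forall (with_app (\<up> f) (Var 0) (Truth (Var 0)) \<^bold>\<longrightarrow> with_app (\<up> g) (Var 0) (Truth (Var 0)))))"
| X2: "axiom_of \<Xi>
    (Forall (defined (\<up> f) (Var 0) \<^bold>\<longrightarrow> with_app (\<up> f) (Var 0) (Meaningful (Var 0)))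
     \<^bold>\<and> Forall (defined (\<up> f) (Var 0) \<^bold>\<and> defined (\<up> g) (Var 0) \<^bold>\<and> with_app (\<up> f) (Var 0) (Truth (Var 0))
               \<^bold>\<longrightarrow> with_app (\<up> g) (Var 0) (Meaningful (Var 0)))
     \<^bold>\<longrightarrow> Meaningful (Fn \<Xi> [f, g]))"
\<comment> \<open>ECT: index 0 of \<open>\<phi>\<close> is \<open>n\<close>; indices 0, 1 of \<open>\<psi>\<close> are \<open>m\<close>, \<open>n\<close>.\<close>
| ECT: "almost_negative \<phi> \<Longrightarrow> axiom_of \<Xi>
    (Forall (\<phi> \<^bold>\<longrightarrow> Exists \<psi>) \<^bold>\<longrightarrow>
     Exists (Forall (at \<phi> [Var 0] 2 \<^bold>\<longrightarrow>
       with_app (Var 1) (Var 0) (at \<psi> [Var 0, Var 1] 3))))"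

text \<open>Intuitionistic natural deduction with equality.\<close>

inductive derives :: "prsym \<Rightarrow> fm list \<Rightarrow> fm \<Rightarrow> bool"  (\<open>_; _ \<turnstile> _\<close> [51, 51, 20] 20)
  for \<Xi> :: prsym where
  Assm: "\<phi> \<in> set \<Gamma> \<Longrightarrow> \<Xi>; \<Gamma> \<turnstile> \<phi>"
| Axiom: "axiom_of \<Xi> \<phi> \<Longrightarrow> \<Xi>; \<Gamma> \<turnstile> \<phi>"
| FalsumE: "\<Xi>; \<Gamma> \<turnstile> Falsum \<Longrightarrow> \<Xi>; \<Gamma> \<turnstile> \<phi>"
| ConjI: "\<Xi>; \<Gamma> \<turnstile> \<phi> \<Longrightarrow> \<Xi>; \<Gamma> \<turnstile> \<psi> \<Longrightarrow> \<Xi>; \<Gamma> \<turnstile> \<phi> \<^bold>\<and> \<psi>"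
| ConjE1: "\<Xi>; \<Gamma> \<turnstile> \<phi> \<^bold>\<and> \<psi> \<Longrightarrow> \<Xi>; \<Gamma> \<turnstile> \<phi>"
| ConjE2: "\<Xi>; \<Gamma> \<turnstile> \<phi> \<^bold>\<and> \<psi> \<Longrightarrow> \<Xi>; \<Gamma> \<turnstile> \<psi>"
| DisjI1: "\<Xi>; \<Gamma> \<turnstile> \<phi> \<Longrightarrow> \<Xi>; \<Gamma> \<turnstile> \<phi> \<^bold>\<or> \<psi>"
| DisjI2: "\<Xi>; \<Gamma> \<turnstile> \<psi> \<Longrightarrow> \<Xi>; \<Gamma> \<turnstile> \<phi> \<^bold>\<or> \<psi>"
| DisjE: "\<Xi>; \<Gamma> \<turnstile> \<phi> \<^bold>\<or> \<psi> \<Longrightarrow> \<Xi>; \<phi> # \<Gamma> \<turnstile> \<chi> \<Longrightarrow> \<Xi>; \<psi> # \<Gamma> \<turnstile> \<chi> \<Longrightarrow> \<Xi>; \<Gamma> \<turnstile> \<chi>"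
| ImplI: "\<Xi>; \<phi> # \<Gamma> \<turnstile> \<psi> \<Longrightarrow> \<Xi>; \<Gamma> \<turnstile> \<phi> \<^bold>\<longrightarrow> \<psi>"
| ImplE: "\<Xi>; \<Gamma> \<turnstile> \<phi> \<^bold>\<longrightarrow> \<psi> \<Longrightarrow> \<Xi>; \<Gamma> \<turnstile> \<phi> \<Longrightarrow> \<Xi>; \<Gamma> \<turnstile> \<psi>"
| ForallI: "\<Xi>; map lift \<Gamma> \<turnstile> \<phi> \<Longrightarrow> \<Xi>; \<Gamma> \<turnstile> Forall \<phi>"
| ForallE: "\<Xi>; \<Gamma> \<turnstile> Forall \<phi> \<Longrightarrow> \<Xi>; \<Gamma> \<turnstile> inst \<phi> t"
| ExistsI: "\<Xi>; \<Gamma> \<turnstile> inst \<phi> t \<Longrightarrow> \<Xi>; \<Gamma> \<turnstile> Exists \<phi>"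
| ExistsE: "\<Xi>; \<Gamma> \<turnstile> Exists \<phi> \<Longrightarrow> \<Xi>; \<phi> # map lift \<Gamma> \<turnstile> lift \<chi> \<Longrightarrow> \<Xi>; \<Gamma> \<turnstile> \<chi>"
| EquI: "\<Xi>; \<Gamma> \<turnstile> t \<doteq> t"
| EquE: "\<Xi>; \<Gamma> \<turnstile> s \<doteq> t \<Longrightarrow> \<Xi>; \<Gamma> \<turnstile> inst \<phi> s \<Longrightarrow> \<Xi>; \<Gamma> \<turnstile> inst \<phi> t"

definition injective_pair_coding :: "prsym \<Rightarrow> bool" where
  "injective_pair_coding \<Xi> \<longleftrightarrow>
     (\<forall>a b c d. pr_eval \<Xi> [a, b] = pr_eval \<Xi> [c, d] \<longrightarrow> a = c \<and> b = d)"


section \<open>The v-set interpretation\<close>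

text \<open>\<open>EL x a\<close> is \<open>a \<in> EL(x)\<close>. The quantifiers bind index 0 of their last argument.\<close>

definition EL :: "tm \<Rightarrow> tm \<Rightarrow> fm" where
  "EL x a = Exists (with_app (\<up> x) (Var 0) (Truth (rgt (Var 0)) \<^bold>\<and> \<up> (\<up> a) \<doteq> lft (Var 0)))"

definition all_sets :: "fm \<Rightarrow> fm" where "all_sets \<phi> = Forall (Vset (Var 0) \<^bold>\<longrightarrow> \<phi>)"
definition some_set :: "fm \<Rightarrow> fm" where "some_set \<phi> = Exists (Vset (Var 0) \<^bold>\<and> \<phi>)"
definition all_in :: "tm \<Rightarrow> fm \<Rightarrow> fm" where "all_in x \<phi> = Forall (EL (\<up> x) (Var 0) \<^bold>\<longrightarrow> \<phi>)"
definition some_in :: "tm \<Rightarrow> fm \<Rightarrow> fm" where "some_in x \<phi> = Exists (EL (\<up> x) (Var 0) \<^bold>\<and> \<phi>)"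

text \<open>A formula \<open>E\<close> used as a binary relation has its arguments at indices 0 and 1; any further
  index is set to 0, so that \<open>E\<close> has no parameters.\<close>

definition rel2 :: "fm \<Rightarrow> tm \<Rightarrow> tm \<Rightarrow> fm" where
  "rel2 E s t = subst (\<lambda>i. if i = 0 then s else if i = 1 then t else zero) E"

text \<open>\<open>E\<close> defines extensional equality of v-sets: its characterization is provable. By (V2) it
  determines \<open>E\<close> on v-sets up to provable equivalence.\<close>

definition extensional_equality :: "prsym \<Rightarrow> fm \<Rightarrow> bool" where
  "extensional_equality \<Xi> E \<longleftrightarrow>
    (\<Xi>; [] \<turnstile> all_sets (all_sets
       (let x = Var 1; y = Var 0 in
        rel2 E x y \<^bold>\<longleftrightarrow>
          (all_in x (some_in (\<up> y) (rel2 E (Var 1) (Var 0)))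
           \<^bold>\<and> all_in y (some_in (\<up> x) (rel2 E (Var 1) (Var 0)))))))"

definition set_mem :: "fm \<Rightarrow> tm \<Rightarrow> tm \<Rightarrow> fm" where
  "set_mem E x y = some_in y (rel2 E (\<up> x) (Var 0))"

definition subset_fm :: "fm \<Rightarrow> tm \<Rightarrow> tm \<Rightarrow> fm" where
  "subset_fm E w y = all_in w (set_mem E (Var 0) (\<up> y))"

text \<open>Indices 0, 1, 2 of \<open>\<psi>\<close> are \<open>a\<close>, \<open>b\<close>, \<open>c\<close>; the others are parameters. The variables bound at
  each place are listed in the comments, index 0 first.\<close>

definition subset_collection :: "fm \<Rightarrow> fm \<Rightarrow> fm" where
  "subset_collection E \<psi> =
    all_sets (all_sets (some_set (all_sets \<comment> \<open>\<open>c z y x\<close>\<close>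
      (all_in (Var 3) (some_in (Var 3) \<comment> \<open>\<open>b a c z y x\<close>\<close>
         (at \<psi> [Var 1, Var 0, Var 2] 6))
       \<^bold>\<longrightarrow>
       some_in (Var 1) \<comment> \<open>\<open>w c z y x\<close>\<close>
        (subset_fm E (Var 0) (Var 3)
         \<^bold>\<and> all_in (Var 4) (some_in (Var 1) \<comment> \<open>\<open>b a w c z y x\<close>\<close>
             (at \<psi> [Var 1, Var 0, Var 3] 7))
         \<^bold>\<and> all_in (Var 0) (some_in (Var 5) \<comment> \<open>\<open>a b w c z y x\<close>\<close>
             (at \<psi> [Var 0, Var 1, Var 3] 7)))))))"

end

theory Submission
  imports Defs
begin

text \<open>If every \<open>a \<in> EL x\<close> has some \<open>b \<in> EL y\<close> with \<open>\<psi>(a,b,c)\<close>, then ECT yields an index \<open>e\<close> that maps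
  every \<open>n\<close> with \<open>\<T>(cd\<^sub>x(n))\<close> to some \<open>m\<close> with \<open>\<T>(cd\<^sub>y(m))\<close> and \<open>\<psi>(el\<^sub>x(n), el\<^sub>y(m), c)\<close>; the
  required \<open>w\<close> is the image \<open>w\<^sub>e = {el\<^sub>y(e n) : \<T>(cd\<^sub>x(n))}\<close>. As \<open>\<psi>\<close> need not be extensional, its elements
  must be the numbers \<open>el\<^sub>y(e n)\<close> themselves, while \<open>e\<close> is partial and a v-set is a total index. Therefore
  \<open>w\<^sub>e\<close> is enumerated by pairs \<open>\<langle>n,k\<rangle>\<close>: if \<open>k\<close> is a computation tree of \<open>e n\<close>, the value is read off
  from \<open>k\<close> and carries the condition \<open>cd\<^sub>x(n)\<close>, otherwise a false condition is used. The condition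
  \<open>\<Xi>(cd\<^sub>x, cd\<^sub>y \<circ> e)\<close> is meaningful for every \<open>e\<close>, and it is true iff \<open>e\<close> maps the true indices of \<open>x\<close>
  to true indices of \<open>y\<close>. So the set \<open>z\<close> of all \<open>w\<^sub>e\<close> under this condition does not depend on \<open>c\<close>.

  ECT with the trivial premise supplies all the total indices needed. The facts about Kleene
  application that have to be derived in the object theory are that it is single-valued, that
  \<open>\<langle>5,\<langle>a,b\<rangle>\<rangle>\<close> is the composition of \<open>a\<close> and \<open>b\<close>, with the exact domain, and that \<open>\<langle>8,0\<rangle>\<close> is
  nowhere defined.\<close>

section \<open>Substitution\<close>

text \<open>It cannot be decided which numbers \<open>e\<close> are choice indices, and it need not
  be: (X2) inspects values only where \<open>e\<close> is defined, and (V1) asks for a v-set as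
  element only under a true condition. Thus \<open>z\<close> can have an entry for every number, and
  a bad entry is neutralised by a condition that is meaningful without being true. The value
  \<open>e n\<close> reaches the argument along several ways: from the tree stored in an index of
  the image, from the truth of the condition, and from ECT for the given \<open>c\<close>.
  Single-valuedness identifies them, so that all clauses speak about the same elements. An index of
  the image would usually be computed from \<open>e\<close> by the s-m-n theorem. Instead, ECT is
  applied to the statement that every \<open>e\<close> has such an index, which was itself obtained
  by ECT with \<open>e\<close> as a parameter. The premise of ECT has to be almost negative, but
  truth of the partial term \<open>cd_x(n)\<close> is existential as written; it is restated
  universally, which is equivalent because \<open>x\<close> is total and single-valued.\<close>

lemma up_simps [simp]: "up \<sigma> 0 = Var 0" "up \<sigma> (Suc i) = \<up> (\<sigma> i)"
  by (simp_all add: up_def)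

lemma subst_tm_subst_tm [simp]:
  "subst_tm \<sigma> (subst_tm \<tau> t) = subst_tm (\<lambda>i. subst_tm \<sigma> (\<tau> i)) t"
  by (induction t) auto

lemma subst_tm_Var [simp]: "subst_tm Var t = t"
  by (induction t) (auto simp: map_idI)

lemma up_Var [simp]: "up Var = Var"
proof
  show "up Var i = Var i" for i by (cases i) auto
qed

lemma subst_Var [simp]: "subst Var \<phi> = \<phi>"
  by (induction \<phi>) auto

lemma up_comp [simp]: "(\<lambda>i. subst_tm (up \<sigma>) (up \<tau> i)) = up (\<lambda>i. subst_tm \<sigma> (\<tau> i))"
proof
  show "subst_tm (up \<sigma>) (up \<tau> i) = up (\<lambda>i. subst_tm \<sigma> (\<tau> i)) i" for i by (cases i) auto
qed

lemma subst_subst [simp]: "subst \<sigma> (subst \<tau> \<phi>) = subst (\<lambda>i. subst_tm \<sigma> (\<tau> i)) \<phi>"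
  by (induction \<phi> arbitrary: \<sigma> \<tau>) auto

lemma subst_inst: "subst \<sigma> (inst \<phi> t) = inst (subst (up \<sigma>) \<phi>) (subst_tm \<sigma> t)"
  unfolding inst_def
  by (auto intro!: arg_cong[where f = "\<lambda>\<sigma>. subst \<sigma> \<phi>"] split: nat.split)

lemma subst_App [simp]:
  "subst \<sigma> (App e n m) = App (subst_tm \<sigma> e) (subst_tm \<sigma> n) (subst_tm \<sigma> m)"
  by (simp add: App_def)

lemma subst_with_app [simp]:
  "subst \<sigma> (with_app e n \<phi>) = with_app (subst_tm \<sigma> e) (subst_tm \<sigma> n) (subst (up \<sigma>) \<phi>)"
  by (simp add: with_app_def)

lemma subst_defined [simp]: "subst \<sigma> (defined e n) = defined (subst_tm \<sigma> e) (subst_tm \<sigma> n)"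
  by (simp add: defined_def)

lemma subst_EL [simp]: "subst \<sigma> (EL x a) = EL (subst_tm \<sigma> x) (subst_tm \<sigma> a)"
  by (simp add: EL_def)

lemma subst_all_in [simp]: "subst \<sigma> (all_in x \<phi>) = all_in (subst_tm \<sigma> x) (subst (up \<sigma>) \<phi>)"
  by (simp add: all_in_def)

lemma subst_some_in [simp]: "subst \<sigma> (some_in x \<phi>) = some_in (subst_tm \<sigma> x) (subst (up \<sigma>) \<phi>)"
  by (simp add: some_in_def)

lemma subst_all_sets [simp]: "subst \<sigma> (all_sets \<phi>) = all_sets (subst (up \<sigma>) \<phi>)"
  by (simp add: all_sets_def)

lemma subst_some_set [simp]: "subst \<sigma> (some_set \<phi>) = some_set (subst (up \<sigma>) \<phi>)"
  by (simp add: some_set_def)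

lemma subst_rel2 [simp]: "subst \<sigma> (rel2 E s t) = rel2 E (subst_tm \<sigma> s) (subst_tm \<sigma> t)"
  unfolding rel2_def subst_subst by (rule arg_cong[where f = "\<lambda>\<sigma>. subst \<sigma> E"]) auto

lemma subst_set_mem [simp]: "subst \<sigma> (set_mem E s t) = set_mem E (subst_tm \<sigma> s) (subst_tm \<sigma> t)"
  by (simp add: set_mem_def)

lemma subst_subset_fm [simp]: "subst \<sigma> (subset_fm E s t) = subset_fm E (subst_tm \<sigma> s) (subst_tm \<sigma> t)"
  by (simp add: subset_fm_def)

text \<open>The hypothesis says that \<open>\<sigma>\<close> merely renumbers the parameters, from
  below \<open>k\<close> binders to below \<open>k'\<close>; so only the explicit arguments
  \<open>ts\<close> change.\<close>

lemma subst_at: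
  "(\<And>j. \<sigma> (j + k) = Var (j + k')) \<Longrightarrow> subst \<sigma> (at \<phi> ts k) = at \<phi> (map (subst_tm \<sigma>) ts) k'"
  unfolding at_def
  by (auto intro!: arg_cong[where f = "\<lambda>\<sigma>. subst \<sigma> \<phi>"] simp del: Nat.add_diff_assoc2)

text \<open>For substitutions that also replace parameters: the replacement \<open>\<tau>\<close>
  then acts on \<open>\<phi>\<close> before the arguments are inserted, which turns an instance of
  an axiom scheme into another instance of it.\<close>

lemma subst_at_gen:
  fixes ts' k'
  defines "\<rho> \<equiv> \<lambda>i. if i < length ts' then ts' ! i else Var (i - length ts' + k')"
  assumes "\<And>i. i < length ts \<Longrightarrow> subst_tm \<sigma> (ts ! i) = subst_tm \<rho> (\<tau> i)"
    and "\<And>i. \<sigma> (i + k) = subst_tm \<rho> (\<tau> (i + length ts))"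
  shows "subst \<sigma> (at \<phi> ts k) = at (subst \<tau> \<phi>) ts' k'"
proof -
  have "subst_tm \<sigma> (if i < length ts then ts ! i else Var (i - length ts + k)) = subst_tm \<rho> (\<tau> i)" for i
    using assms(2)[of i] assms(3)[of "i - length ts"] by (cases "i < length ts") simp_all
  then show ?thesis unfolding at_def \<rho>_def[symmetric] by simp
qed

lemma quantifier_free_subst: "quantifier_free \<phi> \<Longrightarrow> quantifier_free (subst \<sigma> \<phi>)"
  by (induction rule: quantifier_free.induct) (auto intro: quantifier_free.intros)

lemma sigma1_subst: "sigma1 \<phi> \<Longrightarrow> sigma1 (subst \<sigma> \<phi>)"
  by (induction arbitrary: \<sigma> rule: sigma1.induct) (auto intro: sigma1.intros quantifier_free_subst)

lemma almost_negative_subst: "almost_negative \<phi> \<Longrightarrow> almost_negative (subst \<sigma> \<phi>)"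
  by (induction arbitrary: \<sigma> rule: almost_negative.induct)
    (auto intro: almost_negative.intros sigma1_subst)

lemma subst_tm_arg: "subst_tm \<sigma> (arg zero ts i) = arg zero (map (subst_tm \<sigma>) ts) i"
  by (simp add: arg_def)

lemma subst_closed_under:
  "subst (up \<sigma>) (closed_under \<phi>) = closed_under (subst (up \<sigma>) \<phi>)"
proof -
  have "subst (up (up (up \<sigma>))) (at \<phi> [lft (Var 0)] 3) = at (subst (up \<sigma>) \<phi>) [lft (Var 0)] 3"
    by (rule subst_at_gen) (auto simp: numeral_eq_Suc)
  then show ?thesis by (simp add: closed_under_def)
qed

text \<open>The formulas in the schemes may have parameters, so a substituted axiom is again an
  instance; for ECT this relies on almost negativity being preserved. It is the base case for moving
  whole derivations along a substitution.\<close>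

lemma axiom_of_subst: "axiom_of \<Xi> \<phi> \<Longrightarrow> axiom_of \<Xi> (subst \<sigma> \<phi>)"
proof (induction rule: axiom_of.induct)
  case (comp_eq f gs ts)
  show ?case using axiom_of.comp_eq[of \<Xi> f gs "map (subst_tm \<sigma>) ts"] by (simp add: comp_def)
next
  case (induction \<phi>)
  have "subst (up \<sigma>) (at \<phi> [suc (Var 0)] 1) = at (subst (up \<sigma>) \<phi>) [suc (Var 0)] 1"
    by (rule subst_at_gen) auto
  then show ?case using axiom_of.induction[of \<Xi> "subst (up \<sigma>) \<phi>"]
    by (simp add: subst_inst)
next
  case V1
  have "subst (up \<sigma>) (closed_under (Vset (Var 0))) = closed_under (Vset (Var 0))"
    by (simp add: subst_closed_under)
  then show ?case using axiom_of.V1 by simp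
next
  case (V2 \<phi>)
  show ?case using axiom_of.V2[of \<Xi> "subst (up \<sigma>) \<phi>"] by (simp add: subst_closed_under)
next
  case (X1 f g)
  show ?case using axiom_of.X1[of \<Xi> "subst_tm \<sigma> f" "subst_tm \<sigma> g"] by simp
next
  case (X2 f g)
  show ?case using axiom_of.X2[of \<Xi> "subst_tm \<sigma> f" "subst_tm \<sigma> g"] by simp
next
  case (ECT \<phi> \<psi>)
  have 1: "subst (up (up \<sigma>)) (at \<phi> [Var 0] 2) = at (subst (up \<sigma>) \<phi>) [Var 0] 2"
    by (rule subst_at_gen) (auto simp: numeral_eq_Suc)
  have 2: "subst (up (up (up \<sigma>))) (at \<psi> [Var 0, Var 1] 3) = at (subst (up (up \<sigma>)) \<psi>) [Var 0, Var 1] 3"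
    by (rule subst_at_gen) (auto simp: numeral_eq_Suc less_Suc_eq)
  show ?case
    using axiom_of.ECT[OF almost_negative_subst[OF ECT, of "up \<sigma>"], of \<Xi> "subst (up (up \<sigma>)) \<psi>"]
    by (simp add: 1 2[simplified])
qed (auto intro: axiom_of.intros simp: subst_tm_arg)

section \<open>Derivations\<close>

lemma derives_subst: "\<Xi>; \<Gamma> \<turnstile> \<phi> \<Longrightarrow> \<Xi>; map (subst \<sigma>) \<Gamma> \<turnstile> subst \<sigma> \<phi>"
proof (induction arbitrary: \<sigma> rule: derives.induct)
  case (ForallI \<Gamma> \<phi>)
  show ?case using ForallI.IH[of "up \<sigma>"] by (simp add: derives.ForallI comp_def)
next
  case (ForallE \<Gamma> \<phi> t)
  then show ?case using derives.ForallE[of \<Xi> "map (subst \<sigma>) \<Gamma>" "subst (up \<sigma>) \<phi>"] by (simp add: subst_inst)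
next
  case (ExistsI \<Gamma> \<phi> t)
  show ?case using derives.ExistsI[OF ExistsI.IH[unfolded subst_inst]] by simp
next
  case (ExistsE \<Gamma> \<phi> \<chi>)
  show ?case
    using ExistsE.IH(1)[of "\<sigma>"] ExistsE.IH(2)[of "up \<sigma>"]
    by (simp add: derives.ExistsE[where \<phi> = "subst (up \<sigma>) \<phi>"] comp_def)
next
  case (EquE \<Gamma> s t \<phi>)
  show ?case
    using derives.EquE[OF EquE.IH(1)[unfolded subst.simps] EquE.IH(2)[unfolded subst_inst]]
    by (simp add: subst_inst)
next
  case (DisjE \<Gamma> \<phi> \<psi> \<chi>)
  then show ?case using derives.DisjE[of \<Xi> "map (subst \<sigma>) \<Gamma>" "subst \<sigma> \<phi>" "subst \<sigma> \<psi>"] by simp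
next
  case (ConjE1 \<Gamma> \<phi> \<psi>)
  then show ?case using derives.ConjE1 by (metis subst.simps(6))
next
  case (ConjE2 \<Gamma> \<phi> \<psi>)
  then show ?case using derives.ConjE2 by (metis subst.simps(6))
next
  case (ImplE \<Gamma> \<phi> \<psi>)
  then show ?case using derives.ImplE by (metis subst.simps(8))
qed (simp_all add: derives.Assm derives.Axiom derives.FalsumE derives.ConjI derives.DisjI1
    derives.DisjI2 derives.ImplI derives.EquI axiom_of_subst)

lemma derives_weaken: "\<Xi>; \<Gamma> \<turnstile> \<phi> \<Longrightarrow> set \<Gamma> \<subseteq> set \<Delta> \<Longrightarrow> \<Xi>; \<Delta> \<turnstile> \<phi>"
proof (induction arbitrary: \<Delta> rule: derives.induct)
  case (DisjE \<Gamma> \<phi> \<psi> \<chi>)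
  show ?case
    by (rule derives.DisjE[OF DisjE.IH(1)[OF DisjE.prems]]; rule DisjE.IH; use DisjE.prems in auto)
next
  case (ImplI \<phi> \<Gamma> \<psi>)
  show ?case by (rule derives.ImplI, rule ImplI.IH) (use ImplI.prems in auto)
next
  case (ForallI \<Gamma> \<phi>)
  show ?case by (rule derives.ForallI, rule ForallI.IH) (use ForallI.prems in auto)
next
  case (ExistsE \<Gamma> \<phi> \<chi>)
  show ?case
    by (rule derives.ExistsE[OF ExistsE.IH(1)[OF ExistsE.prems]], rule ExistsE.IH)
      (use ExistsE.prems in auto)
qed (blast intro: derives.intros)+

section \<open>Fresh variables\<close>

lemma up_agree: "\<forall>i<k. \<sigma> i = \<tau> i \<Longrightarrow> \<forall>i<Suc k. up \<sigma> i = up \<tau> i"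
  by (auto simp: less_Suc_eq_0_disj)

lemma tm_bound: "\<exists>k. \<forall>\<sigma> \<tau>. (\<forall>i<k. \<sigma> i = \<tau> i) \<longrightarrow> subst_tm \<sigma> t = subst_tm \<tau> t"
proof (induction t)
  case (Var x)
  show ?case by (rule exI[of _ "Suc x"]) auto
next
  case (Fn f ts)
  then obtain b where b: "\<And>t \<sigma> \<tau>. t \<in> set ts \<Longrightarrow> (\<forall>i<b t. \<sigma> i = \<tau> i) \<Longrightarrow> subst_tm \<sigma> t = subst_tm \<tau> t"
    by metis
  have "b t \<le> sum_list (map b ts)" if "t \<in> set ts" for t
    using that by (simp add: member_le_sum_list)
  then show ?case using b by (intro exI[of _ "sum_list (map b ts)"]) fastforce
qed

text \<open>Says that all free indices of \<open>\<phi>\<close> lie below \<open>k\<close>, phrased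
  through the effect of substitutions because freshness serves to replace one substitution by
  another.\<close>

definition bounds :: "nat \<Rightarrow> fm \<Rightarrow> bool" where
  "bounds k \<phi> \<longleftrightarrow> (\<forall>\<sigma> \<tau>. (\<forall>i<k. \<sigma> i = \<tau> i) \<longrightarrow> subst \<sigma> \<phi> = subst \<tau> \<phi>)"

lemma bounds_mono: "bounds k \<phi> \<Longrightarrow> k \<le> l \<Longrightarrow> bounds l \<phi>"
  unfolding bounds_def by (meson order.strict_trans2)

lemma bounds_Suc: "bounds k \<phi> \<Longrightarrow> bounds k (Forall \<phi>) \<and> bounds k (Exists \<phi>)"
  unfolding bounds_def by (simp add: up_agree less_SucI)

lemma bounds2:
  assumes "\<exists>k. bounds k \<phi>" "\<exists>k. bounds k \<psi>"
  shows "\<exists>k. bounds k \<phi> \<and> bounds k \<psi>"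
  using assms bounds_mono by (meson nat_le_linear)

lemma fm_bound: "\<exists>k. bounds k \<phi>"
proof (induction \<phi>)
  case (Equ s t)
  obtain k l where
    "\<forall>\<sigma> \<tau>. (\<forall>i<k. \<sigma> i = \<tau> i) \<longrightarrow> subst_tm \<sigma> s = subst_tm \<tau> s"
    "\<forall>\<sigma> \<tau>. (\<forall>i<l. \<sigma> i = \<tau> i) \<longrightarrow> subst_tm \<sigma> t = subst_tm \<tau> t"
    using tm_bound by metis
  then show ?case by (intro exI[of _ "max k l"]) (auto simp: bounds_def)
next
  case (Conj \<phi> \<psi>)
  show ?case using bounds2[OF Conj] unfolding bounds_def by (metis subst.simps)
next
  case (Disj \<phi> \<psi>)
  show ?case using bounds2[OF Disj] unfolding bounds_def by (metis subst.simps)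
next
  case (Impl \<phi> \<psi>)
  show ?case using bounds2[OF Impl] unfolding bounds_def by (metis subst.simps)
next
  case (Forall \<phi>)
  then show ?case using bounds_Suc by blast
next
  case (Exists \<phi>)
  then show ?case using bounds_Suc by blast
qed (use tm_bound in \<open>auto simp: bounds_def\<close>)

lemma fms_bound: "\<exists>k. \<forall>\<phi> \<in> set \<Gamma>. bounds k \<phi>"
proof (induction \<Gamma>)
  case (Cons \<phi> \<Gamma>)
  then show ?case using fm_bound[of \<phi>] by (metis bounds_mono nat_le_linear set_ConsD)
qed auto

text \<open>The fresh index \<open>k\<close> becomes the bound index 0 and the smaller indices make
  room for it. On formulas bounded by \<open>k\<close> this undoes the instantiation with
  \<open>Var k\<close>.\<close>

definition capture :: "nat \<Rightarrow> nat \<Rightarrow> tm" where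
  "capture k = (\<lambda>i. if i < k then Var (Suc i) else Var 0)"

lemma boundsD: "bounds k \<phi> \<Longrightarrow> (\<And>i. i < k \<Longrightarrow> \<sigma> i = \<tau> i) \<Longrightarrow> subst \<sigma> \<phi> = subst \<tau> \<phi>"
  unfolding bounds_def by blast

lemma subst_capture: "bounds k \<phi> \<Longrightarrow> subst (capture k) \<phi> = lift \<phi>"
  by (erule boundsD) (simp add: capture_def)

lemma capture_inst:
  assumes "bounds k \<phi>"
  shows "subst (capture k) (inst \<phi> (Var k)) = \<phi>"
proof -
  have "subst (\<lambda>i. subst_tm (capture k) (case_nat (Var k) Var i)) \<phi> = subst Var \<phi>"
    using assms by (rule boundsD) (simp add: capture_def split: nat.split)
  then show ?thesis by (simp add: inst_def)
qed

lemma map_capture: "\<forall>\<phi> \<in> set \<Gamma>. bounds k \<phi> \<Longrightarrow> map (subst (capture k)) \<Gamma> = map lift \<Gamma>"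
  by (simp add: subst_capture)

text \<open>A fresh variable is among the terms \<open>t\<close>, so quantifying over all terms at the meta-level
  replaces the eigenvariable condition.\<close>

lemma ForallI_tm:
  assumes "\<And>t. \<Xi>; \<Gamma> \<turnstile> inst \<phi> t"
  shows "\<Xi>; \<Gamma> \<turnstile> Forall \<phi>"
proof -
  obtain k where k: "\<forall>\<chi> \<in> set (\<phi> # \<Gamma>). bounds k \<chi>" using fms_bound by blast
  have "\<Xi>; map (subst (capture k)) \<Gamma> \<turnstile> subst (capture k) (inst \<phi> (Var k))"
    using assms by (rule derives_subst)
  then show ?thesis using k by (intro ForallI) (simp add: map_capture capture_inst)
qed

lemma ExistsE_tm:
  assumes "\<Xi>; \<Gamma> \<turnstile> Exists \<phi>" and "\<And>t. \<Xi>; inst \<phi> t # \<Gamma> \<turnstile> \<chi>"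
  shows "\<Xi>; \<Gamma> \<turnstile> \<chi>"
proof -
  obtain k where k: "\<forall>\<chi> \<in> set (\<chi> # \<phi> # \<Gamma>). bounds k \<chi>" using fms_bound by blast
  have "\<Xi>; map (subst (capture k)) (inst \<phi> (Var k) # \<Gamma>) \<turnstile> subst (capture k) \<chi>"
    using assms(2) by (rule derives_subst)
  then show ?thesis using k
    by (intro ExistsE[OF assms(1)]) (simp add: map_capture capture_inst subst_capture)
qed

section \<open>Derived rules and provable equality\<close>

locale v_system =
  fixes \<Xi> :: prsym
begin

abbreviation entails :: "fm list \<Rightarrow> fm \<Rightarrow> bool"  (infix \<open>\<tturnstile>\<close> 20) where
  "\<Gamma> \<tturnstile> \<phi> \<equiv> \<Xi>; \<Gamma> \<turnstile> \<phi>"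

abbreviation extended :: "fm list \<Rightarrow> fm list \<Rightarrow> bool"  (infix \<open>\<sqsubseteq>\<close> 50) where
  "\<Gamma> \<sqsubseteq> \<Delta> \<equiv> set \<Gamma> \<subseteq> set \<Delta>"

lemma wk: "\<Gamma> \<sqsubseteq> \<Delta> \<Longrightarrow> \<Gamma> \<tturnstile> \<phi> \<Longrightarrow> \<Delta> \<tturnstile> \<phi>"
  by (rule derives_weaken)

text \<open>The rules with premises are stated over all extensions \<open>\<Delta>\<close> of the context, as in Kripke semantics:
  a proof adds hypotheses without naming them and transports earlier facts by \<open>wk\<close>.\<close>

lemma exE:
  assumes "\<Gamma> \<tturnstile> Exists \<phi>" and "\<And>\<Delta> t. \<Gamma> \<sqsubseteq> \<Delta> \<Longrightarrow> \<Delta> \<tturnstile> inst \<phi> t \<Longrightarrow> \<Delta> \<tturnstile> \<chi>"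
  shows "\<Gamma> \<tturnstile> \<chi>"
  by (rule ExistsE_tm[OF assms(1)], rule assms(2)) (auto intro: Assm)

lemma disjE:
  assumes "\<Gamma> \<tturnstile> \<phi> \<^bold>\<or> \<psi>"
    and "\<And>\<Delta>. \<Gamma> \<sqsubseteq> \<Delta> \<Longrightarrow> \<Delta> \<tturnstile> \<phi> \<Longrightarrow> \<Delta> \<tturnstile> \<chi>" and "\<And>\<Delta>. \<Gamma> \<sqsubseteq> \<Delta> \<Longrightarrow> \<Delta> \<tturnstile> \<psi> \<Longrightarrow> \<Delta> \<tturnstile> \<chi>"
  shows "\<Gamma> \<tturnstile> \<chi>"
  by (rule DisjE[OF assms(1)]; rule assms(2) assms(3)) (auto intro: Assm)

lemma impI: "(\<And>\<Delta>. \<Gamma> \<sqsubseteq> \<Delta> \<Longrightarrow> \<Delta> \<tturnstile> \<phi> \<Longrightarrow> \<Delta> \<tturnstile> \<psi>) \<Longrightarrow> \<Gamma> \<tturnstile> \<phi> \<^bold>\<longrightarrow> \<psi>"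
  by (rule ImplI) (metis Assm list.set_intros(1) set_subset_Cons)

lemmas mp = ImplE
lemmas allI = ForallI_tm
lemmas allE = ForallE
lemmas exI = ExistsI
lemmas conjI = ConjI
lemmas conjD1 = ConjE1
lemmas conjD2 = ConjE2

lemma refl: "\<Gamma> \<tturnstile> t \<doteq> t"
  by (rule EquI)

lemma sym: "\<Gamma> \<tturnstile> s \<doteq> t \<Longrightarrow> \<Gamma> \<tturnstile> t \<doteq> s"
  using EquE[where \<phi> = "Var 0 \<doteq> \<up> s" and s = s and t = t] by (simp add: inst_def refl)

lemma trans: "\<Gamma> \<tturnstile> s \<doteq> t \<Longrightarrow> \<Gamma> \<tturnstile> t \<doteq> u \<Longrightarrow> \<Gamma> \<tturnstile> s \<doteq> u"
  using EquE[where \<phi> = "\<up> s \<doteq> Var 0" and s = t and t = u] by (simp add: inst_def)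

lemma Fn_cong1:
  assumes "\<Gamma> \<tturnstile> s \<doteq> t"
  shows "\<Gamma> \<tturnstile> Fn f (xs @ s # ys) \<doteq> Fn f (xs @ t # ys)"
  using EquE[OF assms, where \<phi> = "\<up> (Fn f (xs @ s # ys)) \<doteq> Fn f (map \<up> xs @ Var 0 # map \<up> ys)"]
  by (simp add: inst_def refl comp_def)

lemma Fn_cong:
  assumes "list_all2 (\<lambda>s t. \<Gamma> \<tturnstile> s \<doteq> t) ss ts"
  shows "\<Gamma> \<tturnstile> Fn f ss \<doteq> Fn f ts"
proof -
  \<comment> \<open>\<open>xs\<close> holds the arguments already replaced, so the lists are
    exchanged one position at a time.\<close>
  have "\<Gamma> \<tturnstile> Fn f (xs @ ss) \<doteq> Fn f (xs @ ts)" for xs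
    using assms
  proof (induction arbitrary: xs rule: list_all2_induct)
    case (Cons s ss t ts)
    show ?case using trans[OF Fn_cong1[OF Cons(1), of f xs ss]] Cons(3)[of "xs @ [t]"] by simp
  qed (rule refl)
  from this[of "[]"] show ?thesis by simp
qed

text \<open>Provable equality becomes equality of representatives, which makes the simplifier
  available for equations of the object theory.\<close>

definition nf :: "fm list \<Rightarrow> tm \<Rightarrow> tm" where
  "nf \<Gamma> t = (SOME s. \<Gamma> \<tturnstile> s \<doteq> t)"

lemma nf_eq: "\<Gamma> \<tturnstile> nf \<Gamma> t \<doteq> t"
  unfolding nf_def by (rule someI[of _ t]) (rule refl)

text \<open>Provably equal terms have the same class of provable equals, and the choice operator
  picks one representative for the whole class.\<close>

lemma eq_iff: "(\<Gamma> \<tturnstile> s \<doteq> t) \<longleftrightarrow> nf \<Gamma> s = nf \<Gamma> t"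
proof
  assume "\<Gamma> \<tturnstile> s \<doteq> t"
  then have "(\<lambda>u. \<Gamma> \<tturnstile> u \<doteq> s) = (\<lambda>u. \<Gamma> \<tturnstile> u \<doteq> t)" using sym trans by blast
  then show "nf \<Gamma> s = nf \<Gamma> t" by (simp add: nf_def)
next
  assume "nf \<Gamma> s = nf \<Gamma> t"
  then show "\<Gamma> \<tturnstile> s \<doteq> t" using nf_eq sym trans by metis
qed

lemma nf_nf [simp]: "nf \<Gamma> (nf \<Gamma> t) = nf \<Gamma> t"
  using nf_eq eq_iff by blast

text \<open>Function application on representatives. Pushing \<open>nf\<close> down to the leaves
  turns both sides of an equation into \<open>ap\<close> expressions, on which the recursion
  equations act as rewrite rules.\<close>

definition ap :: "fm list \<Rightarrow> prsym \<Rightarrow> tm list \<Rightarrow> tm" where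
  "ap \<Gamma> f ts = nf \<Gamma> (Fn f ts)"

lemma nf_ap [simp]: "nf \<Gamma> (ap \<Gamma> f ts) = ap \<Gamma> f ts"
  by (simp add: ap_def)

lemma ap_map_nf: "ap \<Gamma> f (map (nf \<Gamma>) ts) = ap \<Gamma> f ts"
  unfolding ap_def
  by (rule eq_iff[THEN iffD1], rule Fn_cong) (simp add: list_all2_conv_all_nth nf_eq)

lemma nf_Fn [simp]: "nf \<Gamma> (Fn f ts) = ap \<Gamma> f (map (nf \<Gamma>) ts)"
  by (simp add: ap_map_nf) (simp add: ap_def)

lemma ap_strip:
  "ap \<Gamma> f [nf \<Gamma> a] = ap \<Gamma> f [a]"
  "ap \<Gamma> f [nf \<Gamma> a, b] = ap \<Gamma> f [a, b]"
  "ap \<Gamma> f [a, nf \<Gamma> b] = ap \<Gamma> f [a, b]"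
  using ap_map_nf[of \<Gamma> f "[a]"] ap_map_nf[of \<Gamma> f "[nf \<Gamma> a, b]"] ap_map_nf[of \<Gamma> f "[a, nf \<Gamma> b]"]
    ap_map_nf[of \<Gamma> f "[a, b]"] by simp_all

lemma fun_of_eq: "\<Gamma> \<tturnstile> Fn (fun_of t) ts \<doteq> subst_tm (arg zero ts) t"
proof (induction t)
  case (Var i)
  then show ?case by (simp add: Axiom proj_eq)
next
  case (Fn f us)
  have "\<Gamma> \<tturnstile> Fn (fun_of (Fn f us)) ts \<doteq> Fn f (map (\<lambda>u. Fn (fun_of u) ts) us)"
    using Axiom[OF comp_eq, of \<Xi> \<Gamma> f "map fun_of us" ts] by (simp add: comp_def)
  moreover have "\<Gamma> \<tturnstile> Fn f (map (\<lambda>u. Fn (fun_of u) ts) us) \<doteq> Fn f (map (subst_tm (arg zero ts)) us)"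
    by (rule Fn_cong) (use Fn in \<open>simp add: list_all2_conv_all_nth\<close>)
  ultimately show ?case using trans by simp
qed

lemma subst_cong:
  assumes "\<Gamma> \<tturnstile> s \<doteq> t" and "\<Gamma> \<tturnstile> inst \<phi> s"
  shows "\<Gamma> \<tturnstile> inst \<phi> t"
  by (rule EquE[OF assms])

declare fun_of.simps [simp del]

lemma ap_eqI: "\<Gamma> \<tturnstile> Fn f ss \<doteq> Fn g ts \<Longrightarrow> ap \<Gamma> f ss = ap \<Gamma> g ts"
  unfolding ap_def by (rule eq_iff[THEN iffD1])

section \<open>Arithmetic\<close>

abbreviation "Z \<Gamma> \<equiv> ap \<Gamma> PZero []"
abbreviation "S \<Gamma> a \<equiv> ap \<Gamma> PSucc [a]"
abbreviation "P \<Gamma> a \<equiv> ap \<Gamma> pred_pr [a]"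
abbreviation "pls \<Gamma> a b \<equiv> ap \<Gamma> add_pr [a, b]"
abbreviation "tms \<Gamma> a b \<equiv> ap \<Gamma> mult_pr [a, b]"
abbreviation "mns \<Gamma> a b \<equiv> ap \<Gamma> monus_pr [a, b]"
abbreviation "tri \<Gamma> a \<equiv> ap \<Gamma> tri_pr [a]"
abbreviation "diag \<Gamma> a \<equiv> ap \<Gamma> diag_pr [a]"
abbreviation "pair \<Gamma> a b \<equiv> ap \<Gamma> pair_pr [a, b]"
abbreviation "L \<Gamma> a \<equiv> ap \<Gamma> left_pr [a]"
abbreviation "R \<Gamma> a \<equiv> ap \<Gamma> right_pr [a]"
abbreviation "eqn \<Gamma> a b \<equiv> ap \<Gamma> eq_pr [a, b]"

lemma ap_rec_zero: "ap \<Gamma> (PRec g h) (Z \<Gamma> # ts) = ap \<Gamma> g ts"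
  by (rule ap_eqI, rule trans[OF Fn_cong1[where xs = "[]", simplified] Axiom[OF rec_zero]])
    (unfold ap_def, rule nf_eq)

lemma ap_rec_suc: "ap \<Gamma> (PRec g h) (S \<Gamma> a # ts) = ap \<Gamma> h (a # ap \<Gamma> (PRec g h) (a # ts) # ts)"
proof (rule ap_eqI, rule trans)
  show "\<Gamma> \<tturnstile> Fn (PRec g h) (S \<Gamma> a # ts) \<doteq> Fn (PRec g h) (suc a # ts)"
    by (rule Fn_cong1[where xs = "[]", simplified]) (unfold ap_def, rule nf_eq)
  show "\<Gamma> \<tturnstile> Fn (PRec g h) (suc a # ts) \<doteq> Fn h (a # ap \<Gamma> (PRec g h) (a # ts) # ts)"
    by (rule trans[OF Axiom[OF rec_suc] Fn_cong1[where xs = "[_]", simplified]])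
      (unfold ap_def, rule sym[OF nf_eq])
qed

lemma ap_proj: "ap \<Gamma> (PProj i) ts = nf \<Gamma> (arg zero ts i)"
  unfolding ap_def by (rule eq_iff[THEN iffD1], rule Axiom[OF proj_eq])

lemma ap_fun_of: "ap \<Gamma> (fun_of t) ts = nf \<Gamma> (subst_tm (arg zero ts) t)"
  unfolding ap_def by (rule eq_iff[THEN iffD1], rule fun_of_eq)

lemma ap_PZero: "ap \<Gamma> PZero (t # ts) = Z \<Gamma>"
  unfolding ap_def by (rule eq_iff[THEN iffD1], rule Axiom[OF zero_eq])

lemma ap_raw:
  "ap \<Gamma> f [Fn g ts] = ap \<Gamma> f [ap \<Gamma> g ts]"
  "ap \<Gamma> f [Fn g ts, b] = ap \<Gamma> f [ap \<Gamma> g ts, b]"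
  "ap \<Gamma> f [a, Fn g ts] = ap \<Gamma> f [a, ap \<Gamma> g ts]"
  using ap_strip(1)[of \<Gamma> f "Fn g ts"] ap_strip(2)[of \<Gamma> f "Fn g ts" b] ap_strip(3)[of \<Gamma> f a "Fn g ts"]
  by (simp_all only: ap_def[symmetric])

lemmas ap_unfold = ap_rec_zero ap_rec_suc ap_proj ap_fun_of ap_PZero arg_def ap_strip

lemma P_simps [simp]: "P \<Gamma> (Z \<Gamma>) = Z \<Gamma>" "P \<Gamma> (S \<Gamma> a) = nf \<Gamma> a"
  unfolding pred_pr_def by (simp_all add: ap_unfold)

lemma plus_simps [simp]: "pls \<Gamma> (Z \<Gamma>) b = nf \<Gamma> b" "pls \<Gamma> (S \<Gamma> a) b = S \<Gamma> (pls \<Gamma> a b)"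
  unfolding add_pr_def by (simp_all add: ap_unfold)

lemma times_simps [simp]:
  "tms \<Gamma> (Z \<Gamma>) b = Z \<Gamma>" "tms \<Gamma> (S \<Gamma> a) b = pls \<Gamma> (tms \<Gamma> a b) b"
  unfolding mult_pr_def by (simp_all add: ap_unfold)

text \<open>The recursion runs over the subtrahend. Only the first equation becomes a permanent
  rewrite rule; the second would take differences of successors apart before
  \<open>minus_S_S\<close> can cancel them.\<close>

lemma minus_simps:
  "mns \<Gamma> a (Z \<Gamma>) = nf \<Gamma> a" "mns \<Gamma> a (S \<Gamma> b) = P \<Gamma> (mns \<Gamma> a b)"
  unfolding monus_pr_def by (simp_all add: ap_unfold)

declare minus_simps(1) [simp]

lemma tri_simps [simp]: "tri \<Gamma> (Z \<Gamma>) = Z \<Gamma>" "tri \<Gamma> (S \<Gamma> a) = S \<Gamma> (pls \<Gamma> a (tri \<Gamma> a))"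
  unfolding tri_pr_def by (simp_all add: ap_unfold)

lemma pair_unfold: "pair \<Gamma> a b = pls \<Gamma> (tri \<Gamma> (pls \<Gamma> a b)) b"
  unfolding pair_pr_def by (simp add: ap_unfold)

text \<open>The summand added in the second equation is the truth value, 0 or 1, of
  \<open>tri (diag z + 1) \<le> z + 1\<close>, expressed by truncated subtraction.\<close>

lemma diag_simps:
  "diag \<Gamma> (Z \<Gamma>) = Z \<Gamma>"
  "diag \<Gamma> (S \<Gamma> z) = pls \<Gamma> (diag \<Gamma> z)
     (mns \<Gamma> (S \<Gamma> (Z \<Gamma>)) (mns \<Gamma> (tri \<Gamma> (S \<Gamma> (diag \<Gamma> z))) (S \<Gamma> z)))"
  unfolding diag_pr_def by (simp_all add: ap_unfold)

declare diag_simps(1) [simp]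

lemma R_unfold: "R \<Gamma> z = mns \<Gamma> z (tri \<Gamma> (diag \<Gamma> z))"
  unfolding right_pr_def by (simp add: ap_unfold)

lemma L_unfold: "L \<Gamma> z = mns \<Gamma> (diag \<Gamma> z) (R \<Gamma> z)"
  unfolding left_pr_def by (simp add: ap_unfold)

lemma eqn_unfold: "eqn \<Gamma> a b = mns \<Gamma> (S \<Gamma> (Z \<Gamma>)) (pls \<Gamma> (mns \<Gamma> a b) (mns \<Gamma> b a))"
  unfolding eq_pr_def by (simp add: ap_unfold)

lemma ind:
  assumes "\<Gamma> \<tturnstile> inst \<phi> zero"
    and "\<And>\<Delta> u. \<Gamma> \<sqsubseteq> \<Delta> \<Longrightarrow> \<Delta> \<tturnstile> inst \<phi> u \<Longrightarrow> \<Delta> \<tturnstile> inst \<phi> (suc u)"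
  shows "\<Gamma> \<tturnstile> inst \<phi> t"
proof (rule allE, rule mp[OF Axiom[OF induction]], rule conjI[OF assms(1)], rule allI)
  fix t
  have "inst (\<phi> \<^bold>\<longrightarrow> at \<phi> [suc (Var 0)] 1) t = (inst \<phi> t \<^bold>\<longrightarrow> inst \<phi> (suc t))"
    unfolding inst_def at_def
    by (auto intro!: arg_cong[where f = "\<lambda>\<sigma>. subst \<sigma> \<phi>"] simp: less_Suc_eq split: nat.split)
  then show "\<Gamma> \<tturnstile> inst (\<phi> \<^bold>\<longrightarrow> at \<phi> [suc (Var 0)] 1) t" using assms(2) by (auto intro: impI)
qed

lemma suc_inject: "S \<Gamma> a = S \<Gamma> b \<longleftrightarrow> nf \<Gamma> a = nf \<Gamma> b"
proof
  assume "S \<Gamma> a = S \<Gamma> b"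
  then have "\<Gamma> \<tturnstile> suc a \<doteq> suc b" by (simp add: eq_iff ap_strip)
  then show "nf \<Gamma> a = nf \<Gamma> b" using mp[OF Axiom[OF suc_inj]] eq_iff by blast
next
  show "nf \<Gamma> a = nf \<Gamma> b \<Longrightarrow> S \<Gamma> a = S \<Gamma> b" by (metis ap_strip(1))
qed

lemma zero_suc: "S \<Gamma> a = Z \<Gamma> \<Longrightarrow> \<Gamma> \<tturnstile> \<chi>"
  by (rule FalsumE, rule mp[OF Axiom[OF suc_not_zero]]) (simp add: eq_iff ap_strip)

lemma plus_Z [simp]: "pls \<Gamma> a (Z \<Gamma>) = nf \<Gamma> a"
proof -
  have "\<Gamma> \<tturnstile> inst (Var 0 \<oplus> zero \<doteq> Var 0) a"
    by (rule ind) (simp_all add: inst_def eq_iff)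
  then show ?thesis by (simp add: inst_def eq_iff ap_strip)
qed

lemma plus_S [simp]: "pls \<Gamma> a (S \<Gamma> b) = S \<Gamma> (pls \<Gamma> a b)"
proof -
  have "\<Gamma> \<tturnstile> inst (Var 0 \<oplus> suc (\<up> b) \<doteq> suc (Var 0 \<oplus> \<up> b)) a"
    by (rule ind) (simp_all add: inst_def eq_iff)
  then show ?thesis by (simp add: inst_def eq_iff ap_strip)
qed

lemma plus_comm: "pls \<Gamma> a b = pls \<Gamma> b a"
proof -
  have "\<Gamma> \<tturnstile> inst (Var 0 \<oplus> \<up> b \<doteq> \<up> b \<oplus> Var 0) a"
    by (rule ind) (simp_all add: inst_def eq_iff)
  then show ?thesis by (simp add: inst_def eq_iff ap_strip)
qed

lemma plus_assoc: "pls \<Gamma> (pls \<Gamma> a b) c = pls \<Gamma> a (pls \<Gamma> b c)"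
proof -
  have "\<Gamma> \<tturnstile> inst (Var 0 \<oplus> \<up> b \<oplus> \<up> c \<doteq> Var 0 \<oplus> (\<up> b \<oplus> \<up> c)) a"
    by (rule ind) (simp_all add: inst_def eq_iff)
  then show ?thesis by (simp add: inst_def eq_iff ap_strip)
qed

lemma minus_Z [simp]: "mns \<Gamma> (Z \<Gamma>) a = Z \<Gamma>"
proof -
  have "\<Gamma> \<tturnstile> inst (zero \<ominus> Var 0 \<doteq> zero) a"
    by (rule ind) (simp_all add: inst_def eq_iff minus_simps(2))
  then show ?thesis by (simp add: inst_def eq_iff ap_strip)
qed

lemma minus_S_S [simp]: "mns \<Gamma> (S \<Gamma> a) (S \<Gamma> b) = mns \<Gamma> a b"
proof -
  have "\<Gamma> \<tturnstile> inst (suc (\<up> a) \<ominus> suc (Var 0) \<doteq> \<up> a \<ominus> Var 0) b"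
    by (rule ind) (simp_all add: inst_def eq_iff minus_simps(2))
  then show ?thesis by (simp add: inst_def eq_iff ap_strip)
qed

lemma minus_plus [simp]: "mns \<Gamma> (pls \<Gamma> a b) b = nf \<Gamma> a"
proof -
  have "\<Gamma> \<tturnstile> inst (\<up> a \<oplus> Var 0 \<ominus> Var 0 \<doteq> \<up> a) b"
    by (rule ind) (simp_all add: inst_def eq_iff)
  then show ?thesis by (simp add: inst_def eq_iff ap_strip)
qed

lemma minus_plus' [simp]: "mns \<Gamma> (pls \<Gamma> b a) b = nf \<Gamma> a"
  by (metis minus_plus plus_comm)

lemma minus_self [simp]: "mns \<Gamma> a a = Z \<Gamma>"
  using minus_plus[of \<Gamma> "Z \<Gamma>" a] by (simp add: ap_strip)

lemma minus_plus_plus: "mns \<Gamma> (pls \<Gamma> a c) (pls \<Gamma> b c) = mns \<Gamma> a b"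
proof -
  have "\<Gamma> \<tturnstile> inst (\<up> a \<oplus> Var 0 \<ominus> (\<up> b \<oplus> Var 0) \<doteq> \<up> a \<ominus> \<up> b) c"
    by (rule ind) (simp_all add: inst_def eq_iff)
  then show ?thesis by (simp add: inst_def eq_iff ap_strip)
qed

lemma minus_less [simp]: "mns \<Gamma> a (pls \<Gamma> b a) = Z \<Gamma>"
  using minus_plus_plus[of \<Gamma> "Z \<Gamma>" a b] by (simp add: ap_strip)

lemma times_Z [simp]: "tms \<Gamma> a (Z \<Gamma>) = Z \<Gamma>"
proof -
  have "\<Gamma> \<tturnstile> inst (Var 0 \<otimes> zero \<doteq> zero) a"
    by (rule ind) (simp_all add: inst_def eq_iff)
  then show ?thesis by (simp add: inst_def eq_iff ap_strip)
qed

lemma nat_cases: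
  assumes "\<And>\<Delta>. \<Gamma> \<sqsubseteq> \<Delta> \<Longrightarrow> nf \<Delta> t = Z \<Delta> \<Longrightarrow> \<Delta> \<tturnstile> \<chi>"
    and "\<And>\<Delta> u. \<Gamma> \<sqsubseteq> \<Delta> \<Longrightarrow> nf \<Delta> t = S \<Delta> (nf \<Delta> u) \<Longrightarrow> \<Delta> \<tturnstile> \<chi>"
  shows "\<Gamma> \<tturnstile> \<chi>"
proof -
  let ?\<phi> = "Var 0 \<doteq> zero \<^bold>\<or> Exists (Var 1 \<doteq> suc (Var 0))"
  have "\<Gamma> \<tturnstile> inst ?\<phi> t"
  proof (rule ind)
    show "\<Gamma> \<tturnstile> inst ?\<phi> zero" by (simp add: inst_def DisjI1 refl)
    show "\<Delta> \<tturnstile> inst ?\<phi> (suc u)" for \<Delta> u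
      unfolding inst_def subst.simps
      by (rule DisjI2, rule exI[where t = u]) (simp add: inst_def refl)
  qed
  then have "\<Gamma> \<tturnstile> t \<doteq> zero \<^bold>\<or> Exists (\<up> t \<doteq> suc (Var 0))" by (simp add: inst_def)
  then show ?thesis
  proof (rule disjE)
    show "\<Delta> \<tturnstile> \<chi>" if "\<Gamma> \<sqsubseteq> \<Delta>" "\<Delta> \<tturnstile> t \<doteq> zero" for \<Delta>
      using that by (intro assms(1)) (simp_all add: eq_iff)
    show "\<Delta> \<tturnstile> \<chi>" if "\<Gamma> \<sqsubseteq> \<Delta>" "\<Delta> \<tturnstile> Exists (\<up> t \<doteq> suc (Var 0))" for \<Delta>
      using that(2) by (rule exE, intro assms(2)) (use that(1) in \<open>auto simp: eq_iff inst_def\<close>)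
  qed
qed

text \<open>Representatives depend on the context, so an equation between them can only be moved to
  a larger context through derivability. This is why sums such as \<open>d \<oplus> u\<close> are
  rebuilt as terms before an equation is transported.\<close>

lemma eq_wk: "\<Gamma> \<sqsubseteq> \<Delta> \<Longrightarrow> nf \<Gamma> s = nf \<Gamma> t \<Longrightarrow> nf \<Delta> s = nf \<Delta> t"
  using wk eq_iff by blast

text \<open>Comparability needs a constructive proof: induction on \<open>a\<close> with the
  difference \<open>d\<close> as explicit witness. Increasing \<open>a\<close> lowers its distance
  to \<open>b\<close> by one or, when that distance is already zero, makes \<open>a\<close> the
  larger number.\<close>

lemma le_cases:
  assumes "\<And>\<Delta> d. \<Gamma> \<sqsubseteq> \<Delta> \<Longrightarrow> nf \<Delta> b = pls \<Delta> (nf \<Delta> d) (nf \<Delta> a) \<Longrightarrow> \<Delta> \<tturnstile> \<chi>"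
    and "\<And>\<Delta> d. \<Gamma> \<sqsubseteq> \<Delta> \<Longrightarrow> nf \<Delta> a = S \<Delta> (pls \<Delta> (nf \<Delta> d) (nf \<Delta> b)) \<Longrightarrow> \<Delta> \<tturnstile> \<chi>"
  shows "\<Gamma> \<tturnstile> \<chi>"
proof -
  let ?\<phi> = "\<lambda>a. Exists (\<up> b \<doteq> Var 0 \<oplus> \<up> a) \<^bold>\<or> Exists (\<up> a \<doteq> suc (Var 0 \<oplus> \<up> b))"
  let ?\<psi> = "Exists (\<up> (\<up> b) \<doteq> Var 0 \<oplus> Var 1) \<^bold>\<or> Exists (Var 1 \<doteq> suc (Var 0 \<oplus> \<up> (\<up> b)))"
  have inst: "inst ?\<psi> a = ?\<phi> a" for a by (simp add: inst_def)
  have I1: "\<Delta> \<tturnstile> ?\<phi> a" if "nf \<Delta> b = pls \<Delta> (nf \<Delta> d) (nf \<Delta> a)" for \<Delta> a d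
    by (rule DisjI1, rule exI[where t = d]) (simp add: inst_def eq_iff that)
  have I2: "\<Delta> \<tturnstile> ?\<phi> a" if "nf \<Delta> a = S \<Delta> (pls \<Delta> (nf \<Delta> d) (nf \<Delta> b))" for \<Delta> a d
    by (rule DisjI2, rule exI[where t = d]) (simp add: inst_def eq_iff that)
  have E: "\<Delta> \<tturnstile> \<chi>"
    if "\<Delta> \<tturnstile> ?\<phi> a"
      "\<And>\<Delta>' d. \<Delta> \<sqsubseteq> \<Delta>' \<Longrightarrow> nf \<Delta>' b = pls \<Delta>' (nf \<Delta>' d) (nf \<Delta>' a) \<Longrightarrow> \<Delta>' \<tturnstile> \<chi>"
      "\<And>\<Delta>' d. \<Delta> \<sqsubseteq> \<Delta>' \<Longrightarrow> nf \<Delta>' a = S \<Delta>' (pls \<Delta>' (nf \<Delta>' d) (nf \<Delta>' b)) \<Longrightarrow> \<Delta>' \<tturnstile> \<chi>" for \<Delta> a \<chi>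
  proof -
    note E1 = that(2) and E2 = that(3)
    show ?thesis using that(1)
    proof (rule disjE)
      show "\<Theta> \<tturnstile> \<chi>" if "\<Delta> \<sqsubseteq> \<Theta>" "\<Theta> \<tturnstile> Exists (\<up> b \<doteq> Var 0 \<oplus> \<up> a)" for \<Theta>
        using that(2) by (rule exE, intro E1)
          (use that(1) in \<open>auto simp: eq_iff inst_def\<close>)
      show "\<Theta> \<tturnstile> \<chi>" if "\<Delta> \<sqsubseteq> \<Theta>" "\<Theta> \<tturnstile> Exists (\<up> a \<doteq> suc (Var 0 \<oplus> \<up> b))" for \<Theta>
        using that(2) by (rule exE, intro E2)
          (use that(1) in \<open>auto simp: eq_iff inst_def\<close>)
    qed
  qed
  have "\<Gamma> \<tturnstile> inst ?\<psi> a"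
  proof (rule ind)
    show "\<Gamma> \<tturnstile> inst ?\<psi> zero" unfolding inst by (rule I1[where d = b]) simp
    show "\<Delta> \<tturnstile> inst ?\<psi> (suc u)" if "\<Delta> \<tturnstile> inst ?\<psi> u" for \<Delta> u
      using that unfolding inst
    proof (rule E)
      show "\<Theta> \<tturnstile> ?\<phi> (suc u)" if "nf \<Theta> b = pls \<Theta> (nf \<Theta> d) (nf \<Theta> u)" for \<Theta> d
      proof (rule nat_cases[of _ d])
        fix \<Lambda> assume "\<Theta> \<sqsubseteq> \<Lambda>" and d: "nf \<Lambda> d = Z \<Lambda>"
        have "nf \<Lambda> b = nf \<Lambda> (d \<oplus> u)" by (rule eq_wk[OF \<open>\<Theta> \<sqsubseteq> \<Lambda>\<close>]) (simp add: that)
        then show "\<Lambda> \<tturnstile> ?\<phi> (suc u)" by (intro I2[where d = zero]) (simp add: d)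
      next
        fix \<Lambda> v assume "\<Theta> \<sqsubseteq> \<Lambda>" and d: "nf \<Lambda> d = S \<Lambda> (nf \<Lambda> v)"
        have "nf \<Lambda> b = nf \<Lambda> (d \<oplus> u)" by (rule eq_wk[OF \<open>\<Theta> \<sqsubseteq> \<Lambda>\<close>]) (simp add: that)
        then show "\<Lambda> \<tturnstile> ?\<phi> (suc u)" by (intro I1[where d = v]) (simp add: d)
      qed
      show "\<Theta> \<tturnstile> ?\<phi> (suc u)" if "nf \<Theta> u = S \<Theta> (pls \<Theta> (nf \<Theta> d) (nf \<Theta> b))" for \<Theta> d
        by (rule I2[where d = "suc d"]) (simp add: that)
    qed
  qed
  then show ?thesis unfolding inst by (rule E) (rule assms; assumption)+
qed

section \<open>The diagonal of a Cantor pair\<close>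

lemma diag_next:
  assumes "diag \<Gamma> (pls \<Gamma> (tri \<Gamma> s) b) = nf \<Gamma> s"
  shows "diag \<Gamma> (S \<Gamma> (pls \<Gamma> (tri \<Gamma> s) b)) = pls \<Gamma> s (mns \<Gamma> (S \<Gamma> (Z \<Gamma>)) (mns \<Gamma> s b))"
  \<comment> \<open>After cancelling \<open>tri s\<close>, the next triangular number exceeds
    \<open>tri s + b + 1\<close> by the truncated difference \<open>s - b\<close>; so the diagonal
    advances only once \<open>b\<close> has reached \<open>s\<close>.\<close>
  using minus_plus_plus[of \<Gamma> s "tri \<Gamma> s" b]
  by (simp add: diag_simps(2) assms ap_strip) (metis plus_comm)

text \<open>A walk along diagonal \<open>s\<close> by induction on \<open>b\<close>. The bound
  \<open>b \<le> s\<close> is expressed by a complement, the inner bound variable; it is quantified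
  inside the induction formula because it is larger by one at the preceding position.\<close>

lemma diag_tri_plus_aux:
  assumes "\<Gamma> \<tturnstile> Fn diag_pr [Fn tri_pr [s]] \<doteq> s"
  shows "\<Gamma> \<tturnstile> inst (Forall (\<up> (\<up> s) \<doteq> Var 1 \<oplus> Var 0 \<^bold>\<longrightarrow>
    Fn diag_pr [Fn tri_pr [\<up> (\<up> s)] \<oplus> Var 1] \<doteq> \<up> (\<up> s))) b" (is "\<Gamma> \<tturnstile> inst ?\<phi> b")
proof (rule ind)
  have "\<Delta> \<tturnstile> Fn diag_pr [Fn tri_pr [s] \<oplus> zero] \<doteq> s" if "\<Gamma> \<sqsubseteq> \<Delta>" for \<Delta>
    using wk[OF that assms] by (simp add: eq_iff)
  then show "\<Gamma> \<tturnstile> inst ?\<phi> zero"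
    unfolding inst_def subst.simps by (intro allI) (simp add: inst_def impI)
  fix \<Delta> u assume \<Delta>: "\<Delta> \<tturnstile> inst ?\<phi> u"
  have "\<Delta> \<tturnstile> s \<doteq> suc u \<oplus> c \<^bold>\<longrightarrow> Fn diag_pr [Fn tri_pr [s] \<oplus> suc u] \<doteq> s" for c
  proof (rule impI)
    fix \<Theta> assume \<Theta>: "\<Delta> \<sqsubseteq> \<Theta>" "\<Theta> \<tturnstile> s \<doteq> suc u \<oplus> c"
    have "\<Delta> \<tturnstile> s \<doteq> u \<oplus> suc c \<^bold>\<longrightarrow> Fn diag_pr [Fn tri_pr [s] \<oplus> u] \<doteq> s"
      using allE[OF \<Delta>[unfolded inst_def subst.simps], of "suc c"] by (simp add: inst_def)
    then have "\<Theta> \<tturnstile> Fn diag_pr [Fn tri_pr [s] \<oplus> u] \<doteq> s"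
      by (rule mp[OF wk[OF \<Theta>(1)]]) (use \<Theta>(2) in \<open>simp add: eq_iff\<close>)
    then have *: "diag \<Theta> (pls \<Theta> (tri \<Theta> s) u) = nf \<Theta> s" by (simp add: eq_iff ap_strip)
    have s: "nf \<Theta> s = pls \<Theta> u (S \<Theta> c)" using \<Theta>(2) by (simp add: eq_iff ap_strip)
    have "mns \<Theta> s u = S \<Theta> c"
      using minus_plus'[of \<Theta> u "S \<Theta> c"] s by (metis ap_strip(2) nf_ap)
    then have "diag \<Theta> (S \<Theta> (pls \<Theta> (tri \<Theta> s) u)) = nf \<Theta> s"
      using diag_next[OF *] by simp
    then show "\<Theta> \<tturnstile> Fn diag_pr [Fn tri_pr [s] \<oplus> suc u] \<doteq> s" by (simp add: eq_iff ap_strip)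
  qed
  then show "\<Delta> \<tturnstile> inst ?\<phi> (suc u)" unfolding inst_def subst.simps by (intro allI) (simp add: inst_def)
qed

lemma diag_tri_plus':
  assumes "\<Gamma> \<tturnstile> Fn diag_pr [Fn tri_pr [s]] \<doteq> s" and "\<Gamma> \<tturnstile> s \<doteq> b \<oplus> c"
  shows "diag \<Gamma> (pls \<Gamma> (tri \<Gamma> s) b) = nf \<Gamma> s"
proof -
  have "\<Gamma> \<tturnstile> s \<doteq> b \<oplus> c \<^bold>\<longrightarrow> Fn diag_pr [Fn tri_pr [s] \<oplus> b] \<doteq> s"
    using allE[OF diag_tri_plus_aux[OF assms(1), of b, unfolded inst_def subst.simps], of c]
    by (simp add: inst_def)
  from mp[OF this assms(2)] show ?thesis by (simp add: eq_iff ap_strip)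
qed

lemma diag_tri: "\<Gamma> \<tturnstile> Fn diag_pr [Fn tri_pr [s]] \<doteq> s"
proof -
  have "\<Gamma> \<tturnstile> inst (Fn diag_pr [Fn tri_pr [Var 0]] \<doteq> Var 0) s"
  proof (rule ind)
    fix \<Delta> u assume "\<Delta> \<tturnstile> inst (Fn diag_pr [Fn tri_pr [Var 0]] \<doteq> Var 0) u"
    then have "\<Delta> \<tturnstile> Fn diag_pr [Fn tri_pr [u]] \<doteq> u" by (simp add: inst_def)
    \<comment> \<open>The last position on diagonal \<open>u\<close>, with complement zero; its
      successor is \<open>tri (u + 1)\<close>, where the next diagonal starts.\<close>
    then have "diag \<Delta> (pls \<Delta> (tri \<Delta> u) u) = nf \<Delta> u"
      by (rule diag_tri_plus'[where c = zero]) (simp add: eq_iff)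
    from diag_next[OF this] have "diag \<Delta> (S \<Delta> (pls \<Delta> u (tri \<Delta> u))) = S \<Delta> u"
      by (simp add: plus_comm[of _ u] ap_strip)
    then show "\<Delta> \<tturnstile> inst (Fn diag_pr [Fn tri_pr [Var 0]] \<doteq> Var 0) (suc u)"
      by (simp add: inst_def eq_iff ap_strip)
  qed (simp add: inst_def eq_iff)
  then show ?thesis by (simp add: inst_def)
qed

lemma diag_tri_plus: "diag \<Gamma> (pls \<Gamma> (tri \<Gamma> (pls \<Gamma> a b)) b) = pls \<Gamma> a b"
  \<comment> \<open>The sum \<open>a \<oplus> b\<close> names the diagonal, \<open>b\<close> is the
    position on it and \<open>a\<close> the complement.\<close>
  using diag_tri_plus'[OF diag_tri, of \<Gamma> "a \<oplus> b" b a] plus_comm[of \<Gamma> a b]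
  by (simp add: eq_iff ap_strip ap_raw)

lemma R_pair [simp]: "R \<Gamma> (pair \<Gamma> a b) = nf \<Gamma> b"
  by (simp add: R_unfold pair_unfold diag_tri_plus)

lemma L_pair [simp]: "L \<Gamma> (pair \<Gamma> a b) = nf \<Gamma> a"
  using R_pair[of \<Gamma> a b] by (simp add: L_unfold) (simp add: pair_unfold diag_tri_plus ap_strip)

lemma L_Z [simp]: "L \<Gamma> (Z \<Gamma>) = Z \<Gamma>"
  by (simp add: L_unfold)

section \<open>Zero and one as truth values\<close>

lemma plus_eq_Z: "pls \<Gamma> a b = Z \<Gamma> \<Longrightarrow> nf \<Gamma> a = Z \<Gamma>"
proof -
  assume *: "pls \<Gamma> a b = Z \<Gamma>"
  have "\<Gamma> \<tturnstile> a \<doteq> zero"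
  proof (rule nat_cases[of _ a])
    fix \<Delta> u assume \<Delta>: "\<Gamma> \<sqsubseteq> \<Delta>" "nf \<Delta> a = S \<Delta> (nf \<Delta> u)"
    have "nf \<Delta> (a \<oplus> b) = nf \<Delta> zero" by (rule eq_wk[OF \<Delta>(1)]) (simp add: * ap_strip)
    then show "\<Delta> \<tturnstile> a \<doteq> zero" by (intro zero_suc) (simp add: \<Delta>)
  qed (simp add: eq_iff)
  then show ?thesis by (simp add: eq_iff)
qed

lemma plus_eq_Z': "pls \<Gamma> a b = Z \<Gamma> \<Longrightarrow> nf \<Gamma> b = Z \<Gamma>"
  by (metis plus_eq_Z plus_comm)

text \<open>\<open>check_pr\<close> codes a conjunction as a product of truth values; this is what
  splits a successful check into its parts.\<close>

lemma times_eq_one: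
  assumes "tms \<Gamma> a b = S \<Gamma> (Z \<Gamma>)"
  shows "nf \<Gamma> a = S \<Gamma> (Z \<Gamma>) \<and> nf \<Gamma> b = S \<Gamma> (Z \<Gamma>)"
proof -
  have "\<Gamma> \<tturnstile> a \<doteq> one \<^bold>\<and> b \<doteq> one"
  proof (rule nat_cases[of _ a])
    fix \<Delta> assume \<Delta>: "\<Gamma> \<sqsubseteq> \<Delta>" "nf \<Delta> a = Z \<Delta>"
    have "nf \<Delta> (a \<otimes> b) = nf \<Delta> one" by (rule eq_wk[OF \<Delta>(1)]) (simp add: assms ap_strip)
    then show "\<Delta> \<tturnstile> a \<doteq> one \<^bold>\<and> b \<doteq> one" by (intro zero_suc[of _ "Z \<Delta>"]) (simp add: \<Delta>)
  next
    fix \<Delta> u assume \<Delta>: "\<Gamma> \<sqsubseteq> \<Delta>" "nf \<Delta> a = S \<Delta> (nf \<Delta> u)"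
    show "\<Delta> \<tturnstile> a \<doteq> one \<^bold>\<and> b \<doteq> one"
    proof (rule nat_cases[of _ b])
      fix \<Theta> assume \<Theta>: "\<Delta> \<sqsubseteq> \<Theta>" "nf \<Theta> b = Z \<Theta>"
      have "nf \<Theta> (a \<otimes> b) = nf \<Theta> one"
        by (rule eq_wk[of \<Gamma>]) (use \<Delta> \<Theta> in \<open>auto simp: assms ap_strip\<close>)
      then show "\<Theta> \<tturnstile> a \<doteq> one \<^bold>\<and> b \<doteq> one" by (intro zero_suc[of _ "Z \<Theta>"]) (simp add: \<Theta>)
    next
      fix \<Theta> v assume \<Theta>: "\<Delta> \<sqsubseteq> \<Theta>" "nf \<Theta> b = S \<Theta> (nf \<Theta> v)"
      have a: "nf \<Theta> a = nf \<Theta> (suc u)" by (rule eq_wk[OF \<Theta>(1)]) (simp add: \<Delta>)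
      have "nf \<Theta> (a \<otimes> b) = nf \<Theta> one"
        by (rule eq_wk[of \<Gamma>]) (use \<Delta> \<Theta> in \<open>auto simp: assms ap_strip\<close>)
      \<comment> \<open>With \<open>a = u + 1\<close> and \<open>b = v + 1\<close>, removing a
        successor from both sides leaves \<open>u * (v + 1) + v = 0\<close>.\<close>
      then have 0: "pls \<Theta> (tms \<Theta> (nf \<Theta> u) (S \<Theta> (nf \<Theta> v))) (nf \<Theta> v) = Z \<Theta>"
        by (simp add: \<Theta> a suc_inject)
      have v: "nf \<Theta> v = Z \<Theta>" using plus_eq_Z'[OF 0] by simp
      have u: "tms \<Theta> (nf \<Theta> u) (S \<Theta> (nf \<Theta> v)) = Z \<Theta>" using plus_eq_Z[OF 0] by simp
      have "\<Theta> \<tturnstile> u \<doteq> zero"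
      proof (rule nat_cases[of _ u])
        fix \<Lambda> w assume \<Lambda>: "\<Theta> \<sqsubseteq> \<Lambda>" "nf \<Lambda> u = S \<Lambda> (nf \<Lambda> w)"
        have "nf \<Lambda> (u \<otimes> suc v) = nf \<Lambda> zero" by (rule eq_wk[OF \<Lambda>(1)]) (simp add: u)
        then show "\<Lambda> \<tturnstile> u \<doteq> zero" by (intro zero_suc) (simp add: \<Lambda>)
      qed (simp add: eq_iff)
      then show "\<Theta> \<tturnstile> a \<doteq> one \<^bold>\<and> b \<doteq> one"
        by (intro conjI) (simp_all add: eq_iff a \<Theta> v)
    qed
  qed
  from conjD1[OF this] conjD2[OF this] show ?thesis by (simp add: eq_iff)
qed

lemma eqn_refl [simp]: "eqn \<Gamma> a a = S \<Gamma> (Z \<Gamma>)"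
  by (simp add: eqn_unfold)

text \<open>Soundness of the equality test: if the numbers differ, one of the two truncated
  differences is a successor, which forces the test down to zero.\<close>

lemma eqn_eq_one:
  assumes "eqn \<Gamma> a b = S \<Gamma> (Z \<Gamma>)"
  shows "nf \<Gamma> a = nf \<Gamma> b"
proof -
  have "\<Gamma> \<tturnstile> a \<doteq> b"
  proof (rule le_cases[of _ b a])
    fix \<Delta> d assume \<Delta>: "\<Gamma> \<sqsubseteq> \<Delta>" "nf \<Delta> b = pls \<Delta> (nf \<Delta> d) (nf \<Delta> a)"
    show "\<Delta> \<tturnstile> a \<doteq> b"
    proof (rule nat_cases[of _ d])
      fix \<Theta> assume \<Theta>: "\<Delta> \<sqsubseteq> \<Theta>" "nf \<Theta> d = Z \<Theta>"
      have "nf \<Theta> b = nf \<Theta> (d \<oplus> a)" by (rule eq_wk[OF \<Theta>(1)]) (simp add: \<Delta>)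
      then show "\<Theta> \<tturnstile> a \<doteq> b" by (simp add: \<Theta> eq_iff)
    next
      fix \<Theta> v assume \<Theta>: "\<Delta> \<sqsubseteq> \<Theta>" "nf \<Theta> d = S \<Theta> (nf \<Theta> v)"
      have b: "nf \<Theta> b = nf \<Theta> (d \<oplus> a)" by (rule eq_wk[OF \<Theta>(1)]) (simp add: \<Delta>)
      have "nf \<Theta> (eqt a b) = nf \<Theta> one"
        by (rule eq_wk[of \<Gamma>]) (use \<Delta> \<Theta> in \<open>auto simp: assms ap_strip\<close>)
      then have "Z \<Theta> = S \<Theta> (Z \<Theta>)"
        using minus_less[of \<Theta> "nf \<Theta> a" "S \<Theta> (nf \<Theta> v)"] minus_plus[of \<Theta> "S \<Theta> (nf \<Theta> v)" "nf \<Theta> a"]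
        by (simp add: b \<Theta> eqn_unfold)
      then show "\<Theta> \<tturnstile> a \<doteq> b" using zero_suc by metis
    qed
  next
    fix \<Theta> v assume \<Theta>: "\<Gamma> \<sqsubseteq> \<Theta>" "nf \<Theta> a = S \<Theta> (pls \<Theta> (nf \<Theta> v) (nf \<Theta> b))"
    have "nf \<Theta> (eqt a b) = nf \<Theta> one"
      by (rule eq_wk[of \<Gamma>]) (use \<Theta> in \<open>auto simp: assms ap_strip\<close>)
    then have "Z \<Theta> = S \<Theta> (Z \<Theta>)"
      using minus_less[of \<Theta> "nf \<Theta> b" "S \<Theta> (nf \<Theta> v)"] minus_plus[of \<Theta> "S \<Theta> (nf \<Theta> v)" "nf \<Theta> b"]
      by (simp add: \<Theta> eqn_unfold)
    then show "\<Theta> \<tturnstile> a \<doteq> b" using zero_suc by metis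
  qed
  then show ?thesis by (simp add: eq_iff)
qed

section \<open>Course-of-values induction and the order\<close>

lemma strong_ind:
  assumes step: "\<And>\<Delta> t. \<Gamma> \<sqsubseteq> \<Delta> \<Longrightarrow>
    (\<And>\<Theta> u d. \<Delta> \<sqsubseteq> \<Theta> \<Longrightarrow> \<Theta> \<tturnstile> t \<doteq> suc (d \<oplus> u) \<Longrightarrow> \<Theta> \<tturnstile> inst \<phi> u) \<Longrightarrow> \<Delta> \<tturnstile> inst \<phi> t"
  shows "\<Gamma> \<tturnstile> inst \<phi> t"
proof -
  \<comment> \<open>States \<open>\<phi>\<close> for all numbers below the current one, the inner
    bound variable being the witness of the inequality; ordinary induction is applied to this
    formula.\<close>
  let ?\<psi> = "Forall (Forall (Var 2 \<doteq> suc (Var 0 \<oplus> Var 1) \<^bold>\<longrightarrow> at \<phi> [Var 1] 3))"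
  have inst1: "inst ?\<psi> t = Forall (Forall (\<up> (\<up> t) \<doteq> suc (Var 0 \<oplus> Var 1) \<^bold>\<longrightarrow> at \<phi> [Var 1] 2))" for t
    by (simp add: inst_def numeral_eq_Suc) (subst subst_at[where k' = "Suc (Suc 0)"]; simp)
  have inst2: "inst (Forall (\<up> (\<up> t) \<doteq> suc (Var 0 \<oplus> Var 1) \<^bold>\<longrightarrow> at \<phi> [Var 1] 2)) u =
      Forall (\<up> t \<doteq> suc (Var 0 \<oplus> \<up> u) \<^bold>\<longrightarrow> at \<phi> [\<up> u] 1)" for t u
    by (simp add: inst_def numeral_eq_Suc) (subst subst_at[where k' = "Suc 0"]; simp)
  have inst3: "inst (\<up> t \<doteq> suc (Var 0 \<oplus> \<up> u) \<^bold>\<longrightarrow> at \<phi> [\<up> u] 1) d =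
      (t \<doteq> suc (d \<oplus> u) \<^bold>\<longrightarrow> inst \<phi> u)" for t u d
    by (simp add: inst_def numeral_eq_Suc)
      (auto simp: at_def less_Suc_eq intro!: arg_cong[where f = "\<lambda>\<sigma>. subst \<sigma> \<phi>"] split: nat.split)
  have I: "\<Delta> \<tturnstile> inst ?\<psi> t"
    if "\<And>\<Theta> u d. \<Delta> \<sqsubseteq> \<Theta> \<Longrightarrow> \<Theta> \<tturnstile> t \<doteq> suc (d \<oplus> u) \<Longrightarrow> \<Theta> \<tturnstile> inst \<phi> u" for \<Delta> t
    unfolding inst1 by (rule allI, unfold inst2, rule allI, unfold inst3, rule impI) (rule that)
  have E: "\<Delta> \<tturnstile> inst \<phi> u" if "\<Delta> \<tturnstile> inst ?\<psi> t" "\<Delta> \<tturnstile> t \<doteq> suc (d \<oplus> u)" for \<Delta> t u d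
    using mp[OF allE[OF allE[OF that(1)[unfolded inst1], of u, unfolded inst2], of d, unfolded inst3] that(2)] .
  \<comment> \<open>At the successor of \<open>t\<close> the bound covers \<open>t\<close> itself,
    with difference zero.\<close>
  have "\<Gamma> \<tturnstile> inst ?\<psi> (suc t)"
  proof (rule ind)
    show "\<Gamma> \<tturnstile> inst ?\<psi> zero"
    proof (rule I)
      fix \<Theta> u d assume "\<Theta> \<tturnstile> zero \<doteq> suc (d \<oplus> u)"
      then have "Z \<Theta> = S \<Theta> (pls \<Theta> (nf \<Theta> d) (nf \<Theta> u))" by (simp add: eq_iff)
      then show "\<Theta> \<tturnstile> inst \<phi> u" by (rule zero_suc[OF HOL.sym])
    qed
    fix \<Delta> v assume \<Delta>: "\<Gamma> \<sqsubseteq> \<Delta>" "\<Delta> \<tturnstile> inst ?\<psi> v"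
    show "\<Delta> \<tturnstile> inst ?\<psi> (suc v)"
    proof (rule I)
      fix \<Theta> u d assume \<Theta>: "\<Delta> \<sqsubseteq> \<Theta>" "\<Theta> \<tturnstile> suc v \<doteq> suc (d \<oplus> u)"
      then have v: "\<Theta> \<tturnstile> v \<doteq> d \<oplus> u" by (simp add: eq_iff suc_inject)
      show "\<Theta> \<tturnstile> inst \<phi> u"
      proof (rule nat_cases[of _ d])
        fix \<Lambda> assume \<Lambda>: "\<Theta> \<sqsubseteq> \<Lambda>" "nf \<Lambda> d = Z \<Lambda>"
        \<comment> \<open>Difference zero means \<open>u = v\<close>, the one number below
          \<open>suc v\<close> that is not below \<open>v\<close>; here the step hypothesis
          enters.\<close>
        have "\<Lambda> \<tturnstile> inst \<phi> v"
        proof (rule step)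
          show "\<Gamma> \<sqsubseteq> \<Lambda>" using \<Delta> \<Theta> \<Lambda> by blast
          show "\<Phi> \<tturnstile> inst \<phi> w" if "\<Lambda> \<sqsubseteq> \<Phi>" "\<Phi> \<tturnstile> v \<doteq> suc (c \<oplus> w)" for \<Phi> w c
            by (rule E[OF wk[OF _ \<Delta>(2)] that(2)]) (use \<Theta> \<Lambda> that in blast)
        qed
        moreover have "\<Lambda> \<tturnstile> v \<doteq> u" using wk[OF \<Lambda>(1) v] \<Lambda>(2) by (simp add: eq_iff)
        ultimately show "\<Lambda> \<tturnstile> inst \<phi> u" by (rule subst_cong[rotated])
      next
        fix \<Lambda> c assume \<Lambda>: "\<Theta> \<sqsubseteq> \<Lambda>" "nf \<Lambda> d = S \<Lambda> (nf \<Lambda> c)"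
        have "\<Lambda> \<tturnstile> v \<doteq> suc (c \<oplus> u)" using wk[OF \<Lambda>(1) v] \<Lambda>(2) by (simp add: eq_iff)
        from E[OF wk[OF _ \<Delta>(2)] this] show "\<Lambda> \<tturnstile> inst \<phi> u" using \<Theta> \<Lambda> by blast
      qed
    qed
  qed
  then show ?thesis by (rule E[where d = zero]) (simp add: eq_iff)
qed

text \<open>The difference is a term found at the meta-level rather than an object-level
  existential, so using a comparison requires no elimination.\<close>

definition le :: "fm list \<Rightarrow> tm \<Rightarrow> tm \<Rightarrow> bool" where
  "le \<Gamma> a b \<longleftrightarrow> (\<exists>d. \<Gamma> \<tturnstile> b \<doteq> d \<oplus> a)"

definition less :: "fm list \<Rightarrow> tm \<Rightarrow> tm \<Rightarrow> bool" where
  "less \<Gamma> a b \<longleftrightarrow> (\<exists>d. \<Gamma> \<tturnstile> b \<doteq> suc (d \<oplus> a))"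

lemma le_trans: "le \<Gamma> a b \<Longrightarrow> le \<Gamma> b c \<Longrightarrow> le \<Gamma> a c"
proof -
  assume "le \<Gamma> a b" "le \<Gamma> b c"
  then obtain d e where "\<Gamma> \<tturnstile> b \<doteq> d \<oplus> a" "\<Gamma> \<tturnstile> c \<doteq> e \<oplus> b" by (auto simp: le_def)
  then have "\<Gamma> \<tturnstile> c \<doteq> (e \<oplus> d) \<oplus> a" by (simp add: eq_iff plus_assoc)
  then show ?thesis by (auto simp: le_def)
qed

lemma le_less_trans: "le \<Gamma> a b \<Longrightarrow> less \<Gamma> b c \<Longrightarrow> less \<Gamma> a c"
proof -
  assume "le \<Gamma> a b" "less \<Gamma> b c"
  then obtain d e where "\<Gamma> \<tturnstile> b \<doteq> d \<oplus> a" "\<Gamma> \<tturnstile> c \<doteq> suc (e \<oplus> b)" by (auto simp: le_def less_def)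
  then have "\<Gamma> \<tturnstile> c \<doteq> suc ((e \<oplus> d) \<oplus> a)" by (simp add: eq_iff plus_assoc)
  then show ?thesis unfolding less_def by blast
qed

lemma monus_le: "le \<Gamma> (a \<ominus> b) a"
proof -
  have "\<Gamma> \<tturnstile> a \<doteq> (a \<ominus> (a \<ominus> b)) \<oplus> (a \<ominus> b)"
  proof (rule le_cases[of _ b a])
    fix \<Delta> d assume *: "nf \<Delta> b = pls \<Delta> (nf \<Delta> d) (nf \<Delta> a)"
    show "\<Delta> \<tturnstile> a \<doteq> (a \<ominus> (a \<ominus> b)) \<oplus> (a \<ominus> b)" by (simp add: eq_iff *)
  next
    fix \<Delta> d assume *: "nf \<Delta> a = S \<Delta> (pls \<Delta> (nf \<Delta> d) (nf \<Delta> b))"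
    have m: "mns \<Delta> (S \<Delta> (pls \<Delta> (nf \<Delta> d) (nf \<Delta> b))) (nf \<Delta> b) = S \<Delta> (nf \<Delta> d)"
      using minus_plus[of \<Delta> "S \<Delta> (nf \<Delta> d)" "nf \<Delta> b"] by simp
    show "\<Delta> \<tturnstile> a \<doteq> (a \<ominus> (a \<ominus> b)) \<oplus> (a \<ominus> b)" by (simp add: eq_iff * m) (metis plus_comm)
  qed
  then show ?thesis by (auto simp: le_def)
qed

text \<open>By induction, as the diagonal number grows by at most one per step. The equation proved
  inside exhibits the difference as an explicit term.\<close>

lemma diag_le: "le \<Gamma> (Fn diag_pr [z]) z"
proof -
  let ?\<phi> = "(Var 0 \<ominus> Fn diag_pr [Var 0]) \<oplus> Fn diag_pr [Var 0] \<doteq> Var 0"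
  have "\<Gamma> \<tturnstile> inst ?\<phi> z"
  proof (rule ind)
    show "\<Gamma> \<tturnstile> inst ?\<phi> zero" by (simp add: inst_def eq_iff)
    fix \<Delta> u assume "\<Delta> \<tturnstile> inst ?\<phi> u"
    then have u: "\<Delta> \<tturnstile> (u \<ominus> Fn diag_pr [u]) \<oplus> Fn diag_pr [u] \<doteq> u" by (simp add: inst_def)
    \<comment> \<open>The diagonal advances from \<open>u\<close> to its successor if and only if
      this term vanishes.\<close>
    let ?t = "Fn tri_pr [suc (Fn diag_pr [u])] \<ominus> suc u"
    show "\<Delta> \<tturnstile> inst ?\<phi> (suc u)"
    proof (rule nat_cases[of _ ?t])
      fix \<Theta> assume \<Theta>: "\<Delta> \<sqsubseteq> \<Theta>" "nf \<Theta> ?t = Z \<Theta>"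
      have d: "diag \<Theta> (S \<Theta> (nf \<Theta> u)) = S \<Theta> (diag \<Theta> (nf \<Theta> u))"
        using \<Theta>(2) by (simp add: diag_simps(2))
      show "\<Theta> \<tturnstile> inst ?\<phi> (suc u)"
        using wk[OF \<Theta>(1) u] by (simp add: inst_def eq_iff d)
    next
      fix \<Theta> v assume \<Theta>: "\<Delta> \<sqsubseteq> \<Theta>" "nf \<Theta> ?t = S \<Theta> (nf \<Theta> v)"
      have d: "diag \<Theta> (S \<Theta> (nf \<Theta> u)) = diag \<Theta> (nf \<Theta> u)"
        using \<Theta>(2) by (simp add: diag_simps(2))
      have "pls \<Theta> (mns \<Theta> (nf \<Theta> u) (diag \<Theta> (nf \<Theta> u))) (diag \<Theta> (nf \<Theta> u)) = nf \<Theta> u"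
        using wk[OF \<Theta>(1) u] by (simp add: eq_iff)
      then have "mns \<Theta> (S \<Theta> (nf \<Theta> u)) (diag \<Theta> (nf \<Theta> u)) = S \<Theta> (mns \<Theta> (nf \<Theta> u) (diag \<Theta> (nf \<Theta> u)))"
        using minus_plus[of \<Theta> "S \<Theta> (mns \<Theta> (nf \<Theta> u) (diag \<Theta> (nf \<Theta> u)))" "diag \<Theta> (nf \<Theta> u)"]
        by simp
      then show "\<Theta> \<tturnstile> inst ?\<phi> (suc u)"
        using wk[OF \<Theta>(1) u] by (simp add: inst_def eq_iff d)
    qed
  qed
  then have "\<Gamma> \<tturnstile> (z \<ominus> Fn diag_pr [z]) \<oplus> Fn diag_pr [z] \<doteq> z" by (simp add: inst_def)
  then show ?thesis using sym unfolding le_def by blast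
qed

lemma le_cong: "nf \<Gamma> a = nf \<Gamma> a' \<Longrightarrow> le \<Gamma> a b \<longleftrightarrow> le \<Gamma> a' b"
  by (simp add: le_def eq_iff)

lemma rgt_le: "le \<Gamma> (rgt z) z"
  using monus_le[of \<Gamma> z "Fn tri_pr [Fn diag_pr [z]]"] by (rule le_cong[THEN iffD1, rotated]) (simp add: R_unfold)

lemma lft_le: "le \<Gamma> (lft z) z"
  by (rule le_trans[OF _ diag_le], rule le_cong[THEN iffD1, rotated, OF monus_le[where b = "rgt z"]]) (simp add: L_unfold)

text \<open>An index with a rule that has premises is positive; hence so is the left component of the tree.\<close>

lemma rgt_less:
  assumes "\<Gamma> \<tturnstile> lft (lft (lft z)) \<doteq> suc u"
  shows "less \<Gamma> (rgt z) z"
proof -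
  have "\<Gamma> \<tturnstile> z \<doteq> suc (prd (z \<ominus> rgt z) \<oplus> rgt z)"
  proof (rule nat_cases[of _ "Fn diag_pr [z]"])
    fix \<Delta> assume \<Delta>: "\<Gamma> \<sqsubseteq> \<Delta>" "nf \<Delta> (Fn diag_pr [z]) = Z \<Delta>"
    have "L \<Delta> (nf \<Delta> z) = Z \<Delta>" using \<Delta>(2) by (simp add: L_unfold)
    then have "S \<Delta> (nf \<Delta> u) = Z \<Delta>" using wk[OF \<Delta>(1) assms] by (simp add: eq_iff)
    then show "\<Delta> \<tturnstile> z \<doteq> suc (prd (z \<ominus> rgt z) \<oplus> rgt z)" by (rule zero_suc)
  next
    fix \<Delta> v assume \<Delta>: "\<Gamma> \<sqsubseteq> \<Delta>" "nf \<Delta> (Fn diag_pr [z]) = S \<Delta> (nf \<Delta> v)"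
    obtain q where q: "\<Delta> \<tturnstile> z \<doteq> q \<oplus> Fn diag_pr [z]" using diag_le le_def by blast
    \<comment> \<open>\<open>y\<close> is the predecessor of \<open>z\<close>. As
      \<open>diag z\<close> is a successor, so is its triangular number; one unit cancels, and
      \<open>R z\<close> is \<open>y\<close> minus something, hence below \<open>z\<close>.\<close>
    define y where "y = q \<oplus> v"
    have "nf \<Delta> z = nf \<Delta> (q \<oplus> Fn diag_pr [z])" using q by (simp only: eq_iff)
    also have "\<dots> = S \<Delta> (nf \<Delta> y)" using \<Delta>(2) by (simp add: y_def)
    finally have z: "nf \<Delta> z = S \<Delta> (nf \<Delta> y)" .
    have "diag \<Delta> (nf \<Delta> z) = S \<Delta> (nf \<Delta> v)" using \<Delta>(2) by simp
    then have r: "R \<Delta> (nf \<Delta> z) = mns \<Delta> (nf \<Delta> y) (pls \<Delta> (nf \<Delta> v) (tri \<Delta> (nf \<Delta> v)))"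
      by (simp add: R_unfold) (simp add: z)
    obtain p where "\<Delta> \<tturnstile> y \<doteq> p \<oplus> (y \<ominus> (v \<oplus> Fn tri_pr [v]))" using monus_le le_def by blast
    then have y: "nf \<Delta> y = pls \<Delta> (nf \<Delta> p) (R \<Delta> (nf \<Delta> z))" by (simp add: eq_iff r)
    have zr: "nf \<Delta> z = pls \<Delta> (S \<Delta> (nf \<Delta> p)) (R \<Delta> (nf \<Delta> z))"
      unfolding plus_simps y[symmetric] by (rule z)
    then have "mns \<Delta> (nf \<Delta> z) (R \<Delta> (nf \<Delta> z)) = S \<Delta> (nf \<Delta> p)"
      using minus_plus[of \<Delta> "S \<Delta> (nf \<Delta> p)" "R \<Delta> (nf \<Delta> z)"] by (metis nf_ap)
    then show "\<Delta> \<tturnstile> z \<doteq> suc (prd (z \<ominus> rgt z) \<oplus> rgt z)" using zr[symmetric] by (simp add: eq_iff)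
  qed
  then show ?thesis unfolding less_def by blast
qed

section \<open>Tables of earlier values\<close>

abbreviation "cmp \<Gamma> z \<equiv> ap \<Gamma> comp_pr [z]"
abbreviation "hist \<Gamma> z \<equiv> ap \<Gamma> hist_pr [z]"
abbreviation "nth_hist \<Gamma> k h \<equiv> ap \<Gamma> drop_pr [k, h]"

lemma comp_unfold: "cmp \<Gamma> z = ap \<Gamma> check_pr [z, hist \<Gamma> z]"
  unfolding comp_pr_def by (simp add: ap_unfold)

lemma hist_simps [simp]: "hist \<Gamma> (S \<Gamma> z) = pair \<Gamma> (cmp \<Gamma> z) (hist \<Gamma> z)"
  unfolding comp_unfold unfolding hist_pr_def by (simp add: ap_unfold)

lemma nth_hist_simps [simp]:
  "nth_hist \<Gamma> (Z \<Gamma>) h = nf \<Gamma> h"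
  "nth_hist \<Gamma> (S \<Gamma> k) h = R \<Gamma> (nth_hist \<Gamma> k h)"
  unfolding drop_pr_def by (simp_all add: ap_unfold)

lemma nth_hist_plus: "nth_hist \<Gamma> k (hist \<Gamma> (pls \<Gamma> k w)) = hist \<Gamma> w"
proof -
  let ?\<phi> = "Forall (Fn drop_pr [Var 1, Fn hist_pr [Var 1 \<oplus> Var 0]] \<doteq> Fn hist_pr [Var 0])"
  have inst1: "inst ?\<phi> k = Forall (Fn drop_pr [\<up> k, Fn hist_pr [\<up> k \<oplus> Var 0]] \<doteq> Fn hist_pr [Var 0])" for k
    by (simp add: inst_def)
  have inst2: "inst (Fn drop_pr [\<up> k, Fn hist_pr [\<up> k \<oplus> Var 0]] \<doteq> Fn hist_pr [Var 0]) w =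
      (Fn drop_pr [k, Fn hist_pr [k \<oplus> w]] \<doteq> Fn hist_pr [w])" for k w
    by (simp add: inst_def)
  have "\<Gamma> \<tturnstile> inst ?\<phi> k"
  proof (rule ind)
    show "\<Gamma> \<tturnstile> inst ?\<phi> zero" unfolding inst1 by (rule allI, unfold inst2) (simp add: eq_iff)
    fix \<Delta> u assume "\<Delta> \<tturnstile> inst ?\<phi> u"
    from allE[OF this[unfolded inst1]]
    have *: "\<Delta> \<tturnstile> Fn drop_pr [u, Fn hist_pr [u \<oplus> w]] \<doteq> Fn hist_pr [w]" for w
      unfolding inst2 .
    show "\<Delta> \<tturnstile> inst ?\<phi> (suc u)"
      unfolding inst1
    proof (rule allI, unfold inst2)
      fix w show "\<Delta> \<tturnstile> Fn drop_pr [suc u, Fn hist_pr [suc u \<oplus> w]] \<doteq> Fn hist_pr [w]"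
        \<comment> \<open>Dropping one more entry means using the hypothesis at \<open>suc w\<close>
          and then removing the top entry of the table that remains.\<close>
        using *[of "suc w"] by (simp add: eq_iff)
    qed
  qed
  from allE[OF this[unfolded inst1], of w]
  have "\<Gamma> \<tturnstile> Fn drop_pr [k, Fn hist_pr [k \<oplus> w]] \<doteq> Fn hist_pr [w]" unfolding inst2 .
  then show ?thesis by (simp add: eq_iff ap_strip)
qed

text \<open>For \<open>u \<ge> z\<close> the truncated subtraction makes this entry the one for \<open>z - 1\<close>.\<close>

lemma nth_hist_comp:
  assumes "less \<Gamma> u z"
  shows "L \<Gamma> (nth_hist \<Gamma> (mns \<Gamma> (nf \<Gamma> z) (S \<Gamma> (nf \<Gamma> u))) (hist \<Gamma> (nf \<Gamma> z))) = cmp \<Gamma> (nf \<Gamma> u)"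
proof -
  obtain d where z: "nf \<Gamma> z = S \<Gamma> (pls \<Gamma> (nf \<Gamma> d) (nf \<Gamma> u))"
    using assms by (auto simp: less_def eq_iff)
  show ?thesis using nth_hist_plus[of \<Gamma> "nf \<Gamma> d" "S \<Gamma> (nf \<Gamma> u)"] by (simp add: z del: hist_simps) simp
qed

lemma eqn_S_S [simp]: "eqn \<Gamma> (S \<Gamma> a) (S \<Gamma> b) = eqn \<Gamma> a b"
  by (simp add: eqn_unfold)

lemma eqn_S_Z [simp]: "eqn \<Gamma> (S \<Gamma> a) (Z \<Gamma>) = Z \<Gamma>"
  by (simp add: eqn_unfold)

lemma eqn_Z_S [simp]: "eqn \<Gamma> (Z \<Gamma>) (S \<Gamma> a) = Z \<Gamma>"
  by (simp add: eqn_unfold)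

section \<open>Computation trees\<close>

abbreviation cmpt :: "tm \<Rightarrow> tm" where "cmpt z \<equiv> Fn comp_pr [z]"
abbreviation idx :: "tm \<Rightarrow> tm" where "idx z \<equiv> lft (lft z)"
abbreviation inp :: "tm \<Rightarrow> tm" where "inp z \<equiv> rgt (lft z)"
abbreviation val :: "tm \<Rightarrow> tm" where "val z \<equiv> lft (rgt z)"
abbreviation sub1 :: "tm \<Rightarrow> tm" where "sub1 z \<equiv> lft (rgt (rgt z))"
abbreviation sub2 :: "tm \<Rightarrow> tm" where "sub2 z \<equiv> rgt (rgt (rgt z))"
abbreviation okt :: "tm \<Rightarrow> tm \<Rightarrow> tm \<Rightarrow> tm" where "okt u f j \<equiv> cmpt u \<otimes> eqt (lft u) (pr f j)"

lemma sub_less: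
  assumes "\<Gamma> \<tturnstile> lft (idx z) \<doteq> suc u"
  shows "less \<Gamma> (sub1 z) z" "less \<Gamma> (sub2 z) z"
  using rgt_less[OF assms] le_less_trans le_trans lft_le rgt_le by blast+

text \<open>Replaces the table look-ups for the two subtrees by values of \<open>comp_pr\<close>.
  The left sides have the shape that the simplifier reaches when it unfolds \<open>check_pr\<close>,
  and \<open>u\<close> is meant to be the predecessor of the tag.\<close>

lemma nth_hist_sub:
  assumes "\<Gamma> \<tturnstile> lft (idx z) \<doteq> suc u"
  shows
    "L \<Gamma> (nth_hist \<Gamma> (mns \<Gamma> (nf \<Gamma> z) (S \<Gamma> (L \<Gamma> (R \<Gamma> (R \<Gamma> (nf \<Gamma> z)))))) (hist \<Gamma> (nf \<Gamma> z))) =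
      cmp \<Gamma> (L \<Gamma> (R \<Gamma> (R \<Gamma> (nf \<Gamma> z))))"
    "L \<Gamma> (nth_hist \<Gamma> (mns \<Gamma> (nf \<Gamma> z) (S \<Gamma> (R \<Gamma> (R \<Gamma> (R \<Gamma> (nf \<Gamma> z)))))) (hist \<Gamma> (nf \<Gamma> z))) =
      cmp \<Gamma> (R \<Gamma> (R \<Gamma> (R \<Gamma> (nf \<Gamma> z))))"
  using sub_less[OF assms, THEN nth_hist_comp] by simp_all

lemmas check_unfold = comp_unfold check_pr_def Let_def ap_fun_of

text \<open>Once the tag is a numeral, the equality tests in \<open>check_pr\<close> evaluate and a
  single summand survives; the lemmas from here to \<open>comp_mu_suc\<close> read off that summand
  for each rule.\<close>

lemma comp_base:
  assumes "\<Gamma> \<tturnstile> lft (idx z) \<doteq> num i"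
  shows "i = 0 \<Longrightarrow> \<Gamma> \<tturnstile> cmpt z \<doteq> eqt (val z) zero"
    and "i = 1 \<Longrightarrow> \<Gamma> \<tturnstile> cmpt z \<doteq> eqt (val z) (suc (inp z))"
    and "i = 2 \<Longrightarrow> \<Gamma> \<tturnstile> cmpt z \<doteq> eqt (val z) (lft (inp z))"
    and "i = 3 \<Longrightarrow> \<Gamma> \<tturnstile> cmpt z \<doteq> eqt (val z) (rgt (inp z))"
  using assms
  by (simp_all add: eq_iff check_unfold arg_def numeral_eq_Suc)

lemma comp_pair:
  assumes "\<Gamma> \<tturnstile> lft (idx z) \<doteq> num 4"
  shows "\<Gamma> \<tturnstile> cmpt z \<doteq> okt (sub1 z) (lft (rgt (idx z))) (inp z) \<otimes>
    okt (sub2 z) (rgt (rgt (idx z))) (inp z) \<otimes> eqt (val z) (pr (val (sub1 z)) (val (sub2 z)))"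
  using assms nth_hist_sub[of \<Gamma> z "num 3"]
  by (simp add: eq_iff check_unfold arg_def numeral_eq_Suc)

lemma comp_comp:
  assumes "\<Gamma> \<tturnstile> lft (idx z) \<doteq> num 5"
  shows "\<Gamma> \<tturnstile> cmpt z \<doteq> okt (sub1 z) (rgt (rgt (idx z))) (inp z) \<otimes>
    okt (sub2 z) (lft (rgt (idx z))) (val (sub1 z)) \<otimes> eqt (val z) (val (sub2 z))"
  using assms nth_hist_sub[of \<Gamma> z "num 4"]
  by (simp add: eq_iff check_unfold arg_def numeral_eq_Suc)

lemma comp_rec_zero:
  assumes "\<Gamma> \<tturnstile> lft (idx z) \<doteq> num 6" and "\<Gamma> \<tturnstile> rgt (inp z) \<doteq> zero"
  shows "\<Gamma> \<tturnstile> cmpt z \<doteq> okt (sub1 z) (lft (rgt (idx z))) (lft (inp z)) \<otimes> eqt (val z) (val (sub1 z))"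
  using assms nth_hist_sub[of \<Gamma> z "num 5"]
  by (simp add: eq_iff check_unfold arg_def numeral_eq_Suc)

lemma comp_rec_suc:
  assumes "\<Gamma> \<tturnstile> lft (idx z) \<doteq> num 6" and "\<Gamma> \<tturnstile> rgt (inp z) \<doteq> suc u"
  shows "\<Gamma> \<tturnstile> cmpt z \<doteq> okt (sub1 z) (idx z) (pr (lft (inp z)) (prd (rgt (inp z)))) \<otimes>
    okt (sub2 z) (rgt (rgt (idx z))) (pr (pr (lft (inp z)) (prd (rgt (inp z)))) (val (sub1 z))) \<otimes>
    eqt (val z) (val (sub2 z))"
  using assms nth_hist_sub[of \<Gamma> z "num 5"]
  by (simp add: eq_iff check_unfold arg_def numeral_eq_Suc)

lemma comp_mu_zero:
  assumes "\<Gamma> \<tturnstile> lft (idx z) \<doteq> num 7" and "\<Gamma> \<tturnstile> val (sub1 z) \<doteq> zero"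
  shows "\<Gamma> \<tturnstile> cmpt z \<doteq> okt (sub1 z) (rgt (idx z)) (inp z) \<otimes> eqt (val z) (rgt (inp z))"
  using assms nth_hist_sub[of \<Gamma> z "num 6"]
  by (simp add: eq_iff check_unfold arg_def numeral_eq_Suc)

lemma comp_mu_suc:
  assumes "\<Gamma> \<tturnstile> lft (idx z) \<doteq> num 7" and "\<Gamma> \<tturnstile> val (sub1 z) \<doteq> suc u"
  shows "\<Gamma> \<tturnstile> cmpt z \<doteq> okt (sub1 z) (rgt (idx z)) (inp z) \<otimes>
    (okt (sub2 z) (idx z) (pr (lft (inp z)) (suc (rgt (inp z)))) \<otimes> eqt (val z) (val (sub2 z)))"
  using assms nth_hist_sub[of \<Gamma> z "num 6"]
  by (simp add: eq_iff check_unfold arg_def numeral_eq_Suc)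

text \<open>The rules occupy the tags 0 to 7, so for a larger tag every summand of
  \<open>check_pr\<close> is zero.\<close>

lemma comp_none:
  assumes "\<Gamma> \<tturnstile> lft (idx z) \<doteq> (suc ^^ 8) u" and "\<Gamma> \<tturnstile> cmpt z \<doteq> one"
  shows "\<Gamma> \<tturnstile> \<chi>"
proof (rule zero_suc)
  show "S \<Gamma> (Z \<Gamma>) = Z \<Gamma>"
    using assms by (simp add: eq_iff check_unfold arg_def numeral_eq_Suc)
qed

lemma times_one: "\<Gamma> \<tturnstile> s \<otimes> t \<doteq> one \<Longrightarrow> (\<Gamma> \<tturnstile> s \<doteq> one) \<and> (\<Gamma> \<tturnstile> t \<doteq> one)"
  using times_eq_one[of \<Gamma> "nf \<Gamma> s" "nf \<Gamma> t"] by (simp add: eq_iff)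

lemma eqt_one: "\<Gamma> \<tturnstile> eqt s t \<doteq> one \<Longrightarrow> \<Gamma> \<tturnstile> s \<doteq> t"
  using eqn_eq_one[of \<Gamma> "nf \<Gamma> s" "nf \<Gamma> t"] by (simp add: eq_iff)

lemma num_cases:
  assumes "\<And>\<Delta> i. \<Gamma> \<sqsubseteq> \<Delta> \<Longrightarrow> i < k \<Longrightarrow> \<Delta> \<tturnstile> t \<doteq> num i \<Longrightarrow> \<Delta> \<tturnstile> \<chi>"
    and "\<And>\<Delta> u. \<Gamma> \<sqsubseteq> \<Delta> \<Longrightarrow> \<Delta> \<tturnstile> t \<doteq> (suc ^^ k) u \<Longrightarrow> \<Delta> \<tturnstile> \<chi>"
  shows "\<Gamma> \<tturnstile> \<chi>"
  using assms
proof (induction k)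
  case 0
  show ?case by (rule "0"(2)[of \<Gamma> t]) (simp_all add: refl)
next
  case (Suc k)
  show ?case
  proof (rule Suc.IH)
    show "\<Delta> \<tturnstile> \<chi>" if "\<Gamma> \<sqsubseteq> \<Delta>" "i < k" "\<Delta> \<tturnstile> t \<doteq> num i" for \<Delta> i
      using Suc.prems(1)[of \<Delta> i] that by simp
    have cong: "nf \<Delta> u = nf \<Delta> v \<Longrightarrow> nf \<Delta> ((suc ^^ k) u) = nf \<Delta> ((suc ^^ k) v)" for \<Delta> u v
      by (induction k) simp_all
    have num: "(suc ^^ k) zero = num k" by (induction k) simp_all
    show "\<Delta> \<tturnstile> \<chi>" if \<Delta>: "\<Gamma> \<sqsubseteq> \<Delta>" "\<Delta> \<tturnstile> t \<doteq> (suc ^^ k) u" for \<Delta> u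
    proof (rule nat_cases[of _ u])
      fix \<Theta> assume \<Theta>: "\<Delta> \<sqsubseteq> \<Theta>" "nf \<Theta> u = Z \<Theta>"
      show "\<Theta> \<tturnstile> \<chi>"
        using Suc.prems(1)[of \<Theta> k] \<Delta> \<Theta> wk[OF \<Theta>(1) \<Delta>(2)] cong[of \<Theta> u zero] by (simp add: num eq_iff)
    next
      fix \<Theta> v assume \<Theta>: "\<Delta> \<sqsubseteq> \<Theta>" "nf \<Theta> u = S \<Theta> (nf \<Theta> v)"
      show "\<Theta> \<tturnstile> \<chi>"
        using Suc.prems(2)[of \<Theta> v] \<Delta> \<Theta> wk[OF \<Theta>(1) \<Delta>(2)] cong[of \<Theta> u "suc v"]
        by (simp add: eq_iff funpow_Suc_right del: funpow.simps)
    qed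
  qed
qed

lemma ok_one:
  assumes "\<Gamma> \<tturnstile> okt u f j \<doteq> one"
  shows "\<Gamma> \<tturnstile> cmpt u \<doteq> one" "\<Gamma> \<tturnstile> lft u \<doteq> pr f j"
  using times_one[OF assms] eqt_one by simp_all

lemma comp_inv2:
  assumes "\<Gamma> \<tturnstile> cmpt z \<doteq> one" and "\<Gamma> \<tturnstile> cmpt z \<doteq> okt u f j \<otimes> eqt a b"
  shows "\<Gamma> \<tturnstile> cmpt u \<doteq> one" "\<Gamma> \<tturnstile> lft u \<doteq> pr f j" "\<Gamma> \<tturnstile> a \<doteq> b"
  using times_one[OF trans[OF sym[OF assms(2)] assms(1)]] ok_one eqt_one by blast+

lemma comp_inv3:
  assumes "\<Gamma> \<tturnstile> cmpt z \<doteq> one" and "\<Gamma> \<tturnstile> cmpt z \<doteq> okt u f j \<otimes> okt v g k \<otimes> eqt a b"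
  shows "\<Gamma> \<tturnstile> cmpt u \<doteq> one" "\<Gamma> \<tturnstile> lft u \<doteq> pr f j" "\<Gamma> \<tturnstile> cmpt v \<doteq> one" "\<Gamma> \<tturnstile> lft v \<doteq> pr g k" "\<Gamma> \<tturnstile> a \<doteq> b"
proof -
  have *: "\<Gamma> \<tturnstile> okt u f j \<otimes> okt v g k \<doteq> one" "\<Gamma> \<tturnstile> eqt a b \<doteq> one"
    using times_one[OF trans[OF sym[OF assms(2)] assms(1)]] by simp_all
  show "\<Gamma> \<tturnstile> cmpt u \<doteq> one" "\<Gamma> \<tturnstile> lft u \<doteq> pr f j" "\<Gamma> \<tturnstile> cmpt v \<doteq> one" "\<Gamma> \<tturnstile> lft v \<doteq> pr g k" "\<Gamma> \<tturnstile> a \<doteq> b"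
    using times_one[OF *(1)] ok_one eqt_one[OF *(2)] by blast+
qed

lemma comp_inv3':
  assumes "\<Gamma> \<tturnstile> cmpt z \<doteq> one" and "\<Gamma> \<tturnstile> cmpt z \<doteq> okt u f j \<otimes> (okt v g k \<otimes> eqt a b)"
  shows "\<Gamma> \<tturnstile> cmpt v \<doteq> one" "\<Gamma> \<tturnstile> lft v \<doteq> pr g k" "\<Gamma> \<tturnstile> a \<doteq> b"
proof -
  have *: "\<Gamma> \<tturnstile> okt v g k \<otimes> eqt a b \<doteq> one"
    using times_one[OF trans[OF sym[OF assms(2)] assms(1)]] by simp_all
  show "\<Gamma> \<tturnstile> cmpt v \<doteq> one" "\<Gamma> \<tturnstile> lft v \<doteq> pr g k" "\<Gamma> \<tturnstile> a \<doteq> b"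
    using times_one[OF *] ok_one eqt_one by blast+
qed

text \<open>Both branches of minimisation check the same first premise, so it can be extracted
  before it is known which branch applies. Uniqueness needs this order, since two trees must first
  agree on the tested value.\<close>

lemma comp_mu:
  assumes i: "\<Gamma> \<tturnstile> lft (idx z) \<doteq> num 7" and z: "\<Gamma> \<tturnstile> cmpt z \<doteq> one"
  shows "\<Gamma> \<tturnstile> cmpt (sub1 z) \<doteq> one \<^bold>\<and> lft (sub1 z) \<doteq> pr (rgt (idx z)) (inp z)"
proof (rule nat_cases[of _ "val (sub1 z)"])
  fix \<Delta> assume \<Delta>: "\<Gamma> \<sqsubseteq> \<Delta>" "nf \<Delta> (val (sub1 z)) = Z \<Delta>"
  then have "\<Delta> \<tturnstile> val (sub1 z) \<doteq> zero" by (simp only: eq_iff nf_Fn) simp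
  from times_one[OF trans[OF sym[OF comp_mu_zero[OF wk[OF \<Delta>(1) i] this]] wk[OF \<Delta>(1) z]]]
  show "\<Delta> \<tturnstile> cmpt (sub1 z) \<doteq> one \<^bold>\<and> lft (sub1 z) \<doteq> pr (rgt (idx z)) (inp z)"
    using conjI ok_one by blast
next
  fix \<Delta> u assume \<Delta>: "\<Gamma> \<sqsubseteq> \<Delta>" "nf \<Delta> (val (sub1 z)) = S \<Delta> (nf \<Delta> u)"
  then have "\<Delta> \<tturnstile> val (sub1 z) \<doteq> suc u" by (simp only: eq_iff nf_Fn) simp
  from times_one[OF trans[OF sym[OF comp_mu_suc[OF wk[OF \<Delta>(1) i] this]] wk[OF \<Delta>(1) z]]]
  show "\<Delta> \<tturnstile> cmpt (sub1 z) \<doteq> one \<^bold>\<and> lft (sub1 z) \<doteq> pr (rgt (idx z)) (inp z)"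
    using conjI ok_one by blast
qed

text \<open>Index and input determine the rule, up to the tested value in minimisation. First
  premises therefore have equal index and input, hence equal values, and these fix index and input
  of the second premises. The size bound in \<open>IH\<close> concerns only the first tree, so
  subtrees of \<open>z'\<close> require no estimate.\<close>

lemma val_unique_step:
  assumes IH: "\<And>\<Delta> u u'. \<Gamma> \<sqsubseteq> \<Delta> \<Longrightarrow> less \<Delta> u z \<Longrightarrow> \<Delta> \<tturnstile> cmpt u \<doteq> one \<Longrightarrow> \<Delta> \<tturnstile> cmpt u' \<doteq> one \<Longrightarrow>
      \<Delta> \<tturnstile> lft u \<doteq> lft u' \<Longrightarrow> \<Delta> \<tturnstile> val u \<doteq> val u'"
    and z: "\<Gamma> \<tturnstile> cmpt z \<doteq> one" and z': "\<Gamma> \<tturnstile> cmpt z' \<doteq> one" and eq: "\<Gamma> \<tturnstile> lft z \<doteq> lft z'"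
  shows "\<Gamma> \<tturnstile> val z \<doteq> val z'"
proof (rule num_cases[where k = 8 and t = "lft (idx z)"])
  show "\<Delta> \<tturnstile> val z \<doteq> val z'" if "\<Gamma> \<sqsubseteq> \<Delta>" "\<Delta> \<tturnstile> lft (idx z) \<doteq> (suc ^^ 8) u" for \<Delta> u
    using comp_none[OF that(2) wk[OF that(1) z]] .
  fix \<Delta> i assume \<Delta>: "\<Gamma> \<sqsubseteq> \<Delta>" and "i < 8" and i: "\<Delta> \<tturnstile> lft (idx z) \<doteq> num i"
  have eqs: "L \<Theta> (nf \<Theta> z) = L \<Theta> (nf \<Theta> z')" if "\<Gamma> \<sqsubseteq> \<Theta>" for \<Theta>
    using wk[OF that eq] by (simp add: eq_iff)
  note eq\<Delta> = eqs[OF \<Delta>]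
  note z = wk[OF \<Delta> z] and z' = wk[OF \<Delta> z']
  have i': "\<Delta> \<tturnstile> lft (idx z') \<doteq> num i" using i by (simp add: eq_iff eq\<Delta>)
  have less: "less \<Delta> (sub1 z) z" "less \<Delta> (sub2 z) z" if "i > 0"
    using sub_less[of \<Delta> z "num (i - 1)"] i that by (cases i; simp)+
  note tr = trans[OF sym]
  \<comment> \<open>Case numbers are shifted: case \<open>j\<close> below treats tag
    \<open>j - 1\<close>.\<close>
  consider "i = 0" | "i = 1" | "i = 2" | "i = 3" | "i = 4" | "i = 5" | "i = 6" | "i = 7"
    using \<open>i < 8\<close> by linarith
  then show "\<Delta> \<tturnstile> val z \<doteq> val z'"
  proof cases
    case 1
    show ?thesis
      using tr[OF comp_base(1)[OF i 1] z, THEN eqt_one] tr[OF comp_base(1)[OF i' 1] z', THEN eqt_one]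
      by (simp add: eq_iff)
  next
    case 2
    show ?thesis
      using tr[OF comp_base(2)[OF i 2] z, THEN eqt_one] tr[OF comp_base(2)[OF i' 2] z', THEN eqt_one]
      by (simp add: eq_iff eq\<Delta>)
  next
    case 3
    show ?thesis
      using tr[OF comp_base(3)[OF i 3] z, THEN eqt_one] tr[OF comp_base(3)[OF i' 3] z', THEN eqt_one]
      by (simp add: eq_iff eq\<Delta>)
  next
    case 4
    show ?thesis
      using tr[OF comp_base(4)[OF i 4] z, THEN eqt_one] tr[OF comp_base(4)[OF i' 4] z', THEN eqt_one]
      by (simp add: eq_iff eq\<Delta>)
  next
    case 5
    note a = comp_inv3[OF z comp_pair[OF i[unfolded 5]]]
    note b = comp_inv3[OF z' comp_pair[OF i'[unfolded 5]]]
    have "\<Delta> \<tturnstile> val (sub1 z) \<doteq> val (sub1 z')"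
      by (rule IH[OF \<Delta> less(1) a(1) b(1)]) (use 5 a(2) b(2) in \<open>simp_all add: eq_iff eq\<Delta>\<close>)
    moreover have "\<Delta> \<tturnstile> val (sub2 z) \<doteq> val (sub2 z')"
      by (rule IH[OF \<Delta> less(2) a(3) b(3)]) (use 5 a(4) b(4) in \<open>simp_all add: eq_iff eq\<Delta>\<close>)
    ultimately show ?thesis using a(5) b(5) by (simp add: eq_iff)
  next
    case 6
    note a = comp_inv3[OF z comp_comp[OF i[unfolded 6]]]
    note b = comp_inv3[OF z' comp_comp[OF i'[unfolded 6]]]
    have v: "\<Delta> \<tturnstile> val (sub1 z) \<doteq> val (sub1 z')"
      by (rule IH[OF \<Delta> less(1) a(1) b(1)]) (use 6 a(2) b(2) in \<open>simp_all add: eq_iff eq\<Delta>\<close>)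
    have "\<Delta> \<tturnstile> val (sub2 z) \<doteq> val (sub2 z')"
      by (rule IH[OF \<Delta> less(2) a(3) b(3)]) (use 6 a(4) b(4) v in \<open>simp_all add: eq_iff eq\<Delta>\<close>)
    then show ?thesis using a(5) b(5) by (simp add: eq_iff)
  next
    case 7
    show ?thesis
    proof (rule nat_cases[of _ "rgt (inp z)"])
      fix \<Theta> assume \<Theta>: "\<Delta> \<sqsubseteq> \<Theta>" "nf \<Theta> (rgt (inp z)) = Z \<Theta>"
      have \<Gamma>\<Theta>: "\<Gamma> \<sqsubseteq> \<Theta>" using \<Delta> \<Theta> by blast
      note eq\<Theta> = eqs[OF \<Gamma>\<Theta>]
      have k: "\<Theta> \<tturnstile> rgt (inp z) \<doteq> zero" "\<Theta> \<tturnstile> rgt (inp z') \<doteq> zero"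
        using \<Theta>(2) by (simp_all add: eq_iff eq\<Theta>)
      have less: "less \<Theta> (sub1 z) z"
        using sub_less(1)[of \<Theta> z "num 5"] wk[OF \<Theta>(1) i] 7 by (simp add: numeral_eq_Suc)
      note a = comp_inv2[OF wk[OF \<Theta>(1) z] comp_rec_zero[OF wk[OF \<Theta>(1) i[unfolded 7]] k(1)]]
      note b = comp_inv2[OF wk[OF \<Theta>(1) z'] comp_rec_zero[OF wk[OF \<Theta>(1) i'[unfolded 7]] k(2)]]
      have "\<Theta> \<tturnstile> val (sub1 z) \<doteq> val (sub1 z')"
        by (rule IH[OF \<Gamma>\<Theta> less a(1) b(1)]) (use a(2) b(2) in \<open>simp add: eq_iff eq\<Theta>\<close>)
      then show "\<Theta> \<tturnstile> val z \<doteq> val z'" using a(3) b(3) by (simp add: eq_iff)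
    next
      fix \<Theta> u assume \<Theta>: "\<Delta> \<sqsubseteq> \<Theta>" "nf \<Theta> (rgt (inp z)) = S \<Theta> (nf \<Theta> u)"
      have \<Gamma>\<Theta>: "\<Gamma> \<sqsubseteq> \<Theta>" using \<Delta> \<Theta> by blast
      note eq\<Theta> = eqs[OF \<Gamma>\<Theta>]
      have k: "\<Theta> \<tturnstile> rgt (inp z) \<doteq> suc u" "\<Theta> \<tturnstile> rgt (inp z') \<doteq> suc u"
        using \<Theta>(2) by (simp_all add: eq_iff eq\<Theta>)
      have less: "less \<Theta> (sub1 z) z" "less \<Theta> (sub2 z) z"
        using sub_less[of \<Theta> z "num 5"] wk[OF \<Theta>(1) i] 7 by (simp_all add: numeral_eq_Suc)
      note a = comp_inv3[OF wk[OF \<Theta>(1) z] comp_rec_suc[OF wk[OF \<Theta>(1) i[unfolded 7]] k(1)]]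
      note b = comp_inv3[OF wk[OF \<Theta>(1) z'] comp_rec_suc[OF wk[OF \<Theta>(1) i'[unfolded 7]] k(2)]]
      have v: "\<Theta> \<tturnstile> val (sub1 z) \<doteq> val (sub1 z')"
        by (rule IH[OF \<Gamma>\<Theta> less(1) a(1) b(1)]) (use a(2) b(2) in \<open>simp add: eq_iff eq\<Theta>\<close>)
      have "\<Theta> \<tturnstile> val (sub2 z) \<doteq> val (sub2 z')"
        by (rule IH[OF \<Gamma>\<Theta> less(2) a(3) b(3)]) (use a(4) b(4) v in \<open>simp add: eq_iff eq\<Theta>\<close>)
      then show "\<Theta> \<tturnstile> val z \<doteq> val z'" using a(5) b(5) by (simp add: eq_iff)
    qed
  next
    case 8
    note a = comp_mu[OF i[unfolded 8] z, THEN conjD1] comp_mu[OF i[unfolded 8] z, THEN conjD2]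
    note b = comp_mu[OF i'[unfolded 8] z', THEN conjD1] comp_mu[OF i'[unfolded 8] z', THEN conjD2]
    \<comment> \<open>The tested values are compared first, so that both searches are known to stop
      or to continue together.\<close>
    have v: "\<Delta> \<tturnstile> val (sub1 z) \<doteq> val (sub1 z')"
      by (rule IH[OF \<Delta> less(1) a(1) b(1)]) (use 8 a(2) b(2) in \<open>simp_all add: eq_iff eq\<Delta>\<close>)
    show ?thesis
    proof (rule nat_cases[of _ "val (sub1 z)"])
      fix \<Theta> assume \<Theta>: "\<Delta> \<sqsubseteq> \<Theta>" "nf \<Theta> (val (sub1 z)) = Z \<Theta>"
      have \<Gamma>\<Theta>: "\<Gamma> \<sqsubseteq> \<Theta>" using \<Delta> \<Theta> by blast
      note eq\<Theta> = eqs[OF \<Gamma>\<Theta>]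
      have k: "\<Theta> \<tturnstile> val (sub1 z) \<doteq> zero" "\<Theta> \<tturnstile> val (sub1 z') \<doteq> zero"
        using \<Theta>(2) wk[OF \<Theta>(1) v] by (simp_all add: eq_iff)
      note a = comp_inv2[OF wk[OF \<Theta>(1) z] comp_mu_zero[OF wk[OF \<Theta>(1) i[unfolded 8]] k(1)]]
      note b = comp_inv2[OF wk[OF \<Theta>(1) z'] comp_mu_zero[OF wk[OF \<Theta>(1) i'[unfolded 8]] k(2)]]
      show "\<Theta> \<tturnstile> val z \<doteq> val z'" using a(3) b(3) by (simp add: eq_iff eq\<Theta>)
    next
      fix \<Theta> u assume \<Theta>: "\<Delta> \<sqsubseteq> \<Theta>" "nf \<Theta> (val (sub1 z)) = S \<Theta> (nf \<Theta> u)"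
      have \<Gamma>\<Theta>: "\<Gamma> \<sqsubseteq> \<Theta>" using \<Delta> \<Theta> by blast
      note eq\<Theta> = eqs[OF \<Gamma>\<Theta>]
      have k: "\<Theta> \<tturnstile> val (sub1 z) \<doteq> suc u" "\<Theta> \<tturnstile> val (sub1 z') \<doteq> suc u"
        using \<Theta>(2) wk[OF \<Theta>(1) v] by (simp_all add: eq_iff)
      have less: "less \<Theta> (sub2 z) z"
        using sub_less(2)[of \<Theta> z "num 6"] wk[OF \<Theta>(1) i] 8 by (simp add: numeral_eq_Suc)
      note a = comp_inv3'[OF wk[OF \<Theta>(1) z] comp_mu_suc[OF wk[OF \<Theta>(1) i[unfolded 8]] k(1)]]
      note b = comp_inv3'[OF wk[OF \<Theta>(1) z'] comp_mu_suc[OF wk[OF \<Theta>(1) i'[unfolded 8]] k(2)]]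
      have "\<Theta> \<tturnstile> val (sub2 z) \<doteq> val (sub2 z')"
        by (rule IH[OF \<Gamma>\<Theta> less a(1) b(1)]) (use a(2) b(2) in \<open>simp add: eq_iff eq\<Theta>\<close>)
      then show "\<Theta> \<tturnstile> val z \<doteq> val z'" using a(3) b(3) by (simp add: eq_iff)
    qed
  qed
qed

lemma val_unique:
  assumes "\<Gamma> \<tturnstile> cmpt z \<doteq> one" "\<Gamma> \<tturnstile> cmpt z' \<doteq> one" "\<Gamma> \<tturnstile> lft z \<doteq> lft z'"
  shows "\<Gamma> \<tturnstile> val z \<doteq> val z'"
proof -
  let ?\<chi> = "\<lambda>z z'. cmpt z \<doteq> one \<^bold>\<longrightarrow> cmpt z' \<doteq> one \<^bold>\<longrightarrow> lft z \<doteq> lft z' \<^bold>\<longrightarrow> val z \<doteq> val z'"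
  \<comment> \<open>The second tree is quantified inside the induction formula, because its subtrees
    take its place when the hypothesis is used.\<close>
  let ?\<phi> = "Forall (?\<chi> (Var 1) (Var 0))"
  have inst1: "inst ?\<phi> z = Forall (?\<chi> (\<up> z) (Var 0))" for z by (simp add: inst_def)
  have inst2: "inst (?\<chi> (\<up> z) (Var 0)) z' = ?\<chi> z z'" for z z' by (simp add: inst_def)
  have E: "\<Delta> \<tturnstile> val u \<doteq> val u'"
    if "\<Delta> \<tturnstile> inst ?\<phi> u" "\<Delta> \<tturnstile> cmpt u \<doteq> one" "\<Delta> \<tturnstile> cmpt u' \<doteq> one" "\<Delta> \<tturnstile> lft u \<doteq> lft u'" for \<Delta> u u'
    using mp[OF mp[OF mp[OF allE[OF that(1)[unfolded inst1], of u', unfolded inst2] that(2)] that(3)] that(4)] .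
  have "\<Gamma> \<tturnstile> inst ?\<phi> z"
  proof (rule strong_ind)
    fix \<Delta> z
    assume IH: "\<And>\<Theta> u d. \<Delta> \<sqsubseteq> \<Theta> \<Longrightarrow> \<Theta> \<tturnstile> z \<doteq> suc (d \<oplus> u) \<Longrightarrow> \<Theta> \<tturnstile> inst ?\<phi> u"
    show "\<Delta> \<tturnstile> inst ?\<phi> z"
      unfolding inst1
    proof (rule allI, unfold inst2, (rule impI)+)
      fix z' \<Delta>1 \<Delta>2 \<Delta>3
      assume sub: "\<Delta> \<sqsubseteq> \<Delta>1" "\<Delta>1 \<sqsubseteq> \<Delta>2" "\<Delta>2 \<sqsubseteq> \<Delta>3"
        and z: "\<Delta>1 \<tturnstile> cmpt z \<doteq> one" and z': "\<Delta>2 \<tturnstile> cmpt z' \<doteq> one" and eq: "\<Delta>3 \<tturnstile> lft z \<doteq> lft z'"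
      show "\<Delta>3 \<tturnstile> val z \<doteq> val z'"
      proof (rule val_unique_step)
        show "\<Delta>3 \<tturnstile> cmpt z \<doteq> one" by (rule wk[OF _ z]) (use sub in blast)
        show "\<Delta>3 \<tturnstile> cmpt z' \<doteq> one" by (rule wk[OF _ z']) (use sub in blast)
        show "\<Delta>3 \<tturnstile> lft z \<doteq> lft z'" by (rule eq)
        fix \<Theta> u u'
        assume \<Theta>: "\<Delta>3 \<sqsubseteq> \<Theta>" "less \<Theta> u z" "\<Theta> \<tturnstile> cmpt u \<doteq> one" "\<Theta> \<tturnstile> cmpt u' \<doteq> one" "\<Theta> \<tturnstile> lft u \<doteq> lft u'"
        then obtain d where d: "\<Theta> \<tturnstile> z \<doteq> suc (d \<oplus> u)" by (auto simp: less_def)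
        have "\<Theta> \<tturnstile> inst ?\<phi> u" by (rule IH[OF _ d]) (use sub \<Theta>(1) in blast)
        then show "\<Theta> \<tturnstile> val u \<doteq> val u'" by (rule E[OF _ \<Theta>(3-5)])
      qed
    qed
  qed
  then show ?thesis by (rule E[OF _ assms])
qed

section \<open>Application, conditions and choice\<close>

lemma AppI:
  assumes "\<Gamma> \<tturnstile> cmpt k \<doteq> one" and "\<Gamma> \<tturnstile> lft k \<doteq> pr e n" and "\<Gamma> \<tturnstile> val k \<doteq> m"
  shows "\<Gamma> \<tturnstile> App e n m"
  unfolding App_def by (rule exI[where t = k]) (simp add: inst_def assms conjI)

lemma AppE:
  assumes "\<Gamma> \<tturnstile> App e n m"
    and "\<And>\<Delta> k. \<Gamma> \<sqsubseteq> \<Delta> \<Longrightarrow> \<Delta> \<tturnstile> cmpt k \<doteq> one \<Longrightarrow> \<Delta> \<tturnstile> lft k \<doteq> pr e n \<Longrightarrow> \<Delta> \<tturnstile> val k \<doteq> m \<Longrightarrow> \<Delta> \<tturnstile> \<chi>"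
  shows "\<Gamma> \<tturnstile> \<chi>"
proof (rule exE[OF assms(1)[unfolded App_def]])
  fix \<Delta> k assume \<Delta>: "\<Gamma> \<sqsubseteq> \<Delta>"
    "\<Delta> \<tturnstile> inst (Fn comp_pr [Var 0] \<doteq> one \<^bold>\<and> lft (Var 0) \<doteq> pr (\<up> e) (\<up> n) \<^bold>\<and> lft (rgt (Var 0)) \<doteq> \<up> m) k"
  then have "\<Delta> \<tturnstile> cmpt k \<doteq> one \<^bold>\<and> lft k \<doteq> pr e n \<^bold>\<and> val k \<doteq> m" by (simp add: inst_def)
  from conjD1[OF this] conjD1[OF conjD2[OF this]] conjD2[OF conjD2[OF this]]
  show "\<Delta> \<tturnstile> \<chi>" by (rule assms(2)[OF \<Delta>(1)])
qed

lemma App_cong: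
  assumes "\<Gamma> \<tturnstile> App e n m" and "\<Gamma> \<tturnstile> e \<doteq> e'" and "\<Gamma> \<tturnstile> n \<doteq> n'" and "\<Gamma> \<tturnstile> m \<doteq> m'"
  shows "\<Gamma> \<tturnstile> App e' n' m'"
  using assms(1)
proof (rule AppE)
  fix \<Delta> k assume \<Delta>: "\<Gamma> \<sqsubseteq> \<Delta>" "\<Delta> \<tturnstile> cmpt k \<doteq> one" "\<Delta> \<tturnstile> lft k \<doteq> pr e n" "\<Delta> \<tturnstile> val k \<doteq> m"
  show "\<Delta> \<tturnstile> App e' n' m'"
    by (rule AppI[OF \<Delta>(2)]) (use \<Delta>(3,4) assms(2-4)[THEN wk[OF \<Delta>(1)]] in \<open>simp_all add: eq_iff\<close>)
qed

lemma App_unique: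
  assumes "\<Gamma> \<tturnstile> App e n m" and "\<Gamma> \<tturnstile> App e n m'"
  shows "\<Gamma> \<tturnstile> m \<doteq> m'"
  using assms(1)
proof (rule AppE)
  fix \<Delta> k assume \<Delta>: "\<Gamma> \<sqsubseteq> \<Delta>" "\<Delta> \<tturnstile> cmpt k \<doteq> one" "\<Delta> \<tturnstile> lft k \<doteq> pr e n" "\<Delta> \<tturnstile> val k \<doteq> m"
  show "\<Delta> \<tturnstile> m \<doteq> m'"
    using wk[OF \<Delta>(1) assms(2)]
  proof (rule AppE)
    fix \<Theta> l assume \<Theta>: "\<Delta> \<sqsubseteq> \<Theta>" "\<Theta> \<tturnstile> cmpt l \<doteq> one" "\<Theta> \<tturnstile> lft l \<doteq> pr e n" "\<Theta> \<tturnstile> val l \<doteq> m'"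
    note k = \<Delta>(2-4)[THEN wk[OF \<Theta>(1)]]
    have "\<Theta> \<tturnstile> val k \<doteq> val l"
      by (rule val_unique) (use k \<Theta> in \<open>simp_all add: eq_iff\<close>)
    then show "\<Theta> \<tturnstile> m \<doteq> m'" using k(3) \<Theta>(4) by (simp add: eq_iff)
  qed
qed

lemma App_none:
  assumes "\<Gamma> \<tturnstile> App (pr (num 8) a) n m"
  shows "\<Gamma> \<tturnstile> \<chi>"
  using assms
proof (rule AppE)
  fix \<Delta> k assume \<Delta>: "\<Delta> \<tturnstile> cmpt k \<doteq> one" "\<Delta> \<tturnstile> lft k \<doteq> pr (pr (num 8) a) n"
  show "\<Delta> \<tturnstile> \<chi>"
    by (rule comp_none[OF _ \<Delta>(1), where u = zero]) (use \<Delta>(2) in \<open>simp add: eq_iff numeral_eq_Suc\<close>)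
qed

abbreviation compose :: "tm \<Rightarrow> tm \<Rightarrow> tm" where "compose a b \<equiv> pr (num 5) (pr a b)"

lemma App_compose:
  assumes "\<Gamma> \<tturnstile> App b n m" and "\<Gamma> \<tturnstile> App a m r"
  shows "\<Gamma> \<tturnstile> App (compose a b) n r"
  using assms(1)
proof (rule AppE)
  fix \<Delta> k assume \<Delta>: "\<Gamma> \<sqsubseteq> \<Delta>" "\<Delta> \<tturnstile> cmpt k \<doteq> one" "\<Delta> \<tturnstile> lft k \<doteq> pr b n" "\<Delta> \<tturnstile> val k \<doteq> m"
  show "\<Delta> \<tturnstile> App (compose a b) n r"
    using wk[OF \<Delta>(1) assms(2)]
  proof (rule AppE)
    fix \<Theta> l assume \<Theta>: "\<Delta> \<sqsubseteq> \<Theta>" "\<Theta> \<tturnstile> cmpt l \<doteq> one" "\<Theta> \<tturnstile> lft l \<doteq> pr a m" "\<Theta> \<tturnstile> val l \<doteq> r"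
    note k = \<Delta>(2-4)[THEN wk[OF \<Theta>(1)]]
    \<comment> \<open>The tree with conclusion \<open>compose a b\<close> at \<open>n\<close> equal
      to \<open>r\<close>, and the given trees \<open>k\<close> for \<open>b n\<close> and
      \<open>l\<close> for \<open>a m\<close> as subtrees.\<close>
    define z where "z = pr (pr (compose a b) n) (pr r (pr k l))"
    have "\<Theta> \<tturnstile> lft (idx z) \<doteq> num 5" by (simp add: eq_iff z_def)
    from comp_comp[OF this] have "\<Theta> \<tturnstile> cmpt z \<doteq> one"
      using k \<Theta>(2-4) by (simp add: eq_iff z_def)
    then show "\<Theta> \<tturnstile> App (compose a b) n r"
      by (rule AppI) (simp_all add: eq_iff z_def)
  qed
qed

text \<open>For arbitrary \<open>e\<close>, a value of \<open>compose h e\<close> must be traced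
  back to a value of \<open>h\<close>; otherwise nothing would show it to be a meaningful
  condition.\<close>

lemma App_composeE:
  assumes "\<Gamma> \<tturnstile> App (compose a b) n r"
    and "\<And>\<Delta> m. \<Gamma> \<sqsubseteq> \<Delta> \<Longrightarrow> \<Delta> \<tturnstile> App b n m \<Longrightarrow> \<Delta> \<tturnstile> App a m r \<Longrightarrow> \<Delta> \<tturnstile> \<chi>"
  shows "\<Gamma> \<tturnstile> \<chi>"
  using assms(1)
proof (rule AppE)
  fix \<Delta> k assume \<Delta>: "\<Gamma> \<sqsubseteq> \<Delta>" "\<Delta> \<tturnstile> cmpt k \<doteq> one" "\<Delta> \<tturnstile> lft k \<doteq> pr (compose a b) n" "\<Delta> \<tturnstile> val k \<doteq> r"
  have "\<Delta> \<tturnstile> lft (idx k) \<doteq> num 5" using \<Delta>(3) by (simp add: eq_iff)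
  note c = comp_inv3[OF \<Delta>(2) comp_comp[OF this]]
  show "\<Delta> \<tturnstile> \<chi>"
  proof (rule assms(2)[OF \<Delta>(1)])
    show "\<Delta> \<tturnstile> App b n (val (sub1 k))"
      by (rule AppI[OF c(1) _ refl]) (use c(2) \<Delta>(3) in \<open>simp add: eq_iff\<close>)
    show "\<Delta> \<tturnstile> App a (val (sub1 k)) r"
      by (rule AppI[OF c(3)]) (use c(4,5) \<Delta>(3,4) in \<open>simp_all add: eq_iff\<close>)
  qed
qed

section \<open>Partial terms and v-sets\<close>

lemma Truth_cong: "\<Gamma> \<tturnstile> Truth s \<Longrightarrow> \<Gamma> \<tturnstile> s \<doteq> t \<Longrightarrow> \<Gamma> \<tturnstile> Truth t"
  using subst_cong[of \<Gamma> s t "Truth (Var 0)"] by (simp add: inst_def)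

lemma Meaningful_cong: "\<Gamma> \<tturnstile> Meaningful s \<Longrightarrow> \<Gamma> \<tturnstile> s \<doteq> t \<Longrightarrow> \<Gamma> \<tturnstile> Meaningful t"
  using subst_cong[of \<Gamma> s t "Meaningful (Var 0)"] by (simp add: inst_def)

lemma Vset_cong: "\<Gamma> \<tturnstile> Vset s \<Longrightarrow> \<Gamma> \<tturnstile> s \<doteq> t \<Longrightarrow> \<Gamma> \<tturnstile> Vset t"
  using subst_cong[of \<Gamma> s t "Vset (Var 0)"] by (simp add: inst_def)

lemma with_appI: "\<Gamma> \<tturnstile> App e n m \<Longrightarrow> \<Gamma> \<tturnstile> inst \<phi> m \<Longrightarrow> \<Gamma> \<tturnstile> with_app e n \<phi>"
  unfolding with_app_def by (rule exI[where t = m]) (simp add: inst_def conjI)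

lemma with_appE:
  assumes "\<Gamma> \<tturnstile> with_app e n \<phi>"
    and "\<And>\<Delta> m. \<Gamma> \<sqsubseteq> \<Delta> \<Longrightarrow> \<Delta> \<tturnstile> App e n m \<Longrightarrow> \<Delta> \<tturnstile> inst \<phi> m \<Longrightarrow> \<Delta> \<tturnstile> \<chi>"
  shows "\<Gamma> \<tturnstile> \<chi>"
proof (rule exE[OF assms(1)[unfolded with_app_def]])
  fix \<Delta> m assume \<Delta>: "\<Gamma> \<sqsubseteq> \<Delta>" "\<Delta> \<tturnstile> inst (App (\<up> e) (\<up> n) (Var 0) \<^bold>\<and> \<phi>) m"
  then have "\<Delta> \<tturnstile> App e n m \<^bold>\<and> inst \<phi> m" by (simp add: inst_def)
  from conjD1[OF this] conjD2[OF this] show "\<Delta> \<tturnstile> \<chi>" by (rule assms(2)[OF \<Delta>(1)])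
qed

text \<open>Single-valuedness converts the existential reading of a partial term into the universal
  one: what holds of some value holds of the value at hand.\<close>

lemma with_appD:
  assumes "\<Gamma> \<tturnstile> with_app e n \<phi>" and "\<Gamma> \<tturnstile> App e n m"
  shows "\<Gamma> \<tturnstile> inst \<phi> m"
  using assms(1) by (rule with_appE) (rule subst_cong[OF App_unique[OF _ wk[OF _ assms(2)]]])

lemma definedE:
  assumes "\<Gamma> \<tturnstile> defined e n" and "\<And>\<Delta> m. \<Gamma> \<sqsubseteq> \<Delta> \<Longrightarrow> \<Delta> \<tturnstile> App e n m \<Longrightarrow> \<Delta> \<tturnstile> \<chi>"
  shows "\<Gamma> \<tturnstile> \<chi>"
  by (rule exE[OF assms(1)[unfolded defined_def]], rule assms(2)) (simp_all add: inst_def)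

text \<open>The matrix of \<open>closed_under\<close> after \<open>x\<close> and \<open>n\<close>
  have been instantiated; hence the parameters of \<open>\<phi>\<close> lie below one binder instead
  of three.\<close>

definition closed_body :: "fm \<Rightarrow> fm" where
  "closed_body \<phi> = (Meaningful (rgt (Var 0)) \<^bold>\<and> (Truth (rgt (Var 0)) \<^bold>\<longrightarrow> at \<phi> [lft (Var 0)] 1))"

lemma inst_closed_body: "inst (closed_body \<phi>) v = (Meaningful (rgt v) \<^bold>\<and> (Truth (rgt v) \<^bold>\<longrightarrow> inst \<phi> (lft v)))"
  unfolding closed_body_def
  by (simp add: inst_def)
    (auto simp: at_def less_Suc_eq intro!: arg_cong[where f = "\<lambda>\<sigma>. subst \<sigma> \<phi>"] split: nat.split)

lemma inst_closed_under:
  "inst (closed_under \<phi>) x = Forall (with_app (\<up> x) (Var 0)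
     (Meaningful (rgt (Var 0)) \<^bold>\<and> (Truth (rgt (Var 0)) \<^bold>\<longrightarrow> at \<phi> [lft (Var 0)] 2)))"
  by (simp add: inst_def closed_under_def) (subst subst_at[where k' = 2]; simp add: numeral_eq_Suc)

lemma inst_closed_under':
  "inst (with_app (\<up> x) (Var 0)
     (Meaningful (rgt (Var 0)) \<^bold>\<and> (Truth (rgt (Var 0)) \<^bold>\<longrightarrow> at \<phi> [lft (Var 0)] 2))) n = with_app x n (closed_body \<phi>)"
  by (simp add: inst_def closed_body_def) (subst subst_at[where k' = 1]; simp add: numeral_eq_Suc)

lemma closedI: "(\<And>n. \<Gamma> \<tturnstile> with_app x n (closed_body \<phi>)) \<Longrightarrow> \<Gamma> \<tturnstile> inst (closed_under \<phi>) x"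
  unfolding inst_closed_under by (rule allI) (simp only: inst_closed_under')

lemma closedE: "\<Gamma> \<tturnstile> inst (closed_under \<phi>) x \<Longrightarrow> \<Gamma> \<tturnstile> with_app x n (closed_body \<phi>)"
  unfolding inst_closed_under by (drule allE[of _ _ _ n]) (simp only: inst_closed_under')

lemma closed_Vset:
  assumes "\<Gamma> \<tturnstile> inst (closed_under (Vset (Var 0))) x"
  shows "\<Gamma> \<tturnstile> Vset x"
proof -
  have "\<Gamma> \<tturnstile> inst (closed_under (Vset (Var 0)) \<^bold>\<longrightarrow> Vset (Var 0)) x" by (rule allE[OF Axiom[OF V1]])
  then have "\<Gamma> \<tturnstile> inst (closed_under (Vset (Var 0))) x \<^bold>\<longrightarrow> Vset x" by (simp add: inst_def)
  from mp[OF this assms] show ?thesis .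
qed

lemma Vset_induct:
  assumes "\<Gamma> \<tturnstile> Vset x"
    and "\<And>\<Delta> x. \<Gamma> \<sqsubseteq> \<Delta> \<Longrightarrow> \<Delta> \<tturnstile> inst (closed_under \<phi>) x \<Longrightarrow> \<Delta> \<tturnstile> inst \<phi> x"
  shows "\<Gamma> \<tturnstile> inst \<phi> x"
proof -
  have "inst (closed_under \<phi> \<^bold>\<longrightarrow> \<phi>) x = (inst (closed_under \<phi>) x \<^bold>\<longrightarrow> inst \<phi> x)" for x
    by (simp add: inst_def)
  then have "\<Gamma> \<tturnstile> Forall (closed_under \<phi> \<^bold>\<longrightarrow> \<phi>)" using assms(2) by (auto intro!: allI impI)
  from allE[OF mp[OF Axiom[OF V2] this], of x] have "\<Gamma> \<tturnstile> Vset x \<^bold>\<longrightarrow> inst \<phi> x" by (simp add: inst_def)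
  from mp[OF this assms(1)] show ?thesis .
qed

text \<open>The converse of (V1), by the usual argument for least fixed points (Lambek's lemma):
  (V2) is applied to the closure condition itself, which is monotone and implies \<open>Vset\<close>
  by (V1).\<close>

lemma Vset_closed:
  assumes "\<Gamma> \<tturnstile> Vset x"
  shows "\<Gamma> \<tturnstile> inst (closed_under (Vset (Var 0))) x"
  using assms
proof (rule Vset_induct)
  fix \<Delta> x assume x: "\<Delta> \<tturnstile> inst (closed_under (closed_under (Vset (Var 0)))) x"
  show "\<Delta> \<tturnstile> inst (closed_under (Vset (Var 0))) x"
  proof (rule closedI)
    fix n
    show "\<Delta> \<tturnstile> with_app x n (closed_body (Vset (Var 0)))"
      using closedE[OF x, of n]
    proof (rule with_appE)
      fix \<Theta> v assume \<Theta>: "\<Theta> \<tturnstile> App x n v" "\<Theta> \<tturnstile> inst (closed_body (closed_under (Vset (Var 0)))) v"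
      have "\<Theta> \<tturnstile> Truth (rgt v) \<^bold>\<longrightarrow> Vset (lft v)"
        using conjD2[OF \<Theta>(2)[unfolded inst_closed_body], THEN wk[rotated], THEN mp]
        by (intro impI closed_Vset) blast
      then have "\<Theta> \<tturnstile> inst (closed_body (Vset (Var 0))) v"
        using conjD1[OF \<Theta>(2)[unfolded inst_closed_body]] conjI
        unfolding inst_closed_body by (simp add: inst_def)
      then show "\<Theta> \<tturnstile> with_app x n (closed_body (Vset (Var 0)))" by (rule with_appI[OF \<Theta>(1)])
    qed
  qed
qed

lemma Vset_app:
  assumes "\<Gamma> \<tturnstile> Vset x" and "\<And>\<Delta> v. \<Gamma> \<sqsubseteq> \<Delta> \<Longrightarrow> \<Delta> \<tturnstile> App x n v \<Longrightarrow> \<Delta> \<tturnstile> \<chi>"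
  shows "\<Gamma> \<tturnstile> \<chi>"
  using closedE[OF Vset_closed[OF assms(1)], of n] by (rule with_appE) (rule assms(2))

lemma Vset_Meaningful: "\<Gamma> \<tturnstile> Vset x \<Longrightarrow> \<Gamma> \<tturnstile> App x n v \<Longrightarrow> \<Gamma> \<tturnstile> Meaningful (rgt v)"
  using with_appD[OF closedE[OF Vset_closed]] conjD1 unfolding inst_closed_body by blast

lemma Vset_el: "\<Gamma> \<tturnstile> Vset x \<Longrightarrow> \<Gamma> \<tturnstile> App x n v \<Longrightarrow> \<Gamma> \<tturnstile> Truth (rgt v) \<Longrightarrow> \<Gamma> \<tturnstile> Vset (lft v)"
  using mp[OF conjD2[OF with_appD[OF closedE[OF Vset_closed], of \<Gamma> x n v, unfolded inst_closed_body]]]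
  by (simp add: inst_def)

lemma VsetI:
  assumes "\<And>n. \<Gamma> \<tturnstile> with_app x n (Meaningful (rgt (Var 0)) \<^bold>\<and> (Truth (rgt (Var 0)) \<^bold>\<longrightarrow> Vset (lft (Var 0))))"
  shows "\<Gamma> \<tturnstile> Vset x"
  by (rule closed_Vset, rule closedI) (use assms in \<open>simp add: closed_body_def at_def\<close>)

section \<open>Meaning and truth of coded implications\<close>

lemma Xi_Meaningful:
  assumes "\<And>\<Delta> n r. \<Gamma> \<sqsubseteq> \<Delta> \<Longrightarrow> \<Delta> \<tturnstile> App f n r \<Longrightarrow> \<Delta> \<tturnstile> Meaningful r"
    and "\<And>\<Delta> n r s. \<Gamma> \<sqsubseteq> \<Delta> \<Longrightarrow> \<Delta> \<tturnstile> App f n r \<Longrightarrow> \<Delta> \<tturnstile> App g n s \<Longrightarrow> \<Delta> \<tturnstile> Truth r \<Longrightarrow> \<Delta> \<tturnstile> Meaningful s"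
  shows "\<Gamma> \<tturnstile> Meaningful (Fn \<Xi> [f, g])"
proof (rule mp[OF Axiom[OF X2]], rule conjI)
  show "\<Gamma> \<tturnstile> Forall (defined (\<up> f) (Var 0) \<^bold>\<longrightarrow> with_app (\<up> f) (Var 0) (Meaningful (Var 0)))"
  proof (rule allI, simp add: inst_def, rule impI, erule definedE)
    fix n \<Delta> \<Theta> r assume "\<Gamma> \<sqsubseteq> \<Delta>" "\<Delta> \<sqsubseteq> \<Theta>" and r: "\<Theta> \<tturnstile> App f n r"
    then show "\<Theta> \<tturnstile> with_app f n (Meaningful (Var 0))"
      using assms(1)[of \<Theta> n r] by (intro with_appI[OF r]) (simp add: inst_def)
  qed
  show "\<Gamma> \<tturnstile> Forall (defined (\<up> f) (Var 0) \<^bold>\<and> defined (\<up> g) (Var 0) \<^bold>\<and>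
      with_app (\<up> f) (Var 0) (Truth (Var 0)) \<^bold>\<longrightarrow> with_app (\<up> g) (Var 0) (Meaningful (Var 0)))"
  proof (rule allI, simp add: inst_def, rule impI)
    fix n \<Delta> assume \<Delta>: "\<Gamma> \<sqsubseteq> \<Delta>" "\<Delta> \<tturnstile> defined f n \<^bold>\<and> defined g n \<^bold>\<and> with_app f n (Truth (Var 0))"
    show "\<Delta> \<tturnstile> with_app g n (Meaningful (Var 0))"
      using conjD1[OF conjD2[OF \<Delta>(2)]]
    proof (rule definedE)
      fix \<Theta> s assume \<Theta>: "\<Delta> \<sqsubseteq> \<Theta>" "\<Theta> \<tturnstile> App g n s"
      show "\<Theta> \<tturnstile> with_app g n (Meaningful (Var 0))"
        using wk[OF \<Theta>(1) conjD2[OF conjD2[OF \<Delta>(2)]]]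
      proof (rule with_appE)
        fix \<Lambda> r assume \<Lambda>: "\<Theta> \<sqsubseteq> \<Lambda>" "\<Lambda> \<tturnstile> App f n r" "\<Lambda> \<tturnstile> inst (Truth (Var 0)) r"
        have "\<Gamma> \<sqsubseteq> \<Lambda>" using \<Delta>(1) \<Theta>(1) \<Lambda>(1) by blast
        from assms(2)[OF this \<Lambda>(2) wk[OF \<Lambda>(1) \<Theta>(2)]] \<Lambda>(3)
        show "\<Lambda> \<tturnstile> with_app g n (Meaningful (Var 0))"
          by (intro with_appI[OF wk[OF \<Lambda>(1) \<Theta>(2)]]) (simp add: inst_def)
      qed
    qed
  qed
qed

lemma Xi_TruthD:
  assumes "\<Gamma> \<tturnstile> Meaningful (Fn \<Xi> [f, g])" and "\<Gamma> \<tturnstile> Truth (Fn \<Xi> [f, g])"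
    and "\<Gamma> \<tturnstile> App f n r" and "\<Gamma> \<tturnstile> Truth r"
  shows "\<Gamma> \<tturnstile> with_app g n (Truth (Var 0))"
proof -
  have "\<Gamma> \<tturnstile> with_app f n (Truth (Var 0)) \<^bold>\<longrightarrow> with_app g n (Truth (Var 0))"
    using allE[OF mp[OF conjD1[OF mp[OF Axiom[OF X1] assms(1)]] assms(2)], of n] by (simp add: inst_def)
  from mp[OF this with_appI[OF assms(3)]] assms(4) show ?thesis by (simp add: inst_def)
qed

lemma Xi_TruthI:
  assumes "\<Gamma> \<tturnstile> Meaningful (Fn \<Xi> [f, g])"
    and "\<And>\<Delta> n r. \<Gamma> \<sqsubseteq> \<Delta> \<Longrightarrow> \<Delta> \<tturnstile> App f n r \<Longrightarrow> \<Delta> \<tturnstile> Truth r \<Longrightarrow> \<Delta> \<tturnstile> with_app g n (Truth (Var 0))"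
  shows "\<Gamma> \<tturnstile> Truth (Fn \<Xi> [f, g])"
proof (rule mp[OF conjD2[OF mp[OF Axiom[OF X1] assms(1)]]], rule allI, simp add: inst_def, rule impI)
  fix n \<Delta> assume \<Delta>: "\<Gamma> \<sqsubseteq> \<Delta>" "\<Delta> \<tturnstile> with_app f n (Truth (Var 0))"
  show "\<Delta> \<tturnstile> with_app g n (Truth (Var 0))"
    using \<Delta>(2)
  proof (rule with_appE)
    fix \<Theta> r assume \<Theta>: "\<Delta> \<sqsubseteq> \<Theta>" "\<Theta> \<tturnstile> App f n r" "\<Theta> \<tturnstile> inst (Truth (Var 0)) r"
    have "\<Gamma> \<sqsubseteq> \<Theta>" using \<Delta>(1) \<Theta>(1) by blast
    from assms(2)[OF this \<Theta>(2)] \<Theta>(3) show "\<Theta> \<tturnstile> with_app g n (Truth (Var 0))" by (simp add: inst_def)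
  qed
qed

section \<open>Choice by extended Church's thesis\<close>

definition inst1 :: "fm \<Rightarrow> tm \<Rightarrow> fm" where
  "inst1 \<psi> n = subst (up (case_nat n Var)) \<psi>"

text \<open>In \<open>inst1 \<psi> n\<close> the argument of the choice is fixed while index 0 still
  awaits the value. The index \<open>e\<close> is handed to a continuation, which keeps the
  object-level quantifiers and the renumbering of parameters away from its uses.\<close>

lemma ect:
  assumes \<phi>: "almost_negative \<phi>"
    and ex: "\<And>\<Delta> n. \<Gamma> \<sqsubseteq> \<Delta> \<Longrightarrow> \<Delta> \<tturnstile> inst \<phi> n \<Longrightarrow> \<Delta> \<tturnstile> Exists (inst1 \<psi> n)"
    and cont: "\<And>\<Delta> e. \<Gamma> \<sqsubseteq> \<Delta> \<Longrightarrow>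
      (\<And>\<Theta> n. \<Delta> \<sqsubseteq> \<Theta> \<Longrightarrow> \<Theta> \<tturnstile> inst \<phi> n \<Longrightarrow> \<Theta> \<tturnstile> with_app e n (inst1 \<psi> n)) \<Longrightarrow> \<Delta> \<tturnstile> \<chi>"
  shows "\<Gamma> \<tturnstile> \<chi>"
proof -
  have "\<Gamma> \<tturnstile> Forall (\<phi> \<^bold>\<longrightarrow> Exists \<psi>)"
  proof (rule allI)
    show "\<Gamma> \<tturnstile> inst (\<phi> \<^bold>\<longrightarrow> Exists \<psi>) n" for n
      using ex[of _ n] by (auto simp: inst_def inst1_def intro!: impI)
  qed
  from mp[OF Axiom[OF ECT[OF \<phi>]] this] show ?thesis
  proof (rule exE)
    fix \<Delta> e
    assume \<Delta>: "\<Gamma> \<sqsubseteq> \<Delta>"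
      "\<Delta> \<tturnstile> inst (Forall (at \<phi> [Var 0] 2 \<^bold>\<longrightarrow> with_app (Var 1) (Var 0) (at \<psi> [Var 0, Var 1] 3))) e"
    show "\<Delta> \<tturnstile> \<chi>"
    proof (rule cont[OF \<Delta>(1)])
      fix \<Theta> n assume \<Theta>: "\<Delta> \<sqsubseteq> \<Theta>" "\<Theta> \<tturnstile> inst \<phi> n"
      \<comment> \<open>Instantiating \<open>e\<close> and then \<open>n\<close> removes the new
        binders one at a time, until the parameters of \<open>\<phi>\<close> and
        \<open>\<psi>\<close> are back in place.\<close>
      have 1: "subst (up (case_nat e Var)) (at \<phi> [Var 0] 2) = at \<phi> [Var 0] 1"
        by (subst subst_at[where k' = 1]) (simp_all add: numeral_eq_Suc)
      have 2: "subst (up (up (case_nat e Var))) (at \<psi> [Var 0, Var (Suc 0)] 3) = at \<psi> [Var 0, Var 1] 2"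
        by (subst subst_at[where k' = 2]) (simp_all add: numeral_eq_Suc)
      have 3: "subst (case_nat n Var) (at \<phi> [Var 0] (Suc 0)) = inst \<phi> n"
        by (auto simp: inst_def at_def less_Suc_eq intro!: arg_cong[where f = "\<lambda>\<sigma>. subst \<sigma> \<phi>"] split: nat.split)
      have 4: "subst (up (case_nat n Var)) (at \<psi> [Var 0, Var (Suc 0)] 2) = inst1 \<psi> n"
        unfolding inst1_def at_def subst_subst
      proof (rule arg_cong[where f = "\<lambda>\<sigma>. subst \<sigma> \<psi>"], rule ext)
        fix i
        consider "i = 0" | "i = 1" | j where "i = Suc (Suc j)" by (metis One_nat_def not0_implies_Suc)
        then show "subst_tm (up (case_nat n Var)) (if i < length [Var 0, Var (Suc 0)]
            then [Var 0, Var (Suc 0)] ! i else Var (i - length [Var 0, Var (Suc 0)] + 2)) = up (case_nat n Var) i"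
          by cases (simp_all add: numeral_eq_Suc)
      qed
      have "\<Delta> \<tturnstile> Forall (at \<phi> [Var 0] 1 \<^bold>\<longrightarrow> with_app (\<up> e) (Var 0) (at \<psi> [Var 0, Var 1] 2))"
        using \<Delta>(2) unfolding inst_def by (simp add: 1[simplified] 2[simplified])
      from allE[OF this, of n] have "\<Delta> \<tturnstile> inst \<phi> n \<^bold>\<longrightarrow> with_app e n (inst1 \<psi> n)"
        by (subst (asm) (1) inst_def) (simp add: 3[simplified] 4[simplified])
      from mp[OF wk[OF \<Theta>(1) this] \<Theta>(2)] show "\<Theta> \<tturnstile> with_app e n (inst1 \<psi> n)" .
    qed
  qed
qed

text \<open>A premise that always holds makes the index total. Since \<open>\<psi>\<close> may
  contain any terms as parameters, nested uses yield indices that depend on other indices.\<close>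

lemma ect_total:
  assumes "\<And>\<Delta> n. \<Gamma> \<sqsubseteq> \<Delta> \<Longrightarrow> \<Delta> \<tturnstile> Exists (inst1 \<psi> n)"
    and "\<And>\<Delta> e. \<Gamma> \<sqsubseteq> \<Delta> \<Longrightarrow> (\<And>\<Theta> n. \<Delta> \<sqsubseteq> \<Theta> \<Longrightarrow> \<Theta> \<tturnstile> with_app e n (inst1 \<psi> n)) \<Longrightarrow> \<Delta> \<tturnstile> \<chi>"
  shows "\<Gamma> \<tturnstile> \<chi>"
proof (rule ect[of "zero \<doteq> zero"])
  show "almost_negative (zero \<doteq> zero)" by (intro almost_negative.intros sigma1.intros quantifier_free.intros)
  show "\<Delta> \<tturnstile> \<chi>" if "\<Gamma> \<sqsubseteq> \<Delta>" "\<And>\<Theta> n. \<Delta> \<sqsubseteq> \<Theta> \<Longrightarrow> \<Theta> \<tturnstile> inst (zero \<doteq> zero) n \<Longrightarrow> \<Theta> \<tturnstile> with_app e n (inst1 \<psi> n)" for \<Delta> e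
    by (rule assms(2)[OF that(1)], rule that(2)) (simp_all add: inst_def refl)
qed (rule assms(1))

section \<open>Elements and set quantifiers\<close>

lemma ELI:
  assumes "\<Gamma> \<tturnstile> App x n v" and "\<Gamma> \<tturnstile> Truth (rgt v)" and "\<Gamma> \<tturnstile> a \<doteq> lft v"
  shows "\<Gamma> \<tturnstile> EL x a"
  unfolding EL_def
proof (rule exI[where t = n])
  have "\<Gamma> \<tturnstile> with_app x n (Truth (rgt (Var 0)) \<^bold>\<and> \<up> a \<doteq> lft (Var 0))"
    by (rule with_appI[OF assms(1)]) (simp add: inst_def assms(2,3) conjI)
  then show "\<Gamma> \<tturnstile> inst (with_app (\<up> x) (Var 0) (Truth (rgt (Var 0)) \<^bold>\<and> \<up> (\<up> a) \<doteq> lft (Var 0))) n"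
    by (simp add: inst_def)
qed

lemma ELE:
  assumes "\<Gamma> \<tturnstile> EL x a"
    and "\<And>\<Delta> n v. \<Gamma> \<sqsubseteq> \<Delta> \<Longrightarrow> \<Delta> \<tturnstile> App x n v \<Longrightarrow> \<Delta> \<tturnstile> Truth (rgt v) \<Longrightarrow> \<Delta> \<tturnstile> a \<doteq> lft v \<Longrightarrow> \<Delta> \<tturnstile> \<chi>"
  shows "\<Gamma> \<tturnstile> \<chi>"
proof (rule exE[OF assms(1)[unfolded EL_def]])
  fix \<Delta> n assume \<Delta>: "\<Gamma> \<sqsubseteq> \<Delta>"
    "\<Delta> \<tturnstile> inst (with_app (\<up> x) (Var 0) (Truth (rgt (Var 0)) \<^bold>\<and> \<up> (\<up> a) \<doteq> lft (Var 0))) n"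
  then have "\<Delta> \<tturnstile> with_app x n (Truth (rgt (Var 0)) \<^bold>\<and> \<up> a \<doteq> lft (Var 0))" by (simp add: inst_def)
  then show "\<Delta> \<tturnstile> \<chi>"
  proof (rule with_appE)
    fix \<Theta> v assume \<Theta>: "\<Delta> \<sqsubseteq> \<Theta>" "\<Theta> \<tturnstile> App x n v" "\<Theta> \<tturnstile> inst (Truth (rgt (Var 0)) \<^bold>\<and> \<up> a \<doteq> lft (Var 0)) v"
    have *: "\<Theta> \<tturnstile> Truth (rgt v) \<^bold>\<and> a \<doteq> lft v" using \<Theta>(3) by (simp add: inst_def)
    show "\<Theta> \<tturnstile> \<chi>"
      by (rule assms(2)[OF _ \<Theta>(2) conjD1[OF *] conjD2[OF *]]) (use \<Delta>(1) \<Theta>(1) in blast)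
  qed
qed

lemma all_inI: "(\<And>\<Delta> a. \<Gamma> \<sqsubseteq> \<Delta> \<Longrightarrow> \<Delta> \<tturnstile> EL x a \<Longrightarrow> \<Delta> \<tturnstile> inst \<phi> a) \<Longrightarrow> \<Gamma> \<tturnstile> all_in x \<phi>"
  unfolding all_in_def by (rule allI, subst inst_def) (simp add: inst_def impI)

lemma all_inD:
  assumes "\<Gamma> \<tturnstile> all_in x \<phi>" and "\<Gamma> \<tturnstile> EL x a"
  shows "\<Gamma> \<tturnstile> inst \<phi> a"
proof -
  have "\<Gamma> \<tturnstile> EL x a \<^bold>\<longrightarrow> inst \<phi> a"
    using allE[OF assms(1)[unfolded all_in_def], of a] by (simp add: inst_def)
  from mp[OF this assms(2)] show ?thesis .
qed

lemma some_inI: "\<Gamma> \<tturnstile> EL x a \<Longrightarrow> \<Gamma> \<tturnstile> inst \<phi> a \<Longrightarrow> \<Gamma> \<tturnstile> some_in x \<phi>"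
  unfolding some_in_def by (rule exI[where t = a]) (simp add: inst_def conjI)

lemma some_inE:
  assumes "\<Gamma> \<tturnstile> some_in x \<phi>"
    and "\<And>\<Delta> a. \<Gamma> \<sqsubseteq> \<Delta> \<Longrightarrow> \<Delta> \<tturnstile> EL x a \<Longrightarrow> \<Delta> \<tturnstile> inst \<phi> a \<Longrightarrow> \<Delta> \<tturnstile> \<chi>"
  shows "\<Gamma> \<tturnstile> \<chi>"
proof (rule exE[OF assms(1)[unfolded some_in_def]])
  fix \<Delta> a assume \<Delta>: "\<Gamma> \<sqsubseteq> \<Delta>" "\<Delta> \<tturnstile> inst (EL (\<up> x) (Var 0) \<^bold>\<and> \<phi>) a"
  then have "\<Delta> \<tturnstile> EL x a \<^bold>\<and> inst \<phi> a" by (simp add: inst_def)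
  from conjD1[OF this] conjD2[OF this] show "\<Delta> \<tturnstile> \<chi>" by (rule assms(2)[OF \<Delta>(1)])
qed

lemma all_setsI: "(\<And>\<Delta> x. \<Gamma> \<sqsubseteq> \<Delta> \<Longrightarrow> \<Delta> \<tturnstile> Vset x \<Longrightarrow> \<Delta> \<tturnstile> inst \<phi> x) \<Longrightarrow> \<Gamma> \<tturnstile> all_sets \<phi>"
  unfolding all_sets_def by (rule allI, subst inst_def) (simp add: inst_def impI)

lemma all_setsD:
  assumes "\<Gamma> \<tturnstile> all_sets \<phi>" and "\<Gamma> \<tturnstile> Vset x"
  shows "\<Gamma> \<tturnstile> inst \<phi> x"
proof -
  have "\<Gamma> \<tturnstile> Vset x \<^bold>\<longrightarrow> inst \<phi> x"
    using allE[OF assms(1)[unfolded all_sets_def], of x] by (simp add: inst_def)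
  from mp[OF this assms(2)] show ?thesis .
qed

lemma some_setI: "\<Gamma> \<tturnstile> Vset x \<Longrightarrow> \<Gamma> \<tturnstile> inst \<phi> x \<Longrightarrow> \<Gamma> \<tturnstile> some_set \<phi>"
  unfolding some_set_def by (rule exI[where t = x]) (simp add: inst_def conjI)

text \<open>By (V2), each element being its own witness. The induction formula carries
  \<open>Vset\<close> along because the characterization of \<open>E\<close> is available on v-sets
  only. The lemma lets literal elements of a v-set count as its members.\<close>

lemma rel2_refl:
  assumes E: "extensional_equality \<Xi> E" and "\<Gamma> \<tturnstile> Vset x"
  shows "\<Gamma> \<tturnstile> rel2 E x x"
proof -
  let ?\<phi> = "Vset (Var 0) \<^bold>\<and> rel2 E (Var 0) (Var 0)"
  have inst: "inst ?\<phi> x = (Vset x \<^bold>\<and> rel2 E x x)" for x by (simp add: inst_def)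
  have "\<Gamma> \<tturnstile> inst ?\<phi> x"
    using assms(2)
  proof (rule Vset_induct)
    fix \<Delta> x assume x: "\<Delta> \<tturnstile> inst (closed_under ?\<phi>) x"
    have V: "\<Delta> \<tturnstile> Vset x"
    proof (rule VsetI)
      fix n
      show "\<Delta> \<tturnstile> with_app x n (Meaningful (rgt (Var 0)) \<^bold>\<and> (Truth (rgt (Var 0)) \<^bold>\<longrightarrow> Vset (lft (Var 0))))"
        using closedE[OF x, of n]
      proof (rule with_appE)
        fix \<Theta> v assume \<Theta>: "\<Theta> \<tturnstile> App x n v" "\<Theta> \<tturnstile> inst (closed_body ?\<phi>) v"
        note b = \<Theta>(2)[unfolded inst_closed_body inst]
        have "\<Theta> \<tturnstile> Truth (rgt v) \<^bold>\<longrightarrow> Vset (lft v)"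
          by (rule impI) (rule conjD1[OF mp[OF wk[OF _ conjD2[OF b]]]])
        with conjD1[OF b] show "\<Theta> \<tturnstile> with_app x n (Meaningful (rgt (Var 0)) \<^bold>\<and>
            (Truth (rgt (Var 0)) \<^bold>\<longrightarrow> Vset (lft (Var 0))))"
          by (intro with_appI[OF \<Theta>(1)]) (simp add: inst_def conjI)
      qed
    qed
    have half: "\<Delta> \<tturnstile> all_in x (some_in (\<up> x) (rel2 E (Var 1) (Var 0)))"
    proof (rule all_inI)
      fix \<Theta> a assume \<Theta>: "\<Delta> \<sqsubseteq> \<Theta>" "\<Theta> \<tturnstile> EL x a"
      have "\<Theta> \<tturnstile> rel2 E a a"
        using \<Theta>(2)
      proof (rule ELE)
        fix \<Lambda> n v assume \<Lambda>: "\<Theta> \<sqsubseteq> \<Lambda>" "\<Lambda> \<tturnstile> App x n v" "\<Lambda> \<tturnstile> Truth (rgt v)" "\<Lambda> \<tturnstile> a \<doteq> lft v"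
        have "\<Delta> \<sqsubseteq> \<Lambda>" using \<Theta>(1) \<Lambda>(1) by blast
        from with_appD[OF wk[OF this closedE[OF x]] \<Lambda>(2)]
        have "\<Lambda> \<tturnstile> rel2 E (lft v) (lft v)"
          unfolding inst_closed_body inst by (rule conjD2[OF mp[OF conjD2 \<Lambda>(3)]])
        then show "\<Lambda> \<tturnstile> rel2 E a a"
          using subst_cong[OF sym[OF \<Lambda>(4)], of "rel2 E (Var 0) (Var 0)"] by (simp add: inst_def)
      qed
      with \<Theta>(2) have "\<Theta> \<tturnstile> some_in x (rel2 E (\<up> a) (Var 0))"
        by (intro some_inI) (simp_all add: inst_def)
      then show "\<Theta> \<tturnstile> inst (some_in (\<up> x) (rel2 E (Var 1) (Var 0))) a" by (simp add: inst_def)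
    qed
    have "\<Delta> \<tturnstile> rel2 E x x \<^bold>\<longleftrightarrow> (all_in x (some_in (\<up> x) (rel2 E (Var 1) (Var 0))) \<^bold>\<and>
        all_in x (some_in (\<up> x) (rel2 E (Var 1) (Var 0))))"
      using all_setsD[OF all_setsD[OF wk[OF _ E[unfolded extensional_equality_def Let_def]] V,
        unfolded inst_def, simplified] V] by (simp add: inst_def)
    from mp[OF conjD2[OF this] conjI[OF half half]] show "\<Delta> \<tturnstile> inst ?\<phi> x"
      unfolding inst by (rule conjI[OF V])
  qed
  then show ?thesis unfolding inst by (rule conjD2)
qed

section \<open>Decidable equality and a false condition\<close>

lemma eq_dec:
  assumes "\<And>\<Delta>. \<Gamma> \<sqsubseteq> \<Delta> \<Longrightarrow> \<Delta> \<tturnstile> s \<doteq> t \<Longrightarrow> \<Delta> \<tturnstile> \<chi>"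
    and "\<And>\<Delta>. \<Gamma> \<sqsubseteq> \<Delta> \<Longrightarrow> \<Delta> \<tturnstile> s \<doteq> t \<^bold>\<longrightarrow> Falsum \<Longrightarrow> \<Delta> \<tturnstile> \<chi>"
  shows "\<Gamma> \<tturnstile> \<chi>"
proof -
  \<comment> \<open>\<open>d + 1\<close> is recovered as \<open>(d + 1 + a) - a\<close>, which under
    the assumptions equals \<open>a - a\<close>, that is, zero.\<close>
  have abs: "\<Theta> \<tturnstile> Falsum" if "\<Theta> \<tturnstile> b \<doteq> suc (d \<oplus> a)" "\<Theta> \<tturnstile> a \<doteq> b" for \<Theta> a b d
  proof -
    have "S \<Theta> (nf \<Theta> d) = mns \<Theta> (pls \<Theta> (S \<Theta> (nf \<Theta> d)) (nf \<Theta> a)) (nf \<Theta> a)"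
      unfolding minus_plus by simp
    also have "pls \<Theta> (S \<Theta> (nf \<Theta> d)) (nf \<Theta> a) = nf \<Theta> a"
      using that by (simp add: eq_iff)
    finally show ?thesis by (intro zero_suc) simp
  qed
  show ?thesis
  proof (rule le_cases[of _ t s])
    fix \<Delta> d assume \<Delta>: "\<Gamma> \<sqsubseteq> \<Delta>" "nf \<Delta> t = pls \<Delta> (nf \<Delta> d) (nf \<Delta> s)"
    show "\<Delta> \<tturnstile> \<chi>"
    proof (rule nat_cases[of _ d])
      fix \<Theta> assume \<Theta>: "\<Delta> \<sqsubseteq> \<Theta>" "nf \<Theta> d = Z \<Theta>"
      have "nf \<Theta> t = nf \<Theta> (d \<oplus> s)" by (rule eq_wk[OF \<Theta>(1)]) (simp add: \<Delta>)
      then have "\<Theta> \<tturnstile> s \<doteq> t" by (simp add: \<Theta> eq_iff)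
      then show "\<Theta> \<tturnstile> \<chi>" by (rule assms(1)[rotated]) (use \<Delta> \<Theta> in blast)
    next
      fix \<Theta> v assume \<Theta>: "\<Delta> \<sqsubseteq> \<Theta>" "nf \<Theta> d = S \<Theta> (nf \<Theta> v)"
      have "nf \<Theta> t = nf \<Theta> (d \<oplus> s)" by (rule eq_wk[OF \<Theta>(1)]) (simp add: \<Delta>)
      then have "\<Theta> \<tturnstile> t \<doteq> suc (v \<oplus> s)" by (simp add: \<Theta> eq_iff)
      then have "\<Theta> \<tturnstile> s \<doteq> t \<^bold>\<longrightarrow> Falsum"
        by (intro impI) (rule abs[OF wk])
      then show "\<Theta> \<tturnstile> \<chi>" by (rule assms(2)[rotated]) (use \<Delta> \<Theta> in blast)
    qed
  next
    fix \<Theta> v assume \<Theta>: "\<Gamma> \<sqsubseteq> \<Theta>" "nf \<Theta> s = S \<Theta> (pls \<Theta> (nf \<Theta> v) (nf \<Theta> t))"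
    then have "\<Theta> \<tturnstile> s \<doteq> suc (v \<oplus> t)" by (simp add: eq_iff)
    then have "\<Theta> \<tturnstile> s \<doteq> t \<^bold>\<longrightarrow> Falsum"
      by (intro impI) (rule abs[OF wk sym])
    then show "\<Theta> \<tturnstile> \<chi>" by (rule assms(2)[OF \<Theta>(1)])
  qed
qed

text \<open>Conditions are only available through \<open>\<Xi>\<close>, so a false one has to be
  built. With \<open>u\<close> nowhere defined, \<open>\<Xi>(u,u)\<close> is vacuously meaningful
  and true. If \<open>f\<close> is constantly this condition, \<open>\<Xi>(f,u)\<close> is
  meaningful, but its truth would require \<open>u\<close> to be defined at 0.\<close>

lemma false_condition:
  assumes "\<And>\<Delta> F. \<Gamma> \<sqsubseteq> \<Delta> \<Longrightarrow> \<Delta> \<tturnstile> Meaningful F \<Longrightarrow> \<Delta> \<tturnstile> Truth F \<^bold>\<longrightarrow> Falsum \<Longrightarrow> \<Delta> \<tturnstile> \<chi>"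
  shows "\<Gamma> \<tturnstile> \<chi>"
proof -
  define u where "u = pr (num 8) zero"
  have none: "\<Delta> \<tturnstile> \<phi>" if "\<Delta> \<tturnstile> App u n m" for \<Delta> n m \<phi> using that unfolding u_def by (rule App_none)
  let ?t = "Fn \<Xi> [u, u]"
  have M: "\<Delta> \<tturnstile> Meaningful ?t" for \<Delta> by (rule Xi_Meaningful) (erule none)+
  have T: "\<Delta> \<tturnstile> Truth ?t" for \<Delta> by (rule Xi_TruthI[OF M]) (erule none)
  have inst1: "inst1 (Var 0 \<doteq> \<up> (\<up> ?t)) n = (Var 0 \<doteq> \<up> ?t)" for n by (simp add: inst1_def)
  show ?thesis
  proof (rule ect_total[of _ "Var 0 \<doteq> \<up> (\<up> ?t)"])
    show "\<Delta> \<tturnstile> Exists (inst1 (Var 0 \<doteq> \<up> (\<up> ?t)) n)" for \<Delta> n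
      unfolding inst1 by (rule exI[where t = ?t]) (simp add: inst_def refl)
    fix \<Delta> f assume \<Delta>: "\<Gamma> \<sqsubseteq> \<Delta>" "\<And>\<Theta> n. \<Delta> \<sqsubseteq> \<Theta> \<Longrightarrow> \<Theta> \<tturnstile> with_app f n (inst1 (Var 0 \<doteq> \<up> (\<up> ?t)) n)"
    have val: "\<Theta> \<tturnstile> ?t \<doteq> r" if "\<Delta> \<sqsubseteq> \<Theta>" "\<Theta> \<tturnstile> App f n r" for \<Theta> n r
      using with_appD[OF \<Delta>(2)[OF that(1), of n] that(2)] unfolding inst1 by - (rule sym, simp add: inst_def)
    have MF: "\<Delta> \<tturnstile> Meaningful (Fn \<Xi> [f, u])"
    proof (rule Xi_Meaningful)
      show "\<Theta> \<tturnstile> Meaningful r" if "\<Delta> \<sqsubseteq> \<Theta>" "\<Theta> \<tturnstile> App f n r" for \<Theta> n r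
        using M val[OF that] by (rule Meaningful_cong)
    qed (erule none)
    show "\<Delta> \<tturnstile> \<chi>"
    proof (rule assms[OF \<Delta>(1) MF], rule impI)
      fix \<Theta> assume \<Theta>: "\<Delta> \<sqsubseteq> \<Theta>" "\<Theta> \<tturnstile> Truth (Fn \<Xi> [f, u])"
      show "\<Theta> \<tturnstile> Falsum"
        using \<Delta>(2)[OF \<Theta>(1), of zero]
      proof (rule with_appE)
        fix \<Lambda> r assume \<Lambda>: "\<Theta> \<sqsubseteq> \<Lambda>" "\<Lambda> \<tturnstile> App f zero r"
        have "\<Delta> \<sqsubseteq> \<Lambda>" using \<Theta>(1) \<Lambda>(1) by blast
        from Xi_TruthD[OF wk[OF this MF] wk[OF \<Lambda>(1) \<Theta>(2)] \<Lambda>(2) Truth_cong[OF T val[OF this \<Lambda>(2)]]]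
        show "\<Lambda> \<tturnstile> Falsum" by (rule with_appE) (erule none)
      qed
    qed
  qed
qed

section \<open>The collecting set\<close>

text \<open>\<open>f\<close> is a total index of \<open>cd_x\<close>. ECT asserts only that such an
  index exists, so \<open>f\<close> is carried along by its specification.\<close>

definition cd_spec :: "tm \<Rightarrow> tm \<Rightarrow> fm" where
  "cd_spec x f = Forall (with_app (\<up> f) (Var 0) (with_app (\<up> (\<up> x)) (Var 1) (Var 1 \<doteq> rgt (Var 0))))"

lemma cd_app:
  assumes "\<Gamma> \<tturnstile> cd_spec x f" and "\<Gamma> \<tturnstile> App x n v"
  shows "\<Gamma> \<tturnstile> App f n (rgt v)"
proof -
  have "\<Gamma> \<tturnstile> with_app f n (with_app (\<up> x) (\<up> n) (Var 1 \<doteq> rgt (Var 0)))"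
    using allE[OF assms(1)[unfolded cd_spec_def], of n] by (simp add: inst_def)
  then show ?thesis
  proof (rule with_appE)
    fix \<Delta> r assume \<Delta>: "\<Gamma> \<sqsubseteq> \<Delta>" "\<Delta> \<tturnstile> App f n r"
      "\<Delta> \<tturnstile> inst (with_app (\<up> x) (\<up> n) (Var 1 \<doteq> rgt (Var 0))) r"
    then have "\<Delta> \<tturnstile> with_app x n (\<up> r \<doteq> rgt (Var 0))" by (simp add: inst_def)
    from with_appD[OF this wk[OF \<Delta>(1) assms(2)]] have "\<Delta> \<tturnstile> r \<doteq> rgt v" by (simp add: inst_def)
    then show "\<Delta> \<tturnstile> App f n (rgt v)" by (rule App_cong[OF \<Delta>(2) refl refl])
  qed
qed

lemma cd_val:
  assumes "\<Gamma> \<tturnstile> cd_spec x f" and "\<Gamma> \<tturnstile> App x n v" and "\<Gamma> \<tturnstile> App f n r"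
  shows "\<Gamma> \<tturnstile> rgt v \<doteq> r"
  by (rule App_unique[OF cd_app[OF assms(1,2)] assms(3)])

lemma cd_index:
  assumes "\<Gamma> \<tturnstile> Vset x" and "\<And>\<Delta> f. \<Gamma> \<sqsubseteq> \<Delta> \<Longrightarrow> \<Delta> \<tturnstile> cd_spec x f \<Longrightarrow> \<Delta> \<tturnstile> \<chi>"
  shows "\<Gamma> \<tturnstile> \<chi>"
proof -
  let ?\<psi> = "with_app (\<up> (\<up> x)) (Var 1) (Var 1 \<doteq> rgt (Var 0))"
  have inst1: "inst1 ?\<psi> n = with_app (\<up> x) (\<up> n) (Var 1 \<doteq> rgt (Var 0))" for n
    by (simp add: inst1_def)
  show ?thesis
  proof (rule ect_total[of _ ?\<psi>])
    fix \<Delta> n assume \<Delta>: "\<Gamma> \<sqsubseteq> \<Delta>"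
    show "\<Delta> \<tturnstile> Exists (inst1 ?\<psi> n)"
      using wk[OF \<Delta> assms(1)]
    proof (rule Vset_app)
      fix \<Theta> v assume "\<Theta> \<tturnstile> App x n v"
      then have "\<Theta> \<tturnstile> with_app x n (\<up> (rgt v) \<doteq> rgt (Var 0))"
        by (rule with_appI) (simp add: inst_def refl)
      then show "\<Theta> \<tturnstile> Exists (inst1 ?\<psi> n)"
        unfolding inst1 by (intro exI[where t = "rgt v"]) (simp add: inst_def)
    qed
  next
    fix \<Delta> f assume \<Delta>: "\<Gamma> \<sqsubseteq> \<Delta>" "\<And>\<Theta> n. \<Delta> \<sqsubseteq> \<Theta> \<Longrightarrow> \<Theta> \<tturnstile> with_app f n (inst1 ?\<psi> n)"
    have "\<Delta> \<tturnstile> cd_spec x f"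
      unfolding cd_spec_def using \<Delta>(2)[unfolded inst1] by (intro allI) (simp add: inst_def)
    then show "\<Delta> \<tturnstile> \<chi>" by (rule assms(2)[OF \<Delta>(1)])
  qed
qed

definition cond :: "tm \<Rightarrow> tm \<Rightarrow> tm \<Rightarrow> tm" where
  "cond f h e = Fn \<Xi> [f, compose h e]"

text \<open>(X2) concerns only values that exist: a value of \<open>f\<close> is some
  \<open>cd_x(n)\<close>, and a value of \<open>compose h e\<close> is a value of \<open>h\<close>,
  hence some \<open>cd_y(m)\<close>. All of these are meaningful because \<open>x\<close> and
  \<open>y\<close> are v-sets, whatever \<open>e\<close> does.\<close>

lemma cond_Meaningful:
  assumes x: "\<Gamma> \<tturnstile> Vset x" and y: "\<Gamma> \<tturnstile> Vset y" and f: "\<Gamma> \<tturnstile> cd_spec x f" and h: "\<Gamma> \<tturnstile> cd_spec y h"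
  shows "\<Gamma> \<tturnstile> Meaningful (cond f h e)"
proof -
  have cd: "\<Delta> \<tturnstile> Meaningful r"
    if "\<Delta> \<tturnstile> Vset x" "\<Delta> \<tturnstile> cd_spec x f" "\<Delta> \<tturnstile> App f n r" for \<Delta> x f n r
    using that(1)
  proof (rule Vset_app[where n = n])
    fix \<Theta> v assume \<Theta>: "\<Delta> \<sqsubseteq> \<Theta>" "\<Theta> \<tturnstile> App x n v"
    show "\<Theta> \<tturnstile> Meaningful r"
      using Vset_Meaningful[OF wk[OF \<Theta>(1) that(1)] \<Theta>(2)]
        cd_val[OF wk[OF \<Theta>(1) that(2)] \<Theta>(2) wk[OF \<Theta>(1) that(3)]]
      by (rule Meaningful_cong)
  qed
  show ?thesis
    unfolding cond_def
  proof (rule Xi_Meaningful)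
    show "\<Delta> \<tturnstile> Meaningful r" if "\<Gamma> \<sqsubseteq> \<Delta>" "\<Delta> \<tturnstile> App f n r" for \<Delta> n r
      by (rule cd[OF wk[OF that(1) x] wk[OF that(1) f] that(2)])
    show "\<Delta> \<tturnstile> Meaningful s" if \<Delta>: "\<Gamma> \<sqsubseteq> \<Delta>" "\<Delta> \<tturnstile> App (compose h e) n s" for \<Delta> n s
      using that(2)
    proof (rule App_composeE)
      fix \<Theta> m assume \<Theta>: "\<Delta> \<sqsubseteq> \<Theta>" "\<Theta> \<tturnstile> App h m s"
      have "\<Gamma> \<sqsubseteq> \<Theta>" using \<Delta>(1) \<Theta>(1) by blast
      from cd[OF wk[OF this y] wk[OF this h] \<Theta>(2)] show "\<Theta> \<tturnstile> Meaningful s" .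
    qed
  qed
qed

text \<open>The conclusion of (X1) includes that \<open>compose h e\<close> is defined, and
  inverting the composition recovers the value of \<open>e\<close>. So truth of the condition
  entails that \<open>e\<close> is total on the true indices of \<open>x\<close>.\<close>

lemma cond_TruthD:
  assumes x: "\<Gamma> \<tturnstile> Vset x" and y: "\<Gamma> \<tturnstile> Vset y" and f: "\<Gamma> \<tturnstile> cd_spec x f" and h: "\<Gamma> \<tturnstile> cd_spec y h"
    and T: "\<Gamma> \<tturnstile> Truth (cond f h e)" and v: "\<Gamma> \<tturnstile> App x n v" "\<Gamma> \<tturnstile> Truth (rgt v)"
    and cont: "\<And>\<Delta> m u. \<Gamma> \<sqsubseteq> \<Delta> \<Longrightarrow> \<Delta> \<tturnstile> App e n m \<Longrightarrow> \<Delta> \<tturnstile> App y m u \<Longrightarrow> \<Delta> \<tturnstile> Truth (rgt u) \<Longrightarrow> \<Delta> \<tturnstile> \<chi>"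
  shows "\<Gamma> \<tturnstile> \<chi>"
  using Xi_TruthD[OF cond_Meaningful[OF x y f h, unfolded cond_def] T[unfolded cond_def] cd_app[OF f v(1)] v(2)]
proof (rule with_appE)
  fix \<Delta> s assume \<Delta>: "\<Gamma> \<sqsubseteq> \<Delta>" "\<Delta> \<tturnstile> App (compose h e) n s" "\<Delta> \<tturnstile> inst (Truth (Var 0)) s"
  have s: "\<Delta> \<tturnstile> Truth s" using \<Delta>(3) by (simp add: inst_def)
  show "\<Delta> \<tturnstile> \<chi>"
    using \<Delta>(2)
  proof (rule App_composeE)
    fix \<Theta> m assume \<Theta>: "\<Delta> \<sqsubseteq> \<Theta>" "\<Theta> \<tturnstile> App e n m" "\<Theta> \<tturnstile> App h m s"
    have \<Gamma>\<Theta>: "\<Gamma> \<sqsubseteq> \<Theta>" using \<Delta>(1) \<Theta>(1) by blast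
    show "\<Theta> \<tturnstile> \<chi>"
      using wk[OF \<Gamma>\<Theta> y]
    proof (rule Vset_app[where n = m])
      fix \<Lambda> u assume \<Lambda>: "\<Theta> \<sqsubseteq> \<Lambda>" "\<Lambda> \<tturnstile> App y m u"
      have \<Gamma>\<Lambda>: "\<Gamma> \<sqsubseteq> \<Lambda>" and "\<Delta> \<sqsubseteq> \<Lambda>" using \<Gamma>\<Theta> \<Theta>(1) \<Lambda>(1) by auto
      have "\<Lambda> \<tturnstile> Truth (rgt u)"
        using wk[OF \<open>\<Delta> \<sqsubseteq> \<Lambda>\<close> s] sym[OF cd_val[OF wk[OF \<Gamma>\<Lambda> h] \<Lambda>(2) wk[OF \<Lambda>(1) \<Theta>(3)]]]
        by (rule Truth_cong)
      then show "\<Lambda> \<tturnstile> \<chi>" by (rule cont[OF \<Gamma>\<Lambda> wk[OF \<Lambda>(1) \<Theta>(2)] \<Lambda>(2)])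
    qed
  qed
qed

lemma cond_TruthI:
  assumes x: "\<Gamma> \<tturnstile> Vset x" and y: "\<Gamma> \<tturnstile> Vset y" and f: "\<Gamma> \<tturnstile> cd_spec x f" and h: "\<Gamma> \<tturnstile> cd_spec y h"
    and e: "\<And>\<Delta> n v. \<Gamma> \<sqsubseteq> \<Delta> \<Longrightarrow> \<Delta> \<tturnstile> App x n v \<Longrightarrow> \<Delta> \<tturnstile> Truth (rgt v) \<Longrightarrow>
      \<Delta> \<tturnstile> with_app e n (with_app (\<up> y) (Var 0) (Truth (rgt (Var 0))))"
  shows "\<Gamma> \<tturnstile> Truth (cond f h e)"
  unfolding cond_def
proof (rule Xi_TruthI[OF cond_Meaningful[OF x y f h, unfolded cond_def]])
  fix \<Delta> n r assume \<Delta>: "\<Gamma> \<sqsubseteq> \<Delta>" "\<Delta> \<tturnstile> App f n r" "\<Delta> \<tturnstile> Truth r"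
  show "\<Delta> \<tturnstile> with_app (compose h e) n (Truth (Var 0))"
    using wk[OF \<Delta>(1) x]
  proof (rule Vset_app[where n = n])
    fix \<Theta> v assume \<Theta>: "\<Delta> \<sqsubseteq> \<Theta>" "\<Theta> \<tturnstile> App x n v"
    have \<Gamma>\<Theta>: "\<Gamma> \<sqsubseteq> \<Theta>" using \<Delta>(1) \<Theta>(1) by blast
    have "\<Theta> \<tturnstile> Truth (rgt v)"
      using wk[OF \<Theta>(1) \<Delta>(3)] sym[OF cd_val[OF wk[OF \<Gamma>\<Theta> f] \<Theta>(2) wk[OF \<Theta>(1) \<Delta>(2)]]]
      by (rule Truth_cong)
    from e[OF \<Gamma>\<Theta> \<Theta>(2) this] show "\<Theta> \<tturnstile> with_app (compose h e) n (Truth (Var 0))"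
    proof (rule with_appE)
      fix \<Lambda> m assume \<Lambda>: "\<Theta> \<sqsubseteq> \<Lambda>" "\<Lambda> \<tturnstile> App e n m"
        "\<Lambda> \<tturnstile> inst (with_app (\<up> y) (Var 0) (Truth (rgt (Var 0)))) m"
      then have "\<Lambda> \<tturnstile> with_app y m (Truth (rgt (Var 0)))" by (simp add: inst_def)
      then show "\<Lambda> \<tturnstile> with_app (compose h e) n (Truth (Var 0))"
      proof (rule with_appE)
        fix \<Phi> u assume \<Phi>: "\<Lambda> \<sqsubseteq> \<Phi>" "\<Phi> \<tturnstile> App y m u" "\<Phi> \<tturnstile> inst (Truth (rgt (Var 0))) u"
        have \<Gamma>\<Phi>: "\<Gamma> \<sqsubseteq> \<Phi>" using \<Gamma>\<Theta> \<Lambda>(1) \<Phi>(1) by blast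
        have "\<Phi> \<tturnstile> App (compose h e) n (rgt u)"
          by (rule App_compose[OF wk[OF \<Phi>(1) \<Lambda>(2)] cd_app[OF wk[OF \<Gamma>\<Phi> h] \<Phi>(2)]])
        then show "\<Phi> \<tturnstile> with_app (compose h e) n (Truth (Var 0))"
          by (rule with_appI) (use \<Phi>(3) in \<open>simp add: inst_def\<close>)
      qed
    qed
  qed
qed

text \<open>\<open>j = \<langle>n,k\<rangle>\<close>, where \<open>k\<close> is a computation tree with conclusion \<open>e n = _\<close>.\<close>

definition is_tree :: "tm \<Rightarrow> tm \<Rightarrow> fm" where
  "is_tree e j = (cmpt (rgt j) \<doteq> one \<^bold>\<and> lft (rgt j) \<doteq> pr e (lft j))"

text \<open>\<open>r\<close> pairs an element with its condition. Attaching \<open>cd_x(n)\<close>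
  is enough, as \<open>cond f h e\<close> makes \<open>cd_y(e n)\<close> follow from it. In the
  second disjunct the element is left open, because the false condition keeps it out of the
  set.\<close>

definition w_rel :: "tm \<Rightarrow> tm \<Rightarrow> tm \<Rightarrow> tm \<Rightarrow> tm \<Rightarrow> tm \<Rightarrow> fm" where
  "w_rel x y F e j r =
    (is_tree e j \<^bold>\<and> with_app y (val (rgt j)) (lft (\<up> r) \<doteq> lft (Var 0))
        \<^bold>\<and> with_app x (lft j) (rgt (\<up> r) \<doteq> rgt (Var 0))
     \<^bold>\<or> (is_tree e j \<^bold>\<longrightarrow> Falsum) \<^bold>\<and> rgt r \<doteq> F)"

definition w_spec :: "tm \<Rightarrow> tm \<Rightarrow> tm \<Rightarrow> tm \<Rightarrow> tm \<Rightarrow> fm" where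
  "w_spec x y F e w = Forall (with_app (\<up> w) (Var 0)
     (w_rel (\<up> (\<up> x)) (\<up> (\<up> y)) (\<up> (\<up> F)) (\<up> (\<up> e)) (Var 1) (Var 0)))"

lemma subst_w_rel [simp]:
  "subst \<sigma> (w_rel x y F e j r) = w_rel (subst_tm \<sigma> x) (subst_tm \<sigma> y) (subst_tm \<sigma> F)
     (subst_tm \<sigma> e) (subst_tm \<sigma> j) (subst_tm \<sigma> r)"
  by (simp add: w_rel_def is_tree_def)

lemma subst_w_spec [simp]:
  "subst \<sigma> (w_spec x y F e w) = w_spec (subst_tm \<sigma> x) (subst_tm \<sigma> y) (subst_tm \<sigma> F)
     (subst_tm \<sigma> e) (subst_tm \<sigma> w)"
  by (simp add: w_spec_def)

text \<open>The case distinction behind the enumeration must be justified constructively. Being a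
  tree for \<open>e n\<close> consists of two equations between numbers, which are decidable;
  definedness of \<open>e n\<close> would offer no such distinction.\<close>

lemma is_tree_dec:
  assumes "\<And>\<Delta>. \<Gamma> \<sqsubseteq> \<Delta> \<Longrightarrow> \<Delta> \<tturnstile> is_tree e j \<Longrightarrow> \<Delta> \<tturnstile> \<chi>"
    and "\<And>\<Delta>. \<Gamma> \<sqsubseteq> \<Delta> \<Longrightarrow> \<Delta> \<tturnstile> is_tree e j \<^bold>\<longrightarrow> Falsum \<Longrightarrow> \<Delta> \<tturnstile> \<chi>"
  shows "\<Gamma> \<tturnstile> \<chi>"
proof (rule eq_dec[of _ "cmpt (rgt j)" one])
  fix \<Delta> assume \<Delta>: "\<Gamma> \<sqsubseteq> \<Delta>" "\<Delta> \<tturnstile> cmpt (rgt j) \<doteq> one"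
  show "\<Delta> \<tturnstile> \<chi>"
  proof (rule eq_dec[of _ "lft (rgt j)" "pr e (lft j)"])
    fix \<Theta> assume \<Theta>: "\<Delta> \<sqsubseteq> \<Theta>" "\<Theta> \<tturnstile> lft (rgt j) \<doteq> pr e (lft j)"
    show "\<Theta> \<tturnstile> \<chi>"
      by (rule assms(1)) (use \<Delta>(1) \<Theta>(1) conjI[OF wk[OF \<Theta>(1) \<Delta>(2)] \<Theta>(2)] in \<open>auto simp: is_tree_def\<close>)
  next
    fix \<Theta> assume \<Theta>: "\<Delta> \<sqsubseteq> \<Theta>" "\<Theta> \<tturnstile> lft (rgt j) \<doteq> pr e (lft j) \<^bold>\<longrightarrow> Falsum"
    have "\<Theta> \<tturnstile> is_tree e j \<^bold>\<longrightarrow> Falsum"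
      unfolding is_tree_def by (rule impI) (rule mp[OF wk[OF _ \<Theta>(2)] conjD2])
    then show "\<Theta> \<tturnstile> \<chi>" by (rule assms(2)[rotated]) (use \<Delta>(1) \<Theta>(1) in blast)
  qed
next
  fix \<Delta> assume \<Delta>: "\<Gamma> \<sqsubseteq> \<Delta>" "\<Delta> \<tturnstile> cmpt (rgt j) \<doteq> one \<^bold>\<longrightarrow> Falsum"
  have "\<Delta> \<tturnstile> is_tree e j \<^bold>\<longrightarrow> Falsum"
    unfolding is_tree_def by (rule impI) (rule mp[OF wk[OF _ \<Delta>(2)] conjD1])
  then show "\<Delta> \<tturnstile> \<chi>" by (rule assms(2)[OF \<Delta>(1)])
qed

lemma w_index:
  assumes x: "\<Gamma> \<tturnstile> Vset x" and y: "\<Gamma> \<tturnstile> Vset y"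
    and cont: "\<And>\<Delta> w. \<Gamma> \<sqsubseteq> \<Delta> \<Longrightarrow> \<Delta> \<tturnstile> w_spec x y F e w \<Longrightarrow> \<Delta> \<tturnstile> \<chi>"
  shows "\<Gamma> \<tturnstile> \<chi>"
proof -
  let ?\<psi> = "w_rel (\<up> (\<up> x)) (\<up> (\<up> y)) (\<up> (\<up> F)) (\<up> (\<up> e)) (Var 1) (Var 0)"
  have inst1: "inst1 ?\<psi> j = w_rel (\<up> x) (\<up> y) (\<up> F) (\<up> e) (\<up> j) (Var 0)" for j
    by (simp add: inst1_def)
  have I: "\<Delta> \<tturnstile> Exists (inst1 ?\<psi> j)" if "\<Delta> \<tturnstile> w_rel x y F e j r" for \<Delta> j r
    unfolding inst1 by (rule exI[where t = r]) (use that in \<open>simp add: inst_def\<close>)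
  show ?thesis
  proof (rule ect_total[of _ ?\<psi>])
    fix \<Delta> j assume \<Delta>: "\<Gamma> \<sqsubseteq> \<Delta>"
    show "\<Delta> \<tturnstile> Exists (inst1 ?\<psi> j)"
    proof (rule is_tree_dec[of _ e j])
      fix \<Theta> assume \<Theta>: "\<Delta> \<sqsubseteq> \<Theta>" "\<Theta> \<tturnstile> is_tree e j"
      have \<Gamma>\<Theta>: "\<Gamma> \<sqsubseteq> \<Theta>" using \<Delta> \<Theta>(1) by blast
      show "\<Theta> \<tturnstile> Exists (inst1 ?\<psi> j)"
        using wk[OF \<Gamma>\<Theta> y]
      proof (rule Vset_app[where n = "val (rgt j)"])
        fix \<Lambda> u assume \<Lambda>: "\<Theta> \<sqsubseteq> \<Lambda>" "\<Lambda> \<tturnstile> App y (val (rgt j)) u"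
        have \<Gamma>\<Lambda>: "\<Gamma> \<sqsubseteq> \<Lambda>" using \<Gamma>\<Theta> \<Lambda>(1) by blast
        show "\<Lambda> \<tturnstile> Exists (inst1 ?\<psi> j)"
          using wk[OF \<Gamma>\<Lambda> x]
        proof (rule Vset_app[where n = "lft j"])
          fix \<Phi> v assume \<Phi>: "\<Lambda> \<sqsubseteq> \<Phi>" "\<Phi> \<tturnstile> App x (lft j) v"
          have \<Theta>\<Phi>: "\<Theta> \<sqsubseteq> \<Phi>" using \<Lambda>(1) \<Phi>(1) by blast
          \<comment> \<open>The entry is \<open>el_y(m)\<close> with condition
            \<open>cd_x(n)\<close>, where \<open>m\<close> is read off from the tree; both exist
            because the v-sets \<open>y\<close> and \<open>x\<close> are total indices.\<close>
          have "\<Phi> \<tturnstile> with_app y (val (rgt j)) (lft (\<up> (pr (lft u) (rgt v))) \<doteq> lft (Var 0))"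
            by (rule with_appI[OF wk[OF \<Phi>(1) \<Lambda>(2)]]) (simp add: inst_def eq_iff)
          moreover have "\<Phi> \<tturnstile> with_app x (lft j) (rgt (\<up> (pr (lft u) (rgt v))) \<doteq> rgt (Var 0))"
            by (rule with_appI[OF \<Phi>(2)]) (simp add: inst_def eq_iff)
          ultimately show "\<Phi> \<tturnstile> Exists (inst1 ?\<psi> j)"
            by (intro I[of _ _ "pr (lft u) (rgt v)"])
              (unfold w_rel_def, intro DisjI1 conjI wk[OF \<Theta>\<Phi> \<Theta>(2)])
        qed
      qed
    next
      fix \<Theta> assume \<Theta>: "\<Delta> \<sqsubseteq> \<Theta>" "\<Theta> \<tturnstile> is_tree e j \<^bold>\<longrightarrow> Falsum"
      show "\<Theta> \<tturnstile> Exists (inst1 ?\<psi> j)"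
        \<comment> \<open>The element \<open>zero\<close> is an arbitrary default under the false
          condition.\<close>
        by (rule I[of _ _ "pr zero F"], unfold w_rel_def, rule DisjI2, rule conjI[OF \<Theta>(2)])
          (simp add: eq_iff)
    qed
  next
    fix \<Delta> w assume \<Delta>: "\<Gamma> \<sqsubseteq> \<Delta>" "\<And>\<Theta> n. \<Delta> \<sqsubseteq> \<Theta> \<Longrightarrow> \<Theta> \<tturnstile> with_app w n (inst1 ?\<psi> n)"
    have "\<Delta> \<tturnstile> w_spec x y F e w"
      unfolding w_spec_def using \<Delta>(2)[unfolded inst1] by (intro allI) (simp add: inst_def)
    then show "\<Delta> \<tturnstile> \<chi>" by (rule cont[OF \<Delta>(1)])
  qed
qed

lemma w_specD:
  assumes "\<Gamma> \<tturnstile> w_spec x y F e w"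
  shows "\<Gamma> \<tturnstile> with_app w j (w_rel (\<up> x) (\<up> y) (\<up> F) (\<up> e) (\<up> j) (Var 0))"
  using allE[OF assms[unfolded w_spec_def], of j] by (simp add: inst_def)

lemma w_relE:
  assumes rel: "\<Gamma> \<tturnstile> w_rel x y F e j r"
    and tree: "\<And>\<Delta> m u v. \<Gamma> \<sqsubseteq> \<Delta> \<Longrightarrow> \<Delta> \<tturnstile> App e (lft j) m \<Longrightarrow> \<Delta> \<tturnstile> App y m u \<Longrightarrow> \<Delta> \<tturnstile> App x (lft j) v \<Longrightarrow>
      \<Delta> \<tturnstile> lft u \<doteq> lft r \<Longrightarrow> \<Delta> \<tturnstile> rgt v \<doteq> rgt r \<Longrightarrow> \<Delta> \<tturnstile> \<chi>"
    and no_tree: "\<And>\<Delta>. \<Gamma> \<sqsubseteq> \<Delta> \<Longrightarrow> \<Delta> \<tturnstile> F \<doteq> rgt r \<Longrightarrow> \<Delta> \<tturnstile> \<chi>"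
  shows "\<Gamma> \<tturnstile> \<chi>"
  using rel[unfolded w_rel_def]
proof (rule disjE)
  fix \<Delta> assume \<Delta>: "\<Gamma> \<sqsubseteq> \<Delta>" "\<Delta> \<tturnstile> is_tree e j \<^bold>\<and> with_app y (val (rgt j)) (lft (\<up> r) \<doteq> lft (Var 0))
        \<^bold>\<and> with_app x (lft j) (rgt (\<up> r) \<doteq> rgt (Var 0))"
  have A: "\<Delta> \<tturnstile> App e (lft j) (val (rgt j))"
    using conjD1[OF \<Delta>(2)] unfolding is_tree_def by - (rule AppI[OF conjD1 _ refl], assumption, rule conjD2)
  show "\<Delta> \<tturnstile> \<chi>"
    using conjD1[OF conjD2[OF \<Delta>(2)]]
  proof (rule with_appE)
    fix \<Theta> u assume \<Theta>: "\<Delta> \<sqsubseteq> \<Theta>" "\<Theta> \<tturnstile> App y (val (rgt j)) u" "\<Theta> \<tturnstile> inst (lft (\<up> r) \<doteq> lft (Var 0)) u"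
    show "\<Theta> \<tturnstile> \<chi>"
      using wk[OF \<Theta>(1) conjD2[OF conjD2[OF \<Delta>(2)]]]
    proof (rule with_appE)
      fix \<Lambda> v assume \<Lambda>: "\<Theta> \<sqsubseteq> \<Lambda>" "\<Lambda> \<tturnstile> App x (lft j) v" "\<Lambda> \<tturnstile> inst (rgt (\<up> r) \<doteq> rgt (Var 0)) v"
      have *: "\<Gamma> \<sqsubseteq> \<Lambda>" "\<Delta> \<sqsubseteq> \<Lambda>" using \<Delta>(1) \<Theta>(1) \<Lambda>(1) by auto
      show "\<Lambda> \<tturnstile> \<chi>"
        by (rule tree[OF *(1) wk[OF *(2) A] wk[OF \<Lambda>(1) \<Theta>(2)] \<Lambda>(2)])
          (use wk[OF \<Lambda>(1) \<Theta>(3)] \<Lambda>(3) in \<open>simp_all add: inst_def eq_iff\<close>)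
    qed
  qed
next
  fix \<Delta> assume \<Delta>: "\<Gamma> \<sqsubseteq> \<Delta>" "\<Delta> \<tturnstile> (is_tree e j \<^bold>\<longrightarrow> Falsum) \<^bold>\<and> rgt r \<doteq> F"
  show "\<Delta> \<tturnstile> \<chi>" by (rule no_tree[OF \<Delta>(1) sym[OF conjD2[OF \<Delta>(2)]]])
qed

text \<open>Truth of the condition is used for the elements alone: if \<open>cd_x(n)\<close> is
  true, then so is \<open>cd_y(e n)\<close>, and only then is \<open>el_y(e n)\<close> known to be a
  v-set. The conditions of the entries are meaningful for any \<open>e\<close>.\<close>

lemma w_Vset:
  assumes x: "\<Gamma> \<tturnstile> Vset x" and y: "\<Gamma> \<tturnstile> Vset y" and f: "\<Gamma> \<tturnstile> cd_spec x f" and h: "\<Gamma> \<tturnstile> cd_spec y h"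
    and F: "\<Gamma> \<tturnstile> Meaningful F" "\<Gamma> \<tturnstile> Truth F \<^bold>\<longrightarrow> Falsum"
    and w: "\<Gamma> \<tturnstile> w_spec x y F e w" and T: "\<Gamma> \<tturnstile> Truth (cond f h e)"
  shows "\<Gamma> \<tturnstile> Vset w"
proof (rule VsetI)
  fix j
  let ?\<phi> = "Meaningful (rgt (Var 0)) \<^bold>\<and> (Truth (rgt (Var 0)) \<^bold>\<longrightarrow> Vset (lft (Var 0)))"
  show "\<Gamma> \<tturnstile> with_app w j ?\<phi>"
    using w_specD[OF w, of j]
  proof (rule with_appE)
    fix \<Delta> r assume \<Delta>: "\<Gamma> \<sqsubseteq> \<Delta>" "\<Delta> \<tturnstile> App w j r" "\<Delta> \<tturnstile> inst (w_rel (\<up> x) (\<up> y) (\<up> F) (\<up> e) (\<up> j) (Var 0)) r"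
    have r: "\<Delta> \<tturnstile> w_rel x y F e j r" using \<Delta>(3) by (simp add: inst_def)
    have "\<Delta> \<tturnstile> Meaningful (rgt r) \<^bold>\<and> (Truth (rgt r) \<^bold>\<longrightarrow> Vset (lft r))"
    proof (rule w_relE[OF r])
      fix \<Theta> m u v
      assume \<Theta>: "\<Delta> \<sqsubseteq> \<Theta>" "\<Theta> \<tturnstile> App e (lft j) m" "\<Theta> \<tturnstile> App y m u" "\<Theta> \<tturnstile> App x (lft j) v"
        "\<Theta> \<tturnstile> lft u \<doteq> lft r" "\<Theta> \<tturnstile> rgt v \<doteq> rgt r"
      have \<Gamma>\<Theta>: "\<Gamma> \<sqsubseteq> \<Theta>" using \<Delta>(1) \<Theta>(1) by blast
      show "\<Theta> \<tturnstile> Meaningful (rgt r) \<^bold>\<and> (Truth (rgt r) \<^bold>\<longrightarrow> Vset (lft r))"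
      proof (rule conjI, rule Meaningful_cong[OF Vset_Meaningful[OF wk[OF \<Gamma>\<Theta> x] \<Theta>(4)] \<Theta>(6)], rule impI)
        fix \<Lambda> assume \<Lambda>: "\<Theta> \<sqsubseteq> \<Lambda>" "\<Lambda> \<tturnstile> Truth (rgt r)"
        have \<Gamma>\<Lambda>: "\<Gamma> \<sqsubseteq> \<Lambda>" using \<Gamma>\<Theta> \<Lambda>(1) by blast
        note \<Theta>\<Lambda> = \<Theta>(2-6)[THEN wk[OF \<Lambda>(1)]]
        have tv: "\<Lambda> \<tturnstile> Truth (rgt v)" using \<Lambda>(2) sym[OF \<Theta>\<Lambda>(5)] by (rule Truth_cong)
        show "\<Lambda> \<tturnstile> Vset (lft r)"
        proof (rule cond_TruthD[OF x[THEN wk[OF \<Gamma>\<Lambda>]] y[THEN wk[OF \<Gamma>\<Lambda>]] f[THEN wk[OF \<Gamma>\<Lambda>]]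
              h[THEN wk[OF \<Gamma>\<Lambda>]] T[THEN wk[OF \<Gamma>\<Lambda>]] \<Theta>\<Lambda>(3) tv])
          fix \<Phi> m' u'
          assume \<Phi>: "\<Lambda> \<sqsubseteq> \<Phi>" "\<Phi> \<tturnstile> App e (lft j) m'" "\<Phi> \<tturnstile> App y m' u'" "\<Phi> \<tturnstile> Truth (rgt u')"
          note \<Theta>\<Phi> = \<Theta>\<Lambda>[THEN wk[OF \<Phi>(1)]]
          have \<Gamma>\<Phi>: "\<Gamma> \<sqsubseteq> \<Phi>" using \<Gamma>\<Lambda> \<Phi>(1) by blast
          \<comment> \<open>The value \<open>m\<close> read off from the tree and the value
            \<open>m'\<close> supplied by the condition agree.\<close>
          have "\<Phi> \<tturnstile> App y m u'"
            by (rule App_cong[OF \<Phi>(3) refl App_unique[OF \<Phi>(2) \<Theta>\<Phi>(1)] refl])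
          from App_unique[OF this \<Theta>\<Phi>(2)] have "\<Phi> \<tturnstile> lft u' \<doteq> lft r"
            using \<Theta>\<Phi>(4) by (simp add: eq_iff)
          with Vset_el[OF wk[OF \<Gamma>\<Phi> y] \<Phi>(3,4)] show "\<Phi> \<tturnstile> Vset (lft r)" by (rule Vset_cong)
        qed
      qed
    next
      fix \<Theta> assume \<Theta>: "\<Delta> \<sqsubseteq> \<Theta>" "\<Theta> \<tturnstile> F \<doteq> rgt r"
      have \<Gamma>\<Theta>: "\<Gamma> \<sqsubseteq> \<Theta>" using \<Delta>(1) \<Theta>(1) by blast
      show "\<Theta> \<tturnstile> Meaningful (rgt r) \<^bold>\<and> (Truth (rgt r) \<^bold>\<longrightarrow> Vset (lft r))"
      proof (rule conjI, rule Meaningful_cong[OF wk[OF \<Gamma>\<Theta> F(1)] \<Theta>(2)], rule impI, rule FalsumE)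
        fix \<Lambda> assume \<Lambda>: "\<Theta> \<sqsubseteq> \<Lambda>" "\<Lambda> \<tturnstile> Truth (rgt r)"
        have "\<Gamma> \<sqsubseteq> \<Lambda>" using \<Gamma>\<Theta> \<Lambda>(1) by blast
        from mp[OF wk[OF this F(2)] Truth_cong[OF \<Lambda>(2) sym[OF wk[OF \<Lambda>(1) \<Theta>(2)]]]]
        show "\<Lambda> \<tturnstile> Falsum" .
      qed
    qed
    then show "\<Delta> \<tturnstile> with_app w j ?\<phi>" by (intro with_appI[OF \<Delta>(2)]) (simp add: inst_def)
  qed
qed

section \<open>The set of all images\<close>

lemma subst_tm_cond [simp]:
  "subst_tm \<sigma> (cond f h e) = cond (subst_tm \<sigma> f) (subst_tm \<sigma> h) (subst_tm \<sigma> e)"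
  by (simp add: cond_def numeral_eq_Suc)

definition z_rel :: "tm \<Rightarrow> tm \<Rightarrow> tm \<Rightarrow> tm \<Rightarrow> tm \<Rightarrow> tm \<Rightarrow> tm \<Rightarrow> fm" where
  "z_rel x y F f h e t = (w_spec x y F e (lft t) \<^bold>\<and> rgt t \<doteq> cond f h e)"

definition z_spec :: "tm \<Rightarrow> tm \<Rightarrow> tm \<Rightarrow> tm \<Rightarrow> tm \<Rightarrow> tm \<Rightarrow> fm" where
  "z_spec x y F f h z = Forall (with_app (\<up> z) (Var 0)
     (z_rel (\<up> (\<up> x)) (\<up> (\<up> y)) (\<up> (\<up> F)) (\<up> (\<up> f)) (\<up> (\<up> h)) (Var 1) (Var 0)))"

lemma subst_z_rel [simp]:
  "subst \<sigma> (z_rel x y F f h e t) = z_rel (subst_tm \<sigma> x) (subst_tm \<sigma> y) (subst_tm \<sigma> F)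
     (subst_tm \<sigma> f) (subst_tm \<sigma> h) (subst_tm \<sigma> e) (subst_tm \<sigma> t)"
  by (simp add: z_rel_def)

text \<open>Stands in for s-m-n: an index of the image is not computed from \<open>e\<close> but
  chosen by ECT, since each \<open>e\<close> has one. Any choice will do, because all later facts
  about the index follow from \<open>w_spec\<close>.\<close>

lemma z_index:
  assumes x: "\<Gamma> \<tturnstile> Vset x" and y: "\<Gamma> \<tturnstile> Vset y"
    and cont: "\<And>\<Delta> z. \<Gamma> \<sqsubseteq> \<Delta> \<Longrightarrow> \<Delta> \<tturnstile> z_spec x y F f h z \<Longrightarrow> \<Delta> \<tturnstile> \<chi>"
  shows "\<Gamma> \<tturnstile> \<chi>"
proof -
  let ?\<psi> = "z_rel (\<up> (\<up> x)) (\<up> (\<up> y)) (\<up> (\<up> F)) (\<up> (\<up> f)) (\<up> (\<up> h)) (Var 1) (Var 0)"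
  have inst1: "inst1 ?\<psi> e = z_rel (\<up> x) (\<up> y) (\<up> F) (\<up> f) (\<up> h) (\<up> e) (Var 0)" for e
    by (simp add: inst1_def)
  show ?thesis
  proof (rule ect_total[of _ ?\<psi>])
    fix \<Delta> e assume \<Delta>: "\<Gamma> \<sqsubseteq> \<Delta>"
    show "\<Delta> \<tturnstile> Exists (inst1 ?\<psi> e)"
    proof (rule w_index[OF wk[OF \<Delta> x] wk[OF \<Delta> y]])
      fix \<Theta> w assume w: "\<Theta> \<tturnstile> w_spec x y F e w"
      let ?t = "pr w (cond f h e)"
      have "\<Theta> \<tturnstile> w \<doteq> lft ?t" by (simp add: eq_iff)
      from subst_cong[OF this, of "w_spec (\<up> x) (\<up> y) (\<up> F) (\<up> e) (Var 0)"] w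
      have "\<Theta> \<tturnstile> w_spec x y F e (lft ?t)" by (simp add: inst_def)
      then have "\<Theta> \<tturnstile> z_rel x y F f h e ?t"
        unfolding z_rel_def by (rule conjI) (simp add: eq_iff)
      then show "\<Theta> \<tturnstile> Exists (inst1 ?\<psi> e)"
        unfolding inst1 by (intro exI[where t = ?t]) (simp add: inst_def)
    qed
  next
    fix \<Delta> z assume \<Delta>: "\<Gamma> \<sqsubseteq> \<Delta>" "\<And>\<Theta> n. \<Delta> \<sqsubseteq> \<Theta> \<Longrightarrow> \<Theta> \<tturnstile> with_app z n (inst1 ?\<psi> n)"
    have "\<Delta> \<tturnstile> z_spec x y F f h z"
      unfolding z_spec_def using \<Delta>(2)[unfolded inst1] by (intro allI) (simp add: inst_def)
    then show "\<Delta> \<tturnstile> \<chi>" by (rule cont[OF \<Delta>(1)])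
  qed
qed

lemma z_specE:
  assumes "\<Gamma> \<tturnstile> z_spec x y F f h z"
    and "\<And>\<Delta> t. \<Gamma> \<sqsubseteq> \<Delta> \<Longrightarrow> \<Delta> \<tturnstile> App z e t \<Longrightarrow> \<Delta> \<tturnstile> w_spec x y F e (lft t) \<Longrightarrow> \<Delta> \<tturnstile> cond f h e \<doteq> rgt t \<Longrightarrow> \<Delta> \<tturnstile> \<chi>"
  shows "\<Gamma> \<tturnstile> \<chi>"
proof -
  have "\<Gamma> \<tturnstile> with_app z e (z_rel (\<up> x) (\<up> y) (\<up> F) (\<up> f) (\<up> h) (\<up> e) (Var 0))"
    using allE[OF assms(1)[unfolded z_spec_def], of e] by (simp add: inst_def)
  then show ?thesis
  proof (rule with_appE)
    fix \<Delta> t assume \<Delta>: "\<Gamma> \<sqsubseteq> \<Delta>" "\<Delta> \<tturnstile> App z e t"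
      "\<Delta> \<tturnstile> inst (z_rel (\<up> x) (\<up> y) (\<up> F) (\<up> f) (\<up> h) (\<up> e) (Var 0)) t"
    have "\<Delta> \<tturnstile> w_spec x y F e (lft t) \<^bold>\<and> rgt t \<doteq> cond f h e"
      using \<Delta>(3) by (simp add: inst_def z_rel_def)
    from assms(2)[OF \<Delta>(1,2) conjD1[OF this] sym[OF conjD2[OF this]]] show "\<Delta> \<tturnstile> \<chi>" .
  qed
qed

text \<open>(V1) lets an element be checked under the assumption that its condition is true, and for
  entry \<open>e\<close> this is exactly what \<open>w_Vset\<close> assumes.\<close>

lemma z_Vset:
  assumes x: "\<Gamma> \<tturnstile> Vset x" and y: "\<Gamma> \<tturnstile> Vset y" and f: "\<Gamma> \<tturnstile> cd_spec x f" and h: "\<Gamma> \<tturnstile> cd_spec y h"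
    and F: "\<Gamma> \<tturnstile> Meaningful F" "\<Gamma> \<tturnstile> Truth F \<^bold>\<longrightarrow> Falsum" and z: "\<Gamma> \<tturnstile> z_spec x y F f h z"
  shows "\<Gamma> \<tturnstile> Vset z"
proof (rule VsetI)
  fix e
  let ?\<phi> = "Meaningful (rgt (Var 0)) \<^bold>\<and> (Truth (rgt (Var 0)) \<^bold>\<longrightarrow> Vset (lft (Var 0)))"
  show "\<Gamma> \<tturnstile> with_app z e ?\<phi>"
    using z
  proof (rule z_specE[where e = e])
    fix \<Delta> t assume \<Delta>: "\<Gamma> \<sqsubseteq> \<Delta>" "\<Delta> \<tturnstile> App z e t" "\<Delta> \<tturnstile> w_spec x y F e (lft t)" "\<Delta> \<tturnstile> cond f h e \<doteq> rgt t"
    note wk\<Delta> = wk[OF \<Delta>(1)]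
    have "\<Delta> \<tturnstile> Meaningful (rgt t)"
      by (rule Meaningful_cong[OF cond_Meaningful[OF x[THEN wk\<Delta>] y[THEN wk\<Delta>] f[THEN wk\<Delta>] h[THEN wk\<Delta>]] \<Delta>(4)])
    moreover have "\<Delta> \<tturnstile> Truth (rgt t) \<^bold>\<longrightarrow> Vset (lft t)"
    proof (rule impI)
      fix \<Theta> assume \<Theta>: "\<Delta> \<sqsubseteq> \<Theta>" "\<Theta> \<tturnstile> Truth (rgt t)"
      have \<Gamma>\<Theta>: "\<Gamma> \<sqsubseteq> \<Theta>" using \<Delta>(1) \<Theta>(1) by blast
      note wk\<Theta> = wk[OF \<Gamma>\<Theta>]
      show "\<Theta> \<tturnstile> Vset (lft t)"
        by (rule w_Vset[OF x[THEN wk\<Theta>] y[THEN wk\<Theta>] f[THEN wk\<Theta>] h[THEN wk\<Theta>] F[THEN wk\<Theta>]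
              wk[OF \<Theta>(1) \<Delta>(3)] Truth_cong[OF \<Theta>(2) sym[OF wk[OF \<Theta>(1) \<Delta>(4)]]]])
    qed
    ultimately show "\<Delta> \<tturnstile> with_app z e ?\<phi>"
      by (intro with_appI[OF \<Delta>(2)]) (simp add: inst_def conjI)
  qed
qed

lemma w_member:
  assumes w: "\<Gamma> \<tturnstile> w_spec x y F e w"
    and m: "\<Gamma> \<tturnstile> App e n m" and u: "\<Gamma> \<tturnstile> App y m u" and v: "\<Gamma> \<tturnstile> App x n v" "\<Gamma> \<tturnstile> Truth (rgt v)"
  shows "\<Gamma> \<tturnstile> EL w (lft u)"
  using m
proof (rule AppE)
  fix \<Delta> k assume \<Delta>: "\<Gamma> \<sqsubseteq> \<Delta>" "\<Delta> \<tturnstile> cmpt k \<doteq> one" "\<Delta> \<tturnstile> lft k \<doteq> pr e n" "\<Delta> \<tturnstile> val k \<doteq> m"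
  \<comment> \<open>Any computation tree \<open>k\<close> of \<open>e n\<close> provides an index of
    \<open>w\<close> at which this element is listed.\<close>
  define j where "j = pr n k"
  have tree: "\<Delta> \<tturnstile> is_tree e j"
    unfolding is_tree_def j_def by (rule conjI) (use \<Delta> in \<open>simp_all add: eq_iff\<close>)
  have yj: "\<Delta> \<tturnstile> App y (val (rgt j)) u"
    by (rule App_cong[OF wk[OF \<Delta>(1) u] refl _ refl]) (use \<Delta>(4) in \<open>simp add: eq_iff j_def\<close>)
  have xj: "\<Delta> \<tturnstile> App x (lft j) v"
    by (rule App_cong[OF wk[OF \<Delta>(1) v(1)] refl _ refl]) (simp add: eq_iff j_def)
  show "\<Delta> \<tturnstile> EL w (lft u)"
    using w_specD[OF wk[OF \<Delta>(1) w], of j]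
  proof (rule with_appE)
    fix \<Theta> r assume \<Theta>: "\<Delta> \<sqsubseteq> \<Theta>" "\<Theta> \<tturnstile> App w j r" "\<Theta> \<tturnstile> inst (w_rel (\<up> x) (\<up> y) (\<up> F) (\<up> e) (\<up> j) (Var 0)) r"
    have \<Gamma>\<Theta>: "\<Gamma> \<sqsubseteq> \<Theta>" using \<Delta>(1) \<Theta>(1) by blast
    have "\<Theta> \<tturnstile> w_rel x y F e j r" using \<Theta>(3) by (simp add: inst_def)
    then show "\<Theta> \<tturnstile> EL w (lft u)"
      unfolding w_rel_def
    proof (rule disjE)
      fix \<Lambda> assume \<Lambda>: "\<Theta> \<sqsubseteq> \<Lambda>" "\<Lambda> \<tturnstile> is_tree e j \<^bold>\<and> with_app y (val (rgt j)) (lft (\<up> r) \<doteq> lft (Var 0))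
        \<^bold>\<and> with_app x (lft j) (rgt (\<up> r) \<doteq> rgt (Var 0))"
      have *: "\<Delta> \<sqsubseteq> \<Lambda>" "\<Gamma> \<sqsubseteq> \<Lambda>" using \<Gamma>\<Theta> \<Theta>(1) \<Lambda>(1) by auto
      have "\<Lambda> \<tturnstile> lft r \<doteq> lft u"
        using with_appD[OF conjD1[OF conjD2[OF \<Lambda>(2)]] wk[OF *(1) yj]] by (simp add: inst_def)
      moreover have "\<Lambda> \<tturnstile> rgt r \<doteq> rgt v"
        using with_appD[OF conjD2[OF conjD2[OF \<Lambda>(2)]] wk[OF *(1) xj]] by (simp add: inst_def)
      ultimately show "\<Lambda> \<tturnstile> EL w (lft u)"
        by (intro ELI[OF wk[OF \<Lambda>(1) \<Theta>(2)] Truth_cong[OF wk[OF *(2) v(2)] sym] sym])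
    next
      fix \<Lambda> assume \<Lambda>: "\<Theta> \<sqsubseteq> \<Lambda>" "\<Lambda> \<tturnstile> (is_tree e j \<^bold>\<longrightarrow> Falsum) \<^bold>\<and> rgt r \<doteq> F"
      have "\<Delta> \<sqsubseteq> \<Lambda>" using \<Theta>(1) \<Lambda>(1) by blast
      from mp[OF conjD1[OF \<Lambda>(2)] wk[OF this tree]] show "\<Lambda> \<tturnstile> EL w (lft u)" by (rule FalsumE)
    qed
  qed
qed

text \<open>An entry with a true condition cannot carry \<open>F\<close>, so it stems from a tree,
  which gives back the argument \<open>n\<close> and the value of \<open>e\<close>.\<close>

lemma w_memberE:
  assumes w: "\<Gamma> \<tturnstile> w_spec x y F e w" and F: "\<Gamma> \<tturnstile> Truth F \<^bold>\<longrightarrow> Falsum" and b: "\<Gamma> \<tturnstile> EL w b"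
    and cont: "\<And>\<Delta> n m u v. \<Gamma> \<sqsubseteq> \<Delta> \<Longrightarrow> \<Delta> \<tturnstile> App e n m \<Longrightarrow> \<Delta> \<tturnstile> App y m u \<Longrightarrow> \<Delta> \<tturnstile> App x n v \<Longrightarrow>
      \<Delta> \<tturnstile> Truth (rgt v) \<Longrightarrow> \<Delta> \<tturnstile> b \<doteq> lft u \<Longrightarrow> \<Delta> \<tturnstile> \<chi>"
  shows "\<Gamma> \<tturnstile> \<chi>"
  using b
proof (rule ELE)
  fix \<Delta> j r assume \<Delta>: "\<Gamma> \<sqsubseteq> \<Delta>" "\<Delta> \<tturnstile> App w j r" "\<Delta> \<tturnstile> Truth (rgt r)" "\<Delta> \<tturnstile> b \<doteq> lft r"
  have "\<Delta> \<tturnstile> w_rel x y F e j r"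
    using with_appD[OF w_specD[OF wk[OF \<Delta>(1) w]] \<Delta>(2)] by (simp add: inst_def)
  then show "\<Delta> \<tturnstile> \<chi>"
  proof (rule w_relE)
    fix \<Theta> m u v
    assume \<Theta>: "\<Delta> \<sqsubseteq> \<Theta>" "\<Theta> \<tturnstile> App e (lft j) m" "\<Theta> \<tturnstile> App y m u" "\<Theta> \<tturnstile> App x (lft j) v"
      "\<Theta> \<tturnstile> lft u \<doteq> lft r" "\<Theta> \<tturnstile> rgt v \<doteq> rgt r"
    show "\<Theta> \<tturnstile> \<chi>"
    proof (rule cont[OF _ \<Theta>(2-4)])
      show "\<Gamma> \<sqsubseteq> \<Theta>" using \<Delta>(1) \<Theta>(1) by blast
      show "\<Theta> \<tturnstile> Truth (rgt v)" by (rule Truth_cong[OF wk[OF \<Theta>(1) \<Delta>(3)] sym[OF \<Theta>(6)]])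
      show "\<Theta> \<tturnstile> b \<doteq> lft u" by (rule trans[OF wk[OF \<Theta>(1) \<Delta>(4)] sym[OF \<Theta>(5)]])
    qed
  next
    fix \<Theta> assume \<Theta>: "\<Delta> \<sqsubseteq> \<Theta>" "\<Theta> \<tturnstile> F \<doteq> rgt r"
    have "\<Gamma> \<sqsubseteq> \<Theta>" using \<Delta>(1) \<Theta>(1) by blast
    from mp[OF wk[OF this F] Truth_cong[OF wk[OF \<Theta>(1) \<Delta>(3)] sym[OF \<Theta>(2)]]]
    show "\<Theta> \<tturnstile> \<chi>" by (rule FalsumE)
  qed
qed

text \<open>In \<open>choice_rel\<close> and \<open>subcoll\<close>, the parameters of \<open>\<psi>\<close> are moved below \<open>k\<close> binders.\<close>

definition choice_rel :: "fm \<Rightarrow> nat \<Rightarrow> tm \<Rightarrow> tm \<Rightarrow> tm \<Rightarrow> tm \<Rightarrow> tm \<Rightarrow> fm" where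
  "choice_rel \<psi> k x y c n m = with_app x n (with_app (\<up> y) (\<up> m)
     (Truth (rgt (Var 0)) \<^bold>\<and> at \<psi> [lft (Var 1), lft (Var 0), \<up> (\<up> c)] (k + 2)))"

lemma subst_choice_rel:
  assumes "\<And>j. \<sigma> (j + k) = Var (j + k')"
  shows "subst \<sigma> (choice_rel \<psi> k x y c n m) = choice_rel \<psi> k' (subst_tm \<sigma> x) (subst_tm \<sigma> y)
    (subst_tm \<sigma> c) (subst_tm \<sigma> n) (subst_tm \<sigma> m)"
proof -
  have "up (up \<sigma>) (j + (k + 2)) = Var (j + (k' + 2))" for j using assms[of j] by (simp add: numeral_2_eq_2)
  from subst_at[OF this] show ?thesis by (simp add: choice_rel_def)
qed

lemma at_cong:
  assumes "\<Gamma> \<tturnstile> at \<psi> [a, b, c] 0" and "\<Gamma> \<tturnstile> a \<doteq> a'" and "\<Gamma> \<tturnstile> b \<doteq> b'"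
  shows "\<Gamma> \<tturnstile> at \<psi> [a', b', c] 0"
proof -
  have *: "inst (at \<psi> ts 1) s = at \<psi> (map (subst_tm (case_nat s Var)) ts) 0" for ts s
    unfolding inst_def by (rule subst_at) simp
  have "\<Gamma> \<tturnstile> at \<psi> [a', b, c] 0"
    using subst_cong[OF assms(2), of "at \<psi> [Var 0, \<up> b, \<up> c] 1"] assms(1) by (simp add: *[simplified])
  then show ?thesis
    using subst_cong[OF assms(3), of "at \<psi> [\<up> a', Var 0, \<up> c] 1"] by (simp add: *[simplified])
qed

lemma inst_some_in_at:
  "inst (some_in (\<up> y) (at \<psi> [Var 1, Var 0, \<up> (\<up> c)] 2)) a = some_in y (at \<psi> [\<up> a, Var 0, \<up> c] 1)"
  "inst (some_in (\<up> y) (at \<psi> [Var 0, Var 1, \<up> (\<up> c)] 2)) a = some_in y (at \<psi> [Var 0, \<up> a, \<up> c] 1)"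
  unfolding inst_def subst_some_in by (subst subst_at[where k' = 1]; simp add: numeral_2_eq_2)+

lemma inst_at:
  "inst (at \<psi> [\<up> a, Var 0, \<up> c] 1) b = at \<psi> [a, b, c] 0"
  "inst (at \<psi> [Var 0, \<up> a, \<up> c] 1) b = at \<psi> [b, a, c] 0"
  unfolding inst_def by (subst subst_at[where k' = 0]; simp)+

lemma almost_negative_App: "almost_negative (App e n m)"
  unfolding App_def by (intro almost_negative.intros(1) sigma1.intros quantifier_free.intros)

text \<open>The choice property of \<open>e\<close> is stated as an elimination rule with an
  arbitrary goal \<open>\<xi>\<close>, which absorbs the nested existential quantifiers over
  \<open>e n\<close> and over the value of \<open>y\<close> there.\<close>

lemma choice_index:
  assumes x: "\<Gamma> \<tturnstile> Vset x" and H: "\<Gamma> \<tturnstile> all_in x (some_in (\<up> y) (at \<psi> [Var 1, Var 0, \<up> (\<up> c)] 2))"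
    and cont: "\<And>\<Delta> e. \<Gamma> \<sqsubseteq> \<Delta> \<Longrightarrow>
      (\<And>\<Theta> n v \<xi>. \<Delta> \<sqsubseteq> \<Theta> \<Longrightarrow> \<Theta> \<tturnstile> App x n v \<Longrightarrow> \<Theta> \<tturnstile> Truth (rgt v) \<Longrightarrow>
        (\<And>\<Lambda> m u. \<Theta> \<sqsubseteq> \<Lambda> \<Longrightarrow> \<Lambda> \<tturnstile> App e n m \<Longrightarrow> \<Lambda> \<tturnstile> App y m u \<Longrightarrow> \<Lambda> \<tturnstile> Truth (rgt u) \<Longrightarrow>
          \<Lambda> \<tturnstile> at \<psi> [lft v, lft u, c] 0 \<Longrightarrow> \<Lambda> \<tturnstile> \<xi>) \<Longrightarrow> \<Theta> \<tturnstile> \<xi>) \<Longrightarrow> \<Delta> \<tturnstile> \<chi>"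
  shows "\<Gamma> \<tturnstile> \<chi>"
proof -
  \<comment> \<open>Truth of \<open>cd_x(n)\<close> in universal form. The form with
    \<open>with_app\<close> would put an existential quantifier in front of a \<open>Truth\<close>
    atom and so fail to be almost negative; here the \<open>\<Sigma>\<close>1 formula
    \<open>App\<close> stands to the left of an implication.\<close>
  let ?\<phi> = "Forall (App (\<up> (\<up> x)) (Var 1) (Var 0) \<^bold>\<longrightarrow> Truth (rgt (Var 0)))"
  let ?\<psi> = "choice_rel \<psi> 2 (\<up> (\<up> x)) (\<up> (\<up> y)) (\<up> (\<up> c)) (Var 1) (Var 0)"
  have inst_\<phi>: "inst ?\<phi> n = Forall (App (\<up> x) (\<up> n) (Var 0) \<^bold>\<longrightarrow> Truth (rgt (Var 0)))" for n
    by (simp add: inst_def)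
  have inst1: "inst1 ?\<psi> n = choice_rel \<psi> 1 (\<up> x) (\<up> y) (\<up> c) (\<up> n) (Var 0)" for n
    unfolding inst1_def by (subst subst_choice_rel[where k' = 1]) (simp_all add: numeral_2_eq_2)
  have inst0: "inst (choice_rel \<psi> 1 (\<up> x) (\<up> y) (\<up> c) (\<up> n) (Var 0)) m = choice_rel \<psi> 0 x y c n m" for n m
    unfolding inst_def by (subst subst_choice_rel[where k' = 0]) simp_all
  have body1: "inst (with_app (\<up> y) (\<up> m) (Truth (rgt (Var 0)) \<^bold>\<and> at \<psi> [lft (Var 1), lft (Var 0), \<up> (\<up> c)] (0 + 2))) v =
      with_app y m (Truth (rgt (Var 0)) \<^bold>\<and> at \<psi> [\<up> (lft v), lft (Var 0), \<up> c] 1)" for m v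
    unfolding inst_def by simp (subst subst_at[where k' = 1]; simp add: numeral_2_eq_2)
  have body0: "inst (Truth (rgt (Var 0)) \<^bold>\<and> at \<psi> [\<up> (lft v), lft (Var 0), \<up> c] 1) u =
      (Truth (rgt u) \<^bold>\<and> at \<psi> [lft v, lft u, c] 0)" for u v
    unfolding inst_def by simp (subst subst_at[where k' = 0]; simp)
  show ?thesis
  proof (rule ect[of ?\<phi> _ ?\<psi>])
    show "almost_negative ?\<phi>"
      by (intro almost_negative.intros(4,6,7) almost_negative_App)
  next
    fix \<Delta> n assume \<Delta>: "\<Gamma> \<sqsubseteq> \<Delta>" "\<Delta> \<tturnstile> inst ?\<phi> n"
    show "\<Delta> \<tturnstile> Exists (inst1 ?\<psi> n)"
      using wk[OF \<Delta>(1) x]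
    proof (rule Vset_app[where n = n])
      fix \<Theta> v assume \<Theta>: "\<Delta> \<sqsubseteq> \<Theta>" "\<Theta> \<tturnstile> App x n v"
      have \<Gamma>\<Theta>: "\<Gamma> \<sqsubseteq> \<Theta>" using \<Delta>(1) \<Theta>(1) by blast
      \<comment> \<open>Totality of \<open>x\<close> has supplied the value \<open>v\<close>, to
        which the universal form applies.\<close>
      have "\<Theta> \<tturnstile> App x n v \<^bold>\<longrightarrow> Truth (rgt v)"
        using allE[OF wk[OF \<Theta>(1) \<Delta>(2)[unfolded inst_\<phi>]], of v] by (simp add: inst_def)
      from mp[OF this \<Theta>(2)] have "\<Theta> \<tturnstile> EL x (lft v)" by (rule ELI[OF \<Theta>(2) _ refl])
      from all_inD[OF wk[OF \<Gamma>\<Theta> H] this, unfolded inst_some_in_at] show "\<Theta> \<tturnstile> Exists (inst1 ?\<psi> n)"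
      proof (rule some_inE)
        fix \<Lambda> b assume \<Lambda>: "\<Theta> \<sqsubseteq> \<Lambda>" "\<Lambda> \<tturnstile> EL y b" "\<Lambda> \<tturnstile> inst (at \<psi> [\<up> (lft v), Var 0, \<up> c] 1) b"
        note ab = \<Lambda>(3)[unfolded inst_at]
        show "\<Lambda> \<tturnstile> Exists (inst1 ?\<psi> n)"
          using \<Lambda>(2)
        proof (rule ELE)
          fix \<Phi> m u assume \<Phi>: "\<Lambda> \<sqsubseteq> \<Phi>" "\<Phi> \<tturnstile> App y m u" "\<Phi> \<tturnstile> Truth (rgt u)" "\<Phi> \<tturnstile> b \<doteq> lft u"
          have "\<Theta> \<sqsubseteq> \<Phi>" using \<Lambda>(1) \<Phi>(1) by blast
          have "\<Phi> \<tturnstile> choice_rel \<psi> 0 x y c n m"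
            unfolding choice_rel_def
            by (rule with_appI[OF wk[OF \<open>\<Theta> \<sqsubseteq> \<Phi>\<close> \<Theta>(2)]], unfold body1, rule with_appI[OF \<Phi>(2)],
                unfold body0, rule conjI[OF \<Phi>(3) at_cong[OF wk[OF \<Phi>(1) ab] refl \<Phi>(4)]])
          then show "\<Phi> \<tturnstile> Exists (inst1 ?\<psi> n)"
            unfolding inst1 by (intro exI[where t = m]) (simp only: inst0)
        qed
      qed
    qed
  next
    fix \<Delta> e
    assume \<Delta>: "\<Gamma> \<sqsubseteq> \<Delta>" "\<And>\<Theta> n. \<Delta> \<sqsubseteq> \<Theta> \<Longrightarrow> \<Theta> \<tturnstile> inst ?\<phi> n \<Longrightarrow> \<Theta> \<tturnstile> with_app e n (inst1 ?\<psi> n)"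
    show "\<Delta> \<tturnstile> \<chi>"
    proof (rule cont[OF \<Delta>(1)])
      fix \<Theta> n v \<xi>
      assume \<Theta>: "\<Delta> \<sqsubseteq> \<Theta>" "\<Theta> \<tturnstile> App x n v" "\<Theta> \<tturnstile> Truth (rgt v)"
        and \<xi>: "\<And>\<Lambda> m u. \<Theta> \<sqsubseteq> \<Lambda> \<Longrightarrow> \<Lambda> \<tturnstile> App e n m \<Longrightarrow> \<Lambda> \<tturnstile> App y m u \<Longrightarrow> \<Lambda> \<tturnstile> Truth (rgt u) \<Longrightarrow>
          \<Lambda> \<tturnstile> at \<psi> [lft v, lft u, c] 0 \<Longrightarrow> \<Lambda> \<tturnstile> \<xi>"
      \<comment> \<open>Conversely, single-valuedness spreads truth from \<open>v\<close> to every
        value of \<open>x n\<close>, which yields the universal form.\<close>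
      have "\<Theta> \<tturnstile> App x n v' \<^bold>\<longrightarrow> Truth (rgt v')" for v'
      proof (rule impI)
        fix \<Lambda> assume \<Lambda>: "\<Theta> \<sqsubseteq> \<Lambda>" "\<Lambda> \<tturnstile> App x n v'"
        have "\<Lambda> \<tturnstile> rgt v \<doteq> rgt v'" using App_unique[OF wk[OF \<Lambda>(1) \<Theta>(2)] \<Lambda>(2)] by (simp add: eq_iff)
        then show "\<Lambda> \<tturnstile> Truth (rgt v')" by (rule Truth_cong[OF wk[OF \<Lambda>(1) \<Theta>(3)]])
      qed
      then have "\<Theta> \<tturnstile> inst ?\<phi> n" unfolding inst_\<phi> by (intro allI) (simp add: inst_def)
      from \<Delta>(2)[OF \<Theta>(1) this, unfolded inst1] show "\<Theta> \<tturnstile> \<xi>"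
      proof (rule with_appE, unfold inst0)
        fix \<Lambda> m assume \<Lambda>: "\<Theta> \<sqsubseteq> \<Lambda>" "\<Lambda> \<tturnstile> App e n m" "\<Lambda> \<tturnstile> choice_rel \<psi> 0 x y c n m"
        from with_appD[OF \<Lambda>(3)[unfolded choice_rel_def] wk[OF \<Lambda>(1) \<Theta>(2)], unfolded body1] show "\<Lambda> \<tturnstile> \<xi>"
        proof (rule with_appE, unfold body0)
          fix \<Phi> u assume \<Phi>: "\<Lambda> \<sqsubseteq> \<Phi>" "\<Phi> \<tturnstile> App y m u" "\<Phi> \<tturnstile> Truth (rgt u) \<^bold>\<and> at \<psi> [lft v, lft u, c] 0"
          have "\<Theta> \<sqsubseteq> \<Phi>" using \<Lambda>(1) \<Phi>(1) by blast
          from \<xi>[OF this wk[OF \<Phi>(1) \<Lambda>(2)] \<Phi>(2) conjD1[OF \<Phi>(3)] conjD2[OF \<Phi>(3)]] show "\<Phi> \<tturnstile> \<xi>" .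
        qed
      qed
    qed
  qed
qed

section \<open>Subset collection for fixed sets\<close>

definition subcoll :: "fm \<Rightarrow> fm \<Rightarrow> nat \<Rightarrow> tm \<Rightarrow> tm \<Rightarrow> tm \<Rightarrow> tm \<Rightarrow> fm" where
  "subcoll E \<psi> k x y z c =
    (all_in x (some_in (\<up> y) (at \<psi> [Var 1, Var 0, \<up> (\<up> c)] (k + 2))) \<^bold>\<longrightarrow>
     some_in z (subset_fm E (Var 0) (\<up> y)
       \<^bold>\<and> all_in (\<up> x) (some_in (Var 1) (at \<psi> [Var 1, Var 0, \<up> (\<up> (\<up> c))] (k + 3)))
       \<^bold>\<and> all_in (Var 0) (some_in (\<up> (\<up> x)) (at \<psi> [Var 0, Var 1, \<up> (\<up> (\<up> c))] (k + 3)))))"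

lemma subset_collection_alt:
  "subset_collection E \<psi> = all_sets (all_sets (some_set (all_sets (subcoll E \<psi> 4 (Var 3) (Var 2) (Var 1) (Var 0)))))"
  by (simp add: subset_collection_def subcoll_def numeral_eq_Suc)

lemma subst_subcoll:
  assumes "\<And>j. \<sigma> (j + k) = Var (j + k')"
  shows "subst \<sigma> (subcoll E \<psi> k x y z c) =
    subcoll E \<psi> k' (subst_tm \<sigma> x) (subst_tm \<sigma> y) (subst_tm \<sigma> z) (subst_tm \<sigma> c)"
proof -
  have 2: "up (up \<sigma>) (j + (k + 2)) = Var (j + (k' + 2))" for j using assms[of j] by (simp add: numeral_eq_Suc)
  have 3: "up (up (up \<sigma>)) (j + (k + 3)) = Var (j + (k' + 3))" for j using assms[of j] by (simp add: numeral_eq_Suc)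
  show ?thesis by (simp add: subcoll_def subst_at[OF 2, simplified] subst_at[OF 3])
qed

text \<open>Each instantiation of an outer quantifier leaves the parameters of \<open>\<psi>\<close>
  one binder fewer to pass, so \<open>k\<close> counts down from 4 to 0.\<close>

lemma inst_subcoll:
  "inst (all_sets (some_set (all_sets (subcoll E \<psi> 4 (Var 3) (Var 2) (Var 1) (Var 0))))) x =
    all_sets (some_set (all_sets (subcoll E \<psi> 3 (\<up> (\<up> (\<up> x))) (Var 2) (Var 1) (Var 0))))"
  "inst (some_set (all_sets (subcoll E \<psi> 3 (\<up> (\<up> (\<up> x))) (Var 2) (Var 1) (Var 0)))) y =
    some_set (all_sets (subcoll E \<psi> 2 (\<up> (\<up> x)) (\<up> (\<up> y)) (Var 1) (Var 0)))"
  "inst (all_sets (subcoll E \<psi> 2 (\<up> (\<up> x)) (\<up> (\<up> y)) (Var 1) (Var 0))) z =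
    all_sets (subcoll E \<psi> 1 (\<up> x) (\<up> y) (\<up> z) (Var 0))"
  "inst (subcoll E \<psi> 1 (\<up> x) (\<up> y) (\<up> z) (Var 0)) c = subcoll E \<psi> 0 x y z c"
  unfolding inst_def subst_all_sets subst_some_set
     apply (subst subst_subcoll[where k' = 3]; simp add: numeral_eq_Suc)
    apply (subst subst_subcoll[where k' = 2]; simp add: numeral_eq_Suc)
   apply (subst subst_subcoll[where k' = 1]; simp add: numeral_eq_Suc)
  apply (subst subst_subcoll[where k' = 0]; simp)
  done

text \<open>A choice index \<open>e\<close> for \<open>c\<close> makes its own condition true, so
  its image is already listed in \<open>z\<close>, at place \<open>e\<close>.\<close>

lemma subcoll_holds:
  assumes E: "extensional_equality \<Xi> E"
    and x: "\<Gamma> \<tturnstile> Vset x" and y: "\<Gamma> \<tturnstile> Vset y" and f: "\<Gamma> \<tturnstile> cd_spec x f" and h: "\<Gamma> \<tturnstile> cd_spec y h"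
    and F: "\<Gamma> \<tturnstile> Truth F \<^bold>\<longrightarrow> Falsum" and z: "\<Gamma> \<tturnstile> z_spec x y F f h z"
  shows "\<Gamma> \<tturnstile> subcoll E \<psi> 0 x y z c"
  unfolding subcoll_def add_0
proof (rule impI)
  let ?G = "subset_fm E (Var 0) (\<up> y)
       \<^bold>\<and> all_in (\<up> x) (some_in (Var 1) (at \<psi> [Var 1, Var 0, \<up> (\<up> (\<up> c))] 3))
       \<^bold>\<and> all_in (Var 0) (some_in (\<up> (\<up> x)) (at \<psi> [Var 0, Var 1, \<up> (\<up> (\<up> c))] 3))"
  have inst_G: "inst ?G w = (subset_fm E w y
       \<^bold>\<and> all_in x (some_in (\<up> w) (at \<psi> [Var 1, Var 0, \<up> (\<up> c)] 2))
       \<^bold>\<and> all_in w (some_in (\<up> x) (at \<psi> [Var 0, Var 1, \<up> (\<up> c)] 2)))" for w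
  proof -
    have 3: "up (up (case_nat w Var)) (j + 3) = Var (j + 2)" for j by (simp add: numeral_eq_Suc)
    show ?thesis unfolding inst_def by (simp add: subst_at[OF 3])
  qed
  fix \<Delta> assume \<Delta>: "\<Gamma> \<sqsubseteq> \<Delta>" "\<Delta> \<tturnstile> all_in x (some_in (\<up> y) (at \<psi> [Var 1, Var 0, \<up> (\<up> c)] 2))"
  show "\<Delta> \<tturnstile> some_in z ?G"
  proof (rule choice_index[OF wk[OF \<Delta>(1) x] \<Delta>(2)])
    fix \<Theta> e
    assume \<Theta>: "\<Delta> \<sqsubseteq> \<Theta>"
      and e: "\<And>\<Lambda> n v \<xi>. \<Theta> \<sqsubseteq> \<Lambda> \<Longrightarrow> \<Lambda> \<tturnstile> App x n v \<Longrightarrow> \<Lambda> \<tturnstile> Truth (rgt v) \<Longrightarrow>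
        (\<And>\<Phi> m u. \<Lambda> \<sqsubseteq> \<Phi> \<Longrightarrow> \<Phi> \<tturnstile> App e n m \<Longrightarrow> \<Phi> \<tturnstile> App y m u \<Longrightarrow> \<Phi> \<tturnstile> Truth (rgt u) \<Longrightarrow>
          \<Phi> \<tturnstile> at \<psi> [lft v, lft u, c] 0 \<Longrightarrow> \<Phi> \<tturnstile> \<xi>) \<Longrightarrow> \<Lambda> \<tturnstile> \<xi>"
    have \<Gamma>\<Theta>: "\<Gamma> \<sqsubseteq> \<Theta>" using \<Delta>(1) \<Theta> by blast
    note wk\<Theta> = wk[OF \<Gamma>\<Theta>]
    have T: "\<Theta> \<tturnstile> Truth (cond f h e)"
    proof (rule cond_TruthI[OF x[THEN wk\<Theta>] y[THEN wk\<Theta>] f[THEN wk\<Theta>] h[THEN wk\<Theta>]])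
      fix \<Lambda> n v assume \<Lambda>: "\<Theta> \<sqsubseteq> \<Lambda>" "\<Lambda> \<tturnstile> App x n v" "\<Lambda> \<tturnstile> Truth (rgt v)"
      show "\<Lambda> \<tturnstile> with_app e n (with_app (\<up> y) (Var 0) (Truth (rgt (Var 0))))"
      proof (rule e[OF \<Lambda>])
        fix \<Phi> m u assume \<Phi>: "\<Phi> \<tturnstile> App e n m" "\<Phi> \<tturnstile> App y m u" "\<Phi> \<tturnstile> Truth (rgt u)"
        have "\<Phi> \<tturnstile> with_app y m (Truth (rgt (Var 0)))"
          by (rule with_appI[OF \<Phi>(2)]) (simp add: inst_def \<Phi>(3))
        then show "\<Phi> \<tturnstile> with_app e n (with_app (\<up> y) (Var 0) (Truth (rgt (Var 0))))"
          by (intro with_appI[OF \<Phi>(1)]) (simp add: inst_def)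
      qed
    qed
    show "\<Theta> \<tturnstile> some_in z ?G"
      using z[THEN wk\<Theta>]
    proof (rule z_specE[where e = e])
      fix \<Lambda> t assume \<Lambda>: "\<Theta> \<sqsubseteq> \<Lambda>" "\<Lambda> \<tturnstile> App z e t" "\<Lambda> \<tturnstile> w_spec x y F e (lft t)" "\<Lambda> \<tturnstile> cond f h e \<doteq> rgt t"
      define w where "w = lft t"
      have w: "\<Lambda> \<tturnstile> w_spec x y F e w" using \<Lambda>(3) by (simp add: w_def)
      have \<Gamma>\<Lambda>: "\<Gamma> \<sqsubseteq> \<Lambda>" using \<Gamma>\<Theta> \<Lambda>(1) by blast
      have wz: "\<Lambda> \<tturnstile> EL z w"
        by (rule ELI[OF \<Lambda>(2) Truth_cong[OF wk[OF \<Lambda>(1) T] \<Lambda>(4)]]) (simp add: w_def refl)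
      \<comment> \<open>An element of \<open>w\<close> comes from a true index \<open>n\<close> of
        \<open>x\<close>. Using the choice property at this \<open>n\<close> once more gives
        \<open>\<psi>\<close> for a value of \<open>e n\<close>, and by single-valuedness this is
        the value that produced \<open>b\<close>. Both the inclusion in \<open>y\<close> and the
        last clause follow.\<close>
      have elE: "\<Phi> \<tturnstile> \<xi>"
        if \<Phi>: "\<Lambda> \<sqsubseteq> \<Phi>" "\<Phi> \<tturnstile> EL w b"
          and cont: "\<And>\<Omega> n m u v. \<Phi> \<sqsubseteq> \<Omega> \<Longrightarrow> \<Omega> \<tturnstile> App y m u \<Longrightarrow> \<Omega> \<tturnstile> Truth (rgt u) \<Longrightarrow> \<Omega> \<tturnstile> b \<doteq> lft u \<Longrightarrow>
            \<Omega> \<tturnstile> EL x (lft v) \<Longrightarrow> \<Omega> \<tturnstile> at \<psi> [lft v, b, c] 0 \<Longrightarrow> \<Omega> \<tturnstile> \<xi>" for \<Phi> b \<xi>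
      proof -
        have \<Gamma>\<Phi>: "\<Gamma> \<sqsubseteq> \<Phi>" using \<Gamma>\<Lambda> \<Phi>(1) by blast
        show ?thesis
        proof (rule w_memberE[OF wk[OF \<Phi>(1) w] wk[OF \<Gamma>\<Phi> F] \<Phi>(2)])
          fix \<Omega> n m u v
          assume \<Omega>: "\<Phi> \<sqsubseteq> \<Omega>" "\<Omega> \<tturnstile> App e n m" "\<Omega> \<tturnstile> App y m u" "\<Omega> \<tturnstile> App x n v" "\<Omega> \<tturnstile> Truth (rgt v)" "\<Omega> \<tturnstile> b \<doteq> lft u"
          have "\<Theta> \<sqsubseteq> \<Omega>" using \<Lambda>(1) \<Phi>(1) \<Omega>(1) by blast
          then show "\<Omega> \<tturnstile> \<xi>"
            using \<Omega>(4,5)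
          proof (rule e)
            fix \<Pi> m' u'
            assume \<Pi>: "\<Omega> \<sqsubseteq> \<Pi>" "\<Pi> \<tturnstile> App e n m'" "\<Pi> \<tturnstile> App y m' u'" "\<Pi> \<tturnstile> Truth (rgt u')" "\<Pi> \<tturnstile> at \<psi> [lft v, lft u', c] 0"
            note \<Omega>\<Pi> = \<Omega>(2-6)[THEN wk[OF \<Pi>(1)]]
            have "\<Pi> \<tturnstile> App y m u'"
              by (rule App_cong[OF \<Pi>(3) refl App_unique[OF \<Pi>(2) \<Omega>\<Pi>(1)] refl])
            from App_unique[OF this \<Omega>\<Pi>(2)] have "\<Pi> \<tturnstile> b \<doteq> lft u'"
              using \<Omega>\<Pi>(5) by (simp add: eq_iff)
            then show "\<Pi> \<tturnstile> \<xi>"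
              by (intro cont[OF _ \<Pi>(3,4) _ ELI[OF \<Omega>\<Pi>(3,4) refl] at_cong[OF \<Pi>(5) refl sym]])
                (use \<Omega>(1) \<Pi>(1) in blast)
          qed
        qed
      qed
      have "\<Lambda> \<tturnstile> subset_fm E w y"
        unfolding subset_fm_def
      proof (rule all_inI)
        fix \<Phi> b assume \<Phi>: "\<Lambda> \<sqsubseteq> \<Phi>" "\<Phi> \<tturnstile> EL w b"
        have "\<Phi> \<tturnstile> set_mem E b y"
          using \<Phi>
        proof (rule elE)
          fix \<Omega> m u assume \<Omega>: "\<Phi> \<sqsubseteq> \<Omega>" "\<Omega> \<tturnstile> App y m u" "\<Omega> \<tturnstile> Truth (rgt u)" "\<Omega> \<tturnstile> b \<doteq> lft u"
          have \<Gamma>\<Omega>: "\<Gamma> \<sqsubseteq> \<Omega>" using \<Gamma>\<Lambda> \<Phi>(1) \<Omega>(1) by blast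
          \<comment> \<open>\<open>b\<close> lies literally in \<open>EL y\<close>, so membership up
            to \<open>E\<close> reduces to reflexivity.\<close>
          have "\<Omega> \<tturnstile> rel2 E b b"
            by (rule rel2_refl[OF E Vset_cong[OF Vset_el[OF wk[OF \<Gamma>\<Omega> y] \<Omega>(2,3)] sym[OF \<Omega>(4)]]])
          then show "\<Omega> \<tturnstile> set_mem E b y"
            unfolding set_mem_def by (intro some_inI[OF ELI[OF \<Omega>(2-4)]]) (simp add: inst_def)
        qed
        then show "\<Phi> \<tturnstile> inst (set_mem E (Var 0) (\<up> y)) b" by (simp add: inst_def)
      qed
      moreover have "\<Lambda> \<tturnstile> all_in x (some_in (\<up> w) (at \<psi> [Var 1, Var 0, \<up> (\<up> c)] 2))"
      proof (rule all_inI, unfold inst_some_in_at)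
        fix \<Phi> a assume \<Phi>: "\<Lambda> \<sqsubseteq> \<Phi>" "\<Phi> \<tturnstile> EL x a"
        show "\<Phi> \<tturnstile> some_in w (at \<psi> [\<up> a, Var 0, \<up> c] 1)"
          using \<Phi>(2)
        proof (rule ELE)
          fix \<Omega> n v assume \<Omega>: "\<Phi> \<sqsubseteq> \<Omega>" "\<Omega> \<tturnstile> App x n v" "\<Omega> \<tturnstile> Truth (rgt v)" "\<Omega> \<tturnstile> a \<doteq> lft v"
          have "\<Theta> \<sqsubseteq> \<Omega>" using \<Lambda>(1) \<Phi>(1) \<Omega>(1) by blast
          then show "\<Omega> \<tturnstile> some_in w (at \<psi> [\<up> a, Var 0, \<up> c] 1)"
            using \<Omega>(2,3)
          proof (rule e)
            fix \<Pi> m u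
            assume \<Pi>: "\<Omega> \<sqsubseteq> \<Pi>" "\<Pi> \<tturnstile> App e n m" "\<Pi> \<tturnstile> App y m u" "\<Pi> \<tturnstile> at \<psi> [lft v, lft u, c] 0"
            have "\<Lambda> \<sqsubseteq> \<Pi>" using \<Phi>(1) \<Omega>(1) \<Pi>(1) by blast
            note \<Omega>\<Pi> = \<Omega>(2-4)[THEN wk[OF \<Pi>(1)]]
            show "\<Pi> \<tturnstile> some_in w (at \<psi> [\<up> a, Var 0, \<up> c] 1)"
              by (rule some_inI[OF w_member[OF wk[OF \<open>\<Lambda> \<sqsubseteq> \<Pi>\<close> w] \<Pi>(2,3) \<Omega>\<Pi>(1,2)]], unfold inst_at)
                (rule at_cong[OF \<Pi>(4) sym[OF \<Omega>\<Pi>(3)] refl])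
          qed
        qed
      qed
      moreover have "\<Lambda> \<tturnstile> all_in w (some_in (\<up> x) (at \<psi> [Var 0, Var 1, \<up> (\<up> c)] 2))"
      proof (rule all_inI, unfold inst_some_in_at)
        fix \<Phi> b assume \<Phi>: "\<Lambda> \<sqsubseteq> \<Phi>" "\<Phi> \<tturnstile> EL w b"
        show "\<Phi> \<tturnstile> some_in x (at \<psi> [Var 0, \<up> b, \<up> c] 1)"
          using \<Phi>
        proof (rule elE)
          fix \<Omega> v assume \<Omega>: "\<Omega> \<tturnstile> EL x (lft v)" "\<Omega> \<tturnstile> at \<psi> [lft v, b, c] 0"
          then show "\<Omega> \<tturnstile> some_in x (at \<psi> [Var 0, \<up> b, \<up> c] 1)"
            by (intro some_inI[OF \<Omega>(1)]) (simp only: inst_at)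
        qed
      qed
      ultimately show "\<Lambda> \<tturnstile> some_in z ?G"
        by (intro some_inI[OF wz]) (simp only: inst_G, intro conjI)
    qed
  qed
qed

end

theorem theorem9:
  fixes \<Xi> :: prsym and E \<psi> :: fm
  assumes "injective_pair_coding \<Xi>"
    and "extensional_equality \<Xi> E"
  shows "\<Xi>; [] \<turnstile> subset_collection E \<psi>"
proof -
  interpret v_system \<Xi> .
  show ?thesis
    unfolding subset_collection_alt
  proof (rule all_setsI, unfold inst_subcoll, rule all_setsI, unfold inst_subcoll)
    fix \<Delta> x \<Theta> y
    assume "\<Delta> \<tturnstile> Vset x" and "\<Delta> \<sqsubseteq> \<Theta>" and y: "\<Theta> \<tturnstile> Vset y"
    then have x: "\<Theta> \<tturnstile> Vset x" using wk by blast
    let ?G = "all_sets (subcoll E \<psi> 2 (\<up> (\<up> x)) (\<up> (\<up> y)) (Var 1) (Var 0))"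
    \<comment> \<open>The indices \<open>f\<close> and \<open>h\<close>, the false condition
      \<open>F\<close> and finally \<open>z\<close> are all obtained before \<open>c\<close> is
      introduced, as the order of quantifiers demands.\<close>
    show "\<Theta> \<tturnstile> some_set ?G"
    proof (rule cd_index[OF x])
      fix \<Delta>1 f assume 1: "\<Theta> \<sqsubseteq> \<Delta>1" "\<Delta>1 \<tturnstile> cd_spec x f"
      show "\<Delta>1 \<tturnstile> some_set ?G"
      proof (rule cd_index[OF wk[OF 1(1) y]])
        fix \<Delta>2 h assume 2: "\<Delta>1 \<sqsubseteq> \<Delta>2" "\<Delta>2 \<tturnstile> cd_spec y h"
        show "\<Delta>2 \<tturnstile> some_set ?G"
        proof (rule false_condition)
          fix \<Delta>3 F assume 3: "\<Delta>2 \<sqsubseteq> \<Delta>3" "\<Delta>3 \<tturnstile> Meaningful F" "\<Delta>3 \<tturnstile> Truth F \<^bold>\<longrightarrow> Falsum"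
          have s3: "\<Theta> \<sqsubseteq> \<Delta>3" "\<Delta>1 \<sqsubseteq> \<Delta>3" using 1(1) 2(1) 3(1) by auto
          show "\<Delta>3 \<tturnstile> some_set ?G"
          proof (rule z_index[OF wk[OF s3(1) x] wk[OF s3(1) y]])
            fix \<Delta>4 z assume 4: "\<Delta>3 \<sqsubseteq> \<Delta>4" "\<Delta>4 \<tturnstile> z_spec x y F f h z"
            have s4: "\<Theta> \<sqsubseteq> \<Delta>4" "\<Delta>1 \<sqsubseteq> \<Delta>4" "\<Delta>2 \<sqsubseteq> \<Delta>4" using s3 3(1) 4(1) by auto
            note facts = wk[OF s4(1) x] wk[OF s4(1) y] wk[OF s4(2) 1(2)] wk[OF s4(3) 2(2)]
            note F = 3(2,3)[THEN wk[OF 4(1)]]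
            show "\<Delta>4 \<tturnstile> some_set ?G"
            proof (rule some_setI[OF z_Vset[OF facts F 4(2)]], unfold inst_subcoll, rule all_setsI,
                unfold inst_subcoll)
              fix \<Delta>5 c assume "\<Delta>4 \<sqsubseteq> \<Delta>5"
              note wk5 = wk[OF this]
              show "\<Delta>5 \<tturnstile> subcoll E \<psi> 0 x y z c"
                by (rule subcoll_holds[OF assms(2) facts[THEN wk5] F(2)[THEN wk5] 4(2)[THEN wk5]])
            qed
          qed
        qed
      qed
    qed
  qed
qed

end
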